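(* Let $\mathbb{M}^2=(\mathbb{R}^2,\|\cdot\|)$ be a strictly convex normed plane. If $K\subset\mathbb{M}^2$ is a set of $n$ points and $\lambda\ge\lambda_K$, then the $\lambda$-ball intersection $\mathrm{bi}(K,\lambda)$ can be constructed via an algorithm taking $O(n\log n)$ time.
   Context: $B(x,\lambda)=\{y:\|y-x\|\le\lambda\}$ is the disc with center $x$ and radius $\lambda>0$, and $S(x,\lambda)$ is its boundary circle. The normed plane is strictly convex if its unit circle contains no non-degenerate line segment. For a finite set $K$ of points, $\lambda_K$ (the circumradius, or minimal enclosing radius) is the smallest number such that $K$ is contained in a translate of $\lambda_K B(o,1)$, where $o$ is the origin. The $\lambda$-ball intersection of $K$ is $\mathrm{bi}(K,\lambda)=\bigcap_{x\in K}B(x,\lambda)$; its boundary consists of circular arcs of radius $\lambda$ with centers in $K$, and its vertices are the endpoints of these arcs. Constructing $\mathrm{bi}(K,\lambda)$ means producing the ordered list of the arcs (with their centers) and the vertices along its boundary. Running time is counted as the number of elementary operations, where the norm is fixed and the following are constant-time operations: arithmetic and comparison of real coordinates, evaluation of the norm, computing the intersection points of two circles of the same radius $\lambda$, computing the points of a circle at which its supporting lines of a fixed direction touch it, and comparing the positions of points along a circle. *)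

theory Defs
  imports "HOL-Analysis.Analysis" "HOL-Library.Landau_Symbols"
begin

section \<open>Normed planes and ball intersections\<close>

type_synonym pt = "real \<times> real"

definition is_norm :: "(pt \<Rightarrow> real) \<Rightarrow> bool" where
  "is_norm N \<longleftrightarrow>
     (\<forall>x. N x = 0 \<longleftrightarrow> x = 0) \<and>
     (\<forall>a x. N (a *\<^sub>R x) = \<bar>a\<bar> * N x) \<and>
     (\<forall>x y. N (x + y) \<le> N x + N y)"

definition disc :: "(pt \<Rightarrow> real) \<Rightarrow> pt \<Rightarrow> real \<Rightarrow> pt set" where
  "disc N x r = {y. N (y - x) \<le> r}"

definition circle :: "(pt \<Rightarrow> real) \<Rightarrow> pt \<Rightarrow> real \<Rightarrow> pt set" where
  "circle N x r = {y. N (y - x) = r}"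

definition strictly_convex :: "(pt \<Rightarrow> real) \<Rightarrow> bool" where
  "strictly_convex N \<longleftrightarrow> (\<forall>a b. a \<noteq> b \<longrightarrow> \<not> closed_segment a b \<subseteq> circle N 0 1)"

definition circumradius :: "(pt \<Rightarrow> real) \<Rightarrow> pt set \<Rightarrow> real" where
  "circumradius N K = (LEAST r. \<exists>c. K \<subseteq> disc N c r)"

definition bi :: "(pt \<Rightarrow> real) \<Rightarrow> pt set \<Rightarrow> real \<Rightarrow> pt set" where
  "bi N K r = (\<Inter>x\<in>K. disc N x r)"

definition det2 :: "pt \<Rightarrow> pt \<Rightarrow> real" where
  "det2 u v = fst u * snd v - snd u * fst v"

text \<open>
  The closed arc of a circle traversed counterclockwise from \<open>p\<close> to \<open>q\<close>, for distinct points
  \<open>p\<close>, \<open>q\<close> of the circle. Since the circle is a convex curve, this is its part on the right of the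
  directed chord from \<open>p\<close> to \<open>q\<close>.
\<close>
definition ccw_arc :: "(pt \<Rightarrow> real) \<Rightarrow> pt \<Rightarrow> real \<Rightarrow> pt \<Rightarrow> pt \<Rightarrow> pt set" where
  "ccw_arc N c r p q = {z \<in> circle N c r. det2 (q - p) (z - p) \<le> 0}"

text \<open>
  The boundary of a ball intersection is represented by the list \<open>cs\<close> of the centers of its arcs and
  the list \<open>vs\<close> of its vertices, both in counterclockwise order: the arc with center \<open>cs ! i\<close> runs
  from \<open>vs ! i\<close> to the cyclically next vertex. As the centers are distinct, no arc is cut into
  pieces. Two cases have fewer than two vertices: a full circle is one arc without vertices, and a
  ball intersection that is a single point has this point as its only vertex and no arcs.
\<close>
definition describes_boundary ::
    "(pt \<Rightarrow> real) \<Rightarrow> pt set \<Rightarrow> real \<Rightarrow> pt list \<Rightarrow> pt list \<Rightarrow> bool" where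
  "describes_boundary N K r cs vs \<longleftrightarrow>
     (\<exists>x\<in>K. cs = [x] \<and> vs = [] \<and> frontier (bi N K r) = circle N x r) \<or>
     (\<exists>p. cs = [] \<and> vs = [p] \<and> frontier (bi N K r) = {p}) \<or>
     (let m = length vs; nxt = (\<lambda>i. vs ! (Suc i mod m)) in
        2 \<le> m \<and> length cs = m \<and> distinct vs \<and> distinct cs \<and> set cs \<subseteq> K \<and>
        (\<forall>i<m. vs ! i \<in> circle N (cs ! i) r \<and> nxt i \<in> circle N (cs ! i) r) \<and>
        frontier (bi N K r) = (\<Union>i<m. ccw_arc N (cs ! i) r (vs ! i) (nxt i)))"


section \<open>Algorithms and their running time\<close>

text \<open>
  Algorithms are programs of a first-order functional language with mutually recursive functions,
  working on binary trees with real numbers at the leaves. Programs are finite syntactic objects that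
  do not depend on the input, and they access real numbers through the primitive operations only.
  On a real random access machine that has these primitives, a tree is a pointer to a cell, so that
  every evaluation step, counted below with cost 1, takes constant time.
\<close>

datatype val = VReal real | VNil | VPair val val

definition enc_pt :: "pt \<Rightarrow> val" where
  "enc_pt p = VPair (VReal (fst p)) (VReal (snd p))"

fun enc_pts :: "pt list \<Rightarrow> val" where
  "enc_pts [] = VNil"
| "enc_pts (p # ps) = VPair (enc_pt p) (enc_pts ps)"

text \<open>As in Lisp, \<open>VNil\<close> is the only value that counts as false.\<close>
definition enc_bool :: "bool \<Rightarrow> val" where
  "enc_bool b = (if b then VReal 1 else VNil)"

text \<open>
  The direction of the supporting lines is a parameter of the instruction \<open>Touch\<close>, so it is fixed by
  the program and cannot be computed at run time.
\<close>
datatype prim =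
    Add | Sub | Mul | Div | Less
  | MkNil | MkPair | Left | Right
  | NormOf
  | Meet
  | Touch int int
  | Between

datatype exp =
    Var nat
  | Lit int
  | Prim prim "exp list"
  | Bind exp exp
  | Cond exp exp exp
  | Call nat "exp list"

text \<open>The points of a finite set, listed from left to right as seen when looking in direction \<open>u\<close>.\<close>
definition left_to_right :: "pt \<Rightarrow> pt set \<Rightarrow> pt list" where
  "left_to_right u A = (THE ps. set ps = A \<and> sorted_wrt (\<lambda>p q. det2 u p > det2 u q) ps)"

definition touching_points :: "(pt \<Rightarrow> real) \<Rightarrow> pt \<Rightarrow> real \<Rightarrow> pt \<Rightarrow> pt set" where
  "touching_points N c r u =
     {z \<in> circle N c r. (\<forall>y\<in>disc N c r. det2 u (y - z) \<ge> 0) \<or> (\<forall>y\<in>disc N c r. det2 u (y - z) \<le> 0)}"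

inductive prim_result :: "(pt \<Rightarrow> real) \<Rightarrow> prim \<Rightarrow> val list \<Rightarrow> val \<Rightarrow> bool" for N where
  "prim_result N Add [VReal x, VReal y] (VReal (x + y))"
| "prim_result N Sub [VReal x, VReal y] (VReal (x - y))"
| "prim_result N Mul [VReal x, VReal y] (VReal (x * y))"
| "y \<noteq> 0 \<Longrightarrow> prim_result N Div [VReal x, VReal y] (VReal (x / y))"
| "prim_result N Less [VReal x, VReal y] (enc_bool (x < y))"
| "prim_result N MkNil [] VNil"
| "prim_result N MkPair [v, w] (VPair v w)"
| "prim_result N Left [VPair v w] v"
| "prim_result N Right [VPair v w] w"
| "prim_result N NormOf [enc_pt p] (VReal (N p))"
| "r > 0 \<Longrightarrow> p \<noteq> q \<Longrightarrow>
   prim_result N Meet [enc_pt p, enc_pt q, VReal r]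
     (enc_pts (left_to_right (q - p) (circle N p r \<inter> circle N q r)))"
| "r > 0 \<Longrightarrow> u = (of_int a, of_int b) \<Longrightarrow> u \<noteq> 0 \<Longrightarrow>
   prim_result N (Touch a b) [enc_pt c, VReal r]
     (enc_pts (left_to_right u (touching_points N c r u)))"
| "{p, z, q} \<subseteq> circle N c r \<Longrightarrow> p \<noteq> q \<Longrightarrow>
   prim_result N Between [enc_pt c, VReal r, enc_pt p, enc_pt z, enc_pt q]
     (enc_bool (z \<in> ccw_arc N c r p q))"

text \<open>
  \<open>eval N P env e v t\<close>: in the environment \<open>env\<close> (variables are de Bruijn indices), the expression
  \<open>e\<close> evaluates to \<open>v\<close> in \<open>t\<close> steps, where \<open>P\<close> is the list of function bodies.
\<close>
inductive eval :: "(pt \<Rightarrow> real) \<Rightarrow> exp list \<Rightarrow> val list \<Rightarrow> exp \<Rightarrow> val \<Rightarrow> nat \<Rightarrow> bool"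
  and evals :: "(pt \<Rightarrow> real) \<Rightarrow> exp list \<Rightarrow> val list \<Rightarrow> exp list \<Rightarrow> val list \<Rightarrow> nat \<Rightarrow> bool"
  for N P where
  Var: "i < length env \<Longrightarrow> eval N P env (Var i) (env ! i) 1"
| Lit: "eval N P env (Lit k) (VReal (of_int k)) 1"
| Prim: "evals N P env es vs t \<Longrightarrow> prim_result N f vs v \<Longrightarrow> eval N P env (Prim f es) v (t + 1)"
| Bind: "eval N P env e1 v1 t1 \<Longrightarrow> eval N P (v1 # env) e2 v2 t2 \<Longrightarrow>
    eval N P env (Bind e1 e2) v2 (t1 + t2 + 1)"
| CondTrue: "eval N P env e v t \<Longrightarrow> v \<noteq> VNil \<Longrightarrow> eval N P env e1 v1 t1 \<Longrightarrow>
    eval N P env (Cond e e1 e2) v1 (t + t1 + 1)"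
| CondFalse: "eval N P env e VNil t \<Longrightarrow> eval N P env e2 v2 t2 \<Longrightarrow>
    eval N P env (Cond e e1 e2) v2 (t + t2 + 1)"
| Call: "evals N P env es vs t1 \<Longrightarrow> g < length P \<Longrightarrow> eval N P vs (P ! g) v t2 \<Longrightarrow>
    eval N P env (Call g es) v (t1 + t2 + 1)"
| Empty: "evals N P env [] [] 0"
| More: "eval N P env e v t1 \<Longrightarrow> evals N P env es vs t2 \<Longrightarrow>
    evals N P env (e # es) (v # vs) (t1 + t2)"

text \<open>A program is run by calling its first function.\<close>
definition computes :: "(pt \<Rightarrow> real) \<Rightarrow> exp list \<Rightarrow> val list \<Rightarrow> val \<Rightarrow> nat \<Rightarrow> bool" where
  "computes N P args v t \<longleftrightarrow> P \<noteq> [] \<and> eval N P args (P ! 0) v t"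


subsection \<open>Well-definedness\<close>

lemma left_to_right_eqI:
  assumes "set ps = A" "sorted_wrt (\<lambda>p q. det2 u p > det2 u q) ps"
  shows "left_to_right u A = ps"
proof -
  have "qs = ps" if "set qs = set ps" "sorted_wrt (\<lambda>p q. det2 u p > det2 u q) qs" for qs
    using assms(2) that
  proof (induction ps arbitrary: qs)
    case Nil
    then show ?case by simp
  next
    case (Cons p ps)
    from Cons.prems(2) obtain q qs' where qs: "qs = q # qs'" by (cases qs) simp_all
    have "p = q"
    proof (rule ccontr)
      assume "p \<noteq> q"
      then have "q \<in> set ps" "p \<in> set qs'" using Cons.prems qs by auto
      then have "det2 u p > det2 u q" "det2 u q > det2 u p" using Cons.prems qs by simp_all
      then show False by simp
    qed
    moreover have "p \<notin> set ps" "q \<notin> set qs'" using Cons.prems qs by auto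
    ultimately have "set qs' = set ps" using Cons.prems(2) qs by (metis insert_ident list.simps(15))
    then have "qs' = ps" using Cons.IH Cons.prems(1,3) qs by simp
    then show ?case using qs \<open>p = q\<close> by simp
  qed
  note unique = this
  show ?thesis
    unfolding left_to_right_def
  proof (rule the_equality)
    show "set ps = A \<and> sorted_wrt (\<lambda>p q. det2 u p > det2 u q) ps"
      using assms by simp
  next
    fix qs
    assume "set qs = A \<and> sorted_wrt (\<lambda>p q. det2 u p > det2 u q) qs"
    then show "qs = ps"
      using unique assms(1) by simp
  qed
qed

lemma enc_pt_inject [simp]: "enc_pt p = enc_pt q \<longleftrightarrow> p = q"
  by (auto simp: enc_pt_def prod_eq_iff)

lemma prim_result_deterministic:
  "prim_result N f vs v \<Longrightarrow> prim_result N f vs w \<Longrightarrow> v = w"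
  by (induction rule: prim_result.induct) (erule prim_result.cases; simp)+

lemma eval_deterministic:
  "eval N P env e v t \<Longrightarrow> eval N P env e v' t' \<Longrightarrow> v' = v \<and> t' = t"
  "evals N P env es vs s \<Longrightarrow> evals N P env es vs' s' \<Longrightarrow> vs' = vs \<and> s' = s"
proof (induction arbitrary: v' t' and vs' s' rule: eval_evals.inducts)
  case (Var i env)
  from Var.prems show ?case by cases simp
next
  case (Lit env k)
  from Lit.prems show ?case by cases simp
next
  case (Prim env es vs t f v)
  from Prim.prems show ?case
    by cases (metis Prim.IH prim_result_deterministic)
next
  case (Bind env e1 v1 t1 e2 v2 t2)
  from Bind.prems show ?case
    by cases (metis Bind.IH)
next
  case (CondTrue env e v t e1 v1 t1 e2)
  from CondTrue.prems show ?case
    by cases (metis CondTrue.IH CondTrue.hyps)+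
next
  case (CondFalse env e t e2 v2 t2 e1)
  from CondFalse.prems show ?case
    by cases (metis CondFalse.IH)+
next
  case (Call env es vs t1 g v t2)
  from Call.prems show ?case
    by cases (metis Call.IH)
next
  case (Empty env)
  from Empty.prems show ?case by cases simp
next
  case (More env e v t1 es vs t2)
  from More.prems show ?case
    by cases (metis More.IH)
qed

end

theory Submission
  imports Defs
begin

text \<open>
  Write \<open>r\<close> for the radius and call the discs of radius \<open>r\<close> with centers in the given set the
  discs of the set. A center is redundant if the discs of the other centers already have the same
  intersection. The program removes redundant centers until the others form a ring, listed
  counterclockwise, in which consecutive centers \<open>a\<close>, \<open>b\<close> contribute the vertex \<open>vtx a b\<close>, the
  intersection point of their circles to the left of the line from \<open>a\<close> to \<open>b\<close>.

  The algorithm is a Graham scan in which \<open>b\<close> is a corner between \<open>a\<close> and \<open>k\<close> only if the turn is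
  to the left and, moreover, \<open>b\<close> lies outside the disc of radius \<open>r\<close> about \<open>vtx a k\<close> (\<open>corner\<close>).
  The lexicographically least center comes first, the others are sorted by the angle around it,
  and a stack is popped as long as its top is not a corner between its predecessor and the next
  center. Every popped center is redundant, because it lies in a triangle of other centers or in
  the cap that the chord from \<open>a\<close> to \<open>k\<close> cuts off the disc about \<open>vtx a k\<close>, and such a cap is
  contained in every disc of radius \<open>r\<close> that contains \<open>a\<close> and \<open>k\<close> (\<open>redundant_if_in_cap\<close>). The
  first center itself may be redundant. So the chain is finally closed to a ring by removing
  centers at its two ends until every center is a corner between its neighbors. Sorting takes time
  \<open>O(n log n)\<close>, and each later step pushes or removes a center, so that the remaining time is
  linear.

  It remains to see that a closed ring, in which all conditions are local, describes the
  intersection. First, the corner condition is inherited by subsequences: if \<open>a\<close>, \<open>c\<close>, \<open>e\<close>, \<open>d\<close>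
  form a convex quadrilateral with corners \<open>c\<close> and \<open>e\<close>, then \<open>c\<close> is a corner between \<open>a\<close> and \<open>d\<close>,
  and so is \<open>e\<close> (\<open>shortcut_keeps_vertex\<close>); otherwise a line through the intersection points of two
  circles would separate the diagonals. Hence all triples of the ring satisfy the condition.
  Second, if the disc of a third center \<open>c\<close> misses both intersection points of the circles about
  \<open>a\<close> and \<open>b\<close>, while the three discs have a common point, then \<open>b\<close> is in the disc about \<open>vtx a c\<close>
  or \<open>a\<close> in the one about \<open>vtx c b\<close> (\<open>redundant_if_arc_cut_off\<close>), which the corner conditions
  exclude. So all vertices of the ring lie in all discs. Third, this suffices
  (\<open>frontier_is_arcs\<close>): the arcs between consecutive vertices lie in all discs by the cap
  property, and a point that lies strictly to the left of all edges of the closed vertex polygon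
  is in the convex hull of the vertices, hence in the interior of the intersection; so every other
  frontier point belongs to one of the caps. If two consecutive vertices agree, then the
  intersection is a single point.

  The facts about circles rest on two consequences of strict convexity: a chord that is translated
  and stays in the disc moves towards the side on which the center lies (\<open>chord_moves_inwards\<close>),
  and then the cap beyond the chord stays inside, too (\<open>cap_inside\<close>).
\<close>

section \<open>Orientation of points in the plane\<close>

lemma det2_add_left: "det2 (u + v) w = det2 u w + det2 v w"
  and det2_add_right: "det2 w (u + v) = det2 w u + det2 w v"
  and det2_diff_left: "det2 (u - v) w = det2 u w - det2 v w"
  and det2_diff_right: "det2 w (u - v) = det2 w u - det2 w v"
  and det2_minus_left: "det2 (- u) w = - det2 u w"
  and det2_minus_right: "det2 w (- u) = - det2 w u"
  and det2_scale_left: "det2 (a *\<^sub>R u) w = a * det2 u w"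
  and det2_scale_right: "det2 w (a *\<^sub>R u) = a * det2 w u"
  and det2_self: "det2 u u = 0"
  and det2_zero_left: "det2 0 w = 0"
  and det2_zero_right: "det2 w 0 = 0"
  by (simp_all add: det2_def algebra_simps)

lemmas det2_simps = det2_add_left det2_add_right det2_diff_left det2_diff_right det2_minus_left
  det2_minus_right det2_scale_left det2_scale_right det2_self det2_zero_left det2_zero_right

lemma det2_eq_0_parallel:
  assumes "det2 d x = 0" "d \<noteq> 0"
  obtains s where "x = s *\<^sub>R d"
proof (cases "fst d = 0")
  case True
  then have "snd d \<noteq> 0" using assms(2) by (simp add: prod_eq_iff)
  then have "x = (snd x / snd d) *\<^sub>R d"
    using True assms(1) by (auto simp: det2_def prod_eq_iff)
  then show ?thesis using that by blast
next
  case False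
  then have "x = (fst x / fst d) *\<^sub>R d"
    using assms(1) by (auto simp: det2_def prod_eq_iff field_simps)
  then show ?thesis using that by blast
qed

text \<open>
  Twice the signed area of the triangle \<open>a\<close>, \<open>b\<close>, \<open>c\<close>: positive if \<open>c\<close> is to the left of the
  line from \<open>a\<close> to \<open>b\<close>.
\<close>
definition ccw :: "pt \<Rightarrow> pt \<Rightarrow> pt \<Rightarrow> real" where
  "ccw a b c = det2 (b - a) (c - a)"

lemma ccw_rotate: "ccw a b c = ccw b c a"
  by (simp add: ccw_def det2_def algebra_simps)

lemma ccw_swap: "ccw b a c = - ccw a b c"
  by (simp add: ccw_def det2_def algebra_simps)

text \<open>
  As a function of its last argument, the signed area is affine. It serves as the affine
  functional whose zero set is the line through \<open>a\<close> and \<open>b\<close>.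
\<close>
lemma ccw_affine: "ccw a b ((1 - t) *\<^sub>R p + t *\<^sub>R q) = (1 - t) * ccw a b p + t * ccw a b q"
  by (simp add: ccw_def det2_def algebra_simps)

lemma ccw_left: "ccw a b a = 0" and ccw_right: "ccw a b b = 0" and ccw_degenerate: "ccw a a b = 0"
  by (simp_all add: ccw_def det2_def algebra_simps)

lemma ccw_eq_0_on_line:
  assumes "ccw a b x = 0" "a \<noteq> b"
  obtains s where "x = (1 - s) *\<^sub>R a + s *\<^sub>R b"
proof -
  obtain s where "x - a = s *\<^sub>R (b - a)"
    using det2_eq_0_parallel[of "b - a" "x - a"] assms by (auto simp: ccw_def)
  then have "x = (1 - s) *\<^sub>R a + s *\<^sub>R b" by (simp add: algebra_simps)
  then show ?thesis by (rule that)
qed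

section \<open>Chords and caps of discs\<close>

locale strictly_convex_plane =
  fixes N :: "pt \<Rightarrow> real"
  assumes norm: "is_norm N" and strict: "strictly_convex N"
begin

lemma N_eq_0 [simp]: "N x = 0 \<longleftrightarrow> x = 0"
  and N_scale: "N (a *\<^sub>R x) = \<bar>a\<bar> * N x"
  and N_triangle: "N (x + y) \<le> N x + N y"
  using norm unfolding is_norm_def by blast+

lemma N_0 [simp]: "N 0 = 0"
  by simp

lemma N_minus [simp]: "N (- x) = N x"
  using N_scale[of "-1" x] by simp

lemma N_commute: "N (x - y) = N (y - x)"
  using N_minus[of "x - y"] by simp

lemma N_nonneg [simp]: "0 \<le> N x"
  using N_triangle[of x "- x"] by simp

lemma N_pos: "x \<noteq> 0 \<Longrightarrow> 0 < N x"
  using N_nonneg[of x] N_eq_0[of x] by linarith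

lemma N_convex:
  assumes "0 \<le> t" "t \<le> 1"
  shows "N ((1 - t) *\<^sub>R x + t *\<^sub>R y) \<le> (1 - t) * N x + t * N y"
  using N_triangle[of "(1 - t) *\<^sub>R x" "t *\<^sub>R y"] assms by (simp add: N_scale)

lemma N_convex_le:
  assumes "0 \<le> t" "t \<le> 1" "N x \<le> r" "N y \<le> r"
  shows "N ((1 - t) *\<^sub>R x + t *\<^sub>R y) \<le> r"
proof -
  have "(1 - t) * N x + t * N y \<le> (1 - t) * r + t * r"
    using assms by (intro add_mono mult_left_mono) auto
  then show ?thesis using N_convex[of t x y] assms by (simp add: algebra_simps)
qed

lemma N_convex_less1:
  assumes "0 \<le> t" "t < 1" "N x < r" "N y \<le> r"
  shows "N ((1 - t) *\<^sub>R x + t *\<^sub>R y) < r"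
proof -
  have "(1 - t) * N x + t * N y < (1 - t) * r + t * r"
    using assms by (intro add_less_le_mono mult_left_mono mult_strict_left_mono) auto
  then show ?thesis using N_convex[of t x y] assms by (simp add: algebra_simps)
qed

lemma N_convex_less2:
  assumes "0 < t" "t \<le> 1" "N x \<le> r" "N y < r"
  shows "N ((1 - t) *\<^sub>R x + t *\<^sub>R y) < r"
  using N_convex_less1[of "1 - t" y r x] assms by (simp add: add.commute)

text \<open>
  The definition of strict convexity speaks of the unit circle only. If a convex combination had
  norm at least \<open>r\<close>, then the norm, being convex, would be constant on the segment, and the
  segment scaled by \<open>1 / r\<close> would lie in the unit circle.
\<close>
lemma N_strict:
  assumes "N x \<le> r" "N y \<le> r" "x \<noteq> y" "0 < t" "t < 1"
  shows "N ((1 - t) *\<^sub>R x + t *\<^sub>R y) < r"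
proof (rule ccontr)
  let ?g = "\<lambda>s. (1 - s) *\<^sub>R x + s *\<^sub>R y"
  assume "\<not> N (?g t) < r"
  then have gt: "N (?g t) \<ge> r" by simp
  have "r \<noteq> 0"
    using assms(1-3) N_nonneg[of x] N_nonneg[of y] by (metis N_eq_0 order_antisym)
  then have r: "r > 0" using assms(1) N_nonneg[of x] by linarith
  \<comment> \<open>a convex function that attains its maximum inside a segment is constant there\<close>
  have const: "N (?g s) = r" if s: "0 \<le> s" "s \<le> 1" for s
  proof (rule ccontr)
    assume "N (?g s) \<noteq> r"
    moreover have "N (?g s) \<le> r" using N_convex_le s assms by blast
    ultimately have less: "N (?g s) < r" by simp
    consider "s < t" | "s > t" using less gt by fastforce
    then have "N (?g t) < r"
    proof cases
      case 1
      define u where "u = (t - s) / (1 - s)"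
      have u: "0 \<le> u" "u < 1" using 1 assms by (auto simp: u_def field_simps)
      have "?g t = (1 - u) *\<^sub>R ?g s + u *\<^sub>R y"
      proof -
        have "u * (1 - s) = t - s"
          using 1 assms by (simp add: u_def)
        then have "(1 - u) * (1 - s) = 1 - t" "(1 - u) * s + u = t"
          by (auto simp: algebra_simps)
        then show ?thesis
          by (metis (no_types, lifting) add.assoc scaleR_add_left scaleR_add_right scaleR_scaleR)
      qed
      then show ?thesis using N_convex_less1[OF u less assms(2)] by simp
    next
      case 2
      define u where "u = t / s"
      have u: "0 < u" "u \<le> 1" using 2 assms by (auto simp: u_def field_simps)
      have "?g t = (1 - u) *\<^sub>R x + u *\<^sub>R ?g s"
      proof -
        have "u * s = t" using 2 assms by (simp add: u_def)
        moreover from this have "(1 - u) + u * (1 - s) = 1 - t" by (simp add: algebra_simps)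
        ultimately show ?thesis
          by (metis (no_types, lifting) add.assoc scaleR_add_left scaleR_add_right scaleR_scaleR)
      qed
      then show ?thesis using N_convex_less2[OF u assms(1) less] by simp
    qed
    then show False using gt by simp
  qed
  have "closed_segment ((1 / r) *\<^sub>R x) ((1 / r) *\<^sub>R y) \<subseteq> circle N 0 1"
  proof
    fix z assume "z \<in> closed_segment ((1 / r) *\<^sub>R x) ((1 / r) *\<^sub>R y)"
    then obtain s where s: "0 \<le> s" "s \<le> 1"
      and "z = (1 - s) *\<^sub>R ((1 / r) *\<^sub>R x) + s *\<^sub>R ((1 / r) *\<^sub>R y)"
      by (auto simp: closed_segment_def)
    then have z: "z = (1 / r) *\<^sub>R ?g s"
      by (simp add: scaleR_add_right)
    show "z \<in> circle N 0 1"
      using const[OF s] r by (simp add: circle_def z N_scale)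
  qed
  moreover have "(1 / r) *\<^sub>R x \<noteq> (1 / r) *\<^sub>R y" using assms(3) r by simp
  ultimately show False using strict unfolding strictly_convex_def by blast
qed

text \<open>
  The weights need not add up to 1; this spares divisions in the applications.
\<close>
lemma N_strict_weights:
  assumes "N x \<le> r" "N y \<le> r" "x \<noteq> y" "0 < a" "0 < b" "(a + b) *\<^sub>R z = a *\<^sub>R x + b *\<^sub>R y"
  shows "N z < r"
proof -
  have "z = (1 / (a + b)) *\<^sub>R (a *\<^sub>R x + b *\<^sub>R y)"
    using assms(4,5) by (simp flip: assms(6))
  also have "\<dots> = (a / (a + b)) *\<^sub>R x + (b / (a + b)) *\<^sub>R y"
    by (simp add: scaleR_add_right)
  also have "a / (a + b) = 1 - b / (a + b)"
    using assms(4,5) by (simp add: field_simps)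
  finally show ?thesis
    using N_strict[of x r y "b / (a + b)"] assms by simp
qed

lemma N_le_weights:
  assumes "N x \<le> r" "N y \<le> r" "0 < a" "0 \<le> b" "(a + b) *\<^sub>R z = a *\<^sub>R x + b *\<^sub>R y"
  shows "N z \<le> r"
proof -
  have "(a + b) * N z \<le> a * N x + b * N y"
    using N_scale[of "a + b" z] N_triangle[of "a *\<^sub>R x" "b *\<^sub>R y"] assms by (simp add: N_scale)
  also have "\<dots> \<le> a * r + b * r"
    using assms by (intro add_mono mult_left_mono) auto
  finally have "(a + b) * N z \<le> (a + b) * r" by (simp add: algebra_simps)
  then show ?thesis using assms by simp
qed

lemma in_disc_strict:
  assumes "N (x - c) \<le> r" "N (y - c) \<le> r" "x \<noteq> y" "0 < t" "t < 1"
  shows "N ((1 - t) *\<^sub>R x + t *\<^sub>R y - c) < r"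
proof -
  have "(1 - t) *\<^sub>R x + t *\<^sub>R y - c = (1 - t) *\<^sub>R (x - c) + t *\<^sub>R (y - c)"
    by (simp add: algebra_simps)
  then show ?thesis using N_strict[of "x - c" r "y - c" t] assms by simp
qed

lemma in_disc_convex:
  assumes "N (x - c) \<le> r" "N (y - c) \<le> r" "0 \<le> t" "t \<le> 1"
  shows "N ((1 - t) *\<^sub>R x + t *\<^sub>R y - c) \<le> r"
proof -
  have "(1 - t) *\<^sub>R x + t *\<^sub>R y - c = (1 - t) *\<^sub>R (x - c) + t *\<^sub>R (y - c)"
    by (simp add: algebra_simps)
  then show ?thesis using N_convex_le[of t "x - c" r "y - c"] assms by simp
qed

lemma close_if_common_points:
  assumes "N (x - c) \<le> r" "N (y - c) \<le> r" "N (x - c') \<le> r" "N (y - c') \<le> r" "x \<noteq> y"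
  shows "N (c - c') < 2 * r"
proof -
  let ?m = "(1 - 1/2) *\<^sub>R x + (1/2) *\<^sub>R y"
  have "N (?m - c) < r" "N (?m - c') < r"
    using in_disc_strict[of x _ r y "1/2"] assms by auto
  then show ?thesis
    using N_triangle[of "c - ?m" "?m - c'"] N_commute[of c ?m] by simp
qed

text \<open>
  If a chord from \<open>p\<close> to \<open>q\<close> is shifted along its own line and remains in the disc, then one of
  its former endpoints lies strictly between two points of the disc.
\<close>
lemma no_three_on_line:
  assumes "N p = r" "N q = r" "p \<noteq> q" "N (p + s *\<^sub>R (q - p)) \<le> r" "N (q + s *\<^sub>R (q - p)) \<le> r" "s \<noteq> 0"
  shows False
proof (cases "s > 0")
  case True
  let ?Q = "q + s *\<^sub>R (q - p)"
  have "(s + 1) *\<^sub>R q = s *\<^sub>R p + 1 *\<^sub>R ?Q"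
    by (simp add: algebra_simps)
  moreover have "p \<noteq> ?Q"
  proof
    assume "p = ?Q"
    then have "(1 + s) *\<^sub>R (q - p) = 0" by (simp add: algebra_simps)
    then show False using True assms(3) by simp
  qed
  ultimately have "N q < r"
    using N_strict_weights[of p r ?Q s 1 q] assms True by simp
  then show False using assms by simp
next
  case False
  then have s: "s < 0" using assms by simp
  let ?P = "p + s *\<^sub>R (q - p)"
  have "(- s + 1) *\<^sub>R p = (- s) *\<^sub>R q + 1 *\<^sub>R ?P"
    by (simp add: algebra_simps)
  moreover have "q \<noteq> ?P"
  proof
    assume "q = ?P"
    then have "(1 - s) *\<^sub>R (q - p) = 0" by (simp add: algebra_simps)
    then show False using s assms(3) by simp
  qed
  ultimately have "N p < r"
    using N_strict_weights[of q r ?P "- s" 1 p] assms s by simp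
  then show False using assms by simp
qed

text \<open>
  The translate of the chord from \<open>p\<close> to \<open>q\<close> by \<open>- x\<close> is again in the disc about the origin, and
  the origin is not to the right of the chord. If the translate were farther out, the given
  chord would lie between the translate and the reflected chord from \<open>- q\<close> to \<open>- p\<close>. These two
  span a parallelogram, whose section at the height of the given chord has the same length as
  the chord but consists of points strictly inside the disc, which is impossible.
\<close>
lemma chord_moves_inwards_centred:
  assumes p: "N p = r" and q: "N q = r" and pq: "p \<noteq> q" and x: "x \<noteq> 0"
    and px: "N (p - x) \<le> r" and qx: "N (q - x) \<le> r" and minor: "det2 (q - p) p \<le> 0"
  shows "det2 (q - p) x < 0"
proof (rule ccontr)
  assume "\<not> det2 (q - p) x < 0"
  then have e: "det2 (q - p) x \<ge> 0" by simp
  define e where "e = det2 (q - p) x"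
  define H where "H = - det2 (q - p) p"
  have d0: "q - p \<noteq> 0" using pq by simp
  have H: "H \<ge> 0" and e0: "e \<ge> 0" using minor e by (simp_all add: H_def e_def)
  \<comment> \<open>\<open>H\<close> is the height of the origin above the chord, \<open>- e\<close> the height by which the translate is raised\<close>
  consider "e = 0" | "e > 0" "H = 0" | "e > 0" "H > 0" using H e0 by linarith
  then show False
  proof cases
    case 1
    then obtain s where s: "x = s *\<^sub>R (q - p)"
      using det2_eq_0_parallel d0 by (metis e_def)
    then have "s \<noteq> 0" using x by auto
    then show False
      using no_three_on_line[OF p q pq, of "- s"] px qx s by simp
  next
    case 2
    then obtain s where s: "p = s *\<^sub>R (q - p)"
      using det2_eq_0_parallel d0 by (metis H_def neg_equal_0_iff_equal)
    then have "q = (s + 1) *\<^sub>R (q - p)" by (simp add: algebra_simps)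
    then have "\<bar>s\<bar> * N (q - p) = \<bar>s + 1\<bar> * N (q - p)"
      using p q s by (metis N_scale)
    then have "s = - 1/2" using N_pos[OF d0] by auto
    then have "2 *\<^sub>R p = (- 1) *\<^sub>R (q - p)"
      using s by (metis (no_types, lifting) divide_minus_left mult_minus_right nonzero_mult_div_cancel_left
          scaleR_scaleR times_divide_eq_right zero_neq_numeral mult.right_neutral)
    then have "p + q = 0" by (simp add: scaleR_2 algebra_simps)
    then have qp: "q = - p" by (simp add: eq_neg_iff_add_eq_0 add.commute)
    have "p = (1 - 1/2) *\<^sub>R (p - x) + (1/2) *\<^sub>R (p + x)" by (simp add: prod_eq_iff field_simps)
    moreover have "N (p + x) \<le> r" using qx qp N_minus[of "p + x"] by simp
    moreover have "p - x \<noteq> p + x"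
    proof
      assume "p - x = p + x"
      then have "2 *\<^sub>R x = 0" by (simp add: scaleR_2 algebra_simps)
      then show False using x by simp
    qed
    ultimately have "N p < r" using N_strict[of "p - x" r "p + x" "1/2"] px by simp
    then show False using p by simp
  next
    case 3
    define t where "t = e / (2 * H + e)"
    have t: "0 < t" "t < 1" using 3 by (auto simp: t_def field_simps)
    let ?P = "(1 - t) *\<^sub>R (p - x) + t *\<^sub>R (- q)"
    let ?Q = "(1 - t) *\<^sub>R (q - x) + t *\<^sub>R (- p)"
    have dq: "det2 (q - p) q = - H" by (simp add: H_def det2_def algebra_simps)
    have "det2 (q - p) (p - x) = - H - e" by (simp add: H_def e_def det2_simps)
    moreover have "det2 (q - p) (- q) = H" using dq by (simp add: det2_minus_right)
    ultimately have "p - x \<noteq> - q" using 3 by auto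
    then have P: "N ?P < r" using N_strict[of "p - x" r "- q" t] t px q by simp
    have "det2 (q - p) (q - x) = - H - e" using dq by (simp add: e_def det2_diff_right)
    moreover have "det2 (q - p) (- p) = H" by (simp add: H_def det2_minus_right)
    ultimately have "q - x \<noteq> - p" using 3 by auto
    then have Q: "N ?Q < r" using N_strict[of "q - x" r "- p" t] t qx p by simp
    have "det2 (q - p) (?P - p) = - e + t * (2 * H + e)"
      using dq unfolding det2_diff_right[of "q - p"] det2_add_right[of "q - p"] det2_scale_right
        det2_minus_right by (simp add: H_def e_def algebra_simps)
    also have "\<dots> = 0" using 3 by (simp add: t_def)
    finally obtain s where s: "?P - p = s *\<^sub>R (q - p)"
      using det2_eq_0_parallel d0 by blast
    then have P': "?P = p + s *\<^sub>R (q - p)" by (simp add: algebra_simps)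
    have "?Q = ?P + (q - p)" by (simp add: algebra_simps)
    then have Q': "?Q = q + s *\<^sub>R (q - p)" using s by (simp add: algebra_simps)
    have "s \<noteq> 0" using P P' p by auto
    then show False using no_three_on_line[OF p q pq, of s] P Q P' Q' by simp
  qed
qed

text \<open>
  The end \<open>e\<close> of a chord would lie strictly between two points of the disc: between \<open>f\<close> and the
  point where the segment from \<open>z\<close> to \<open>e - x\<close> meets the line through \<open>f\<close> and \<open>e\<close>, or, if that
  point is \<open>e\<close>, between \<open>z\<close> and \<open>e - x\<close>.
\<close>
lemma chord_end_inside:
  assumes e: "N e = r" and f: "N f \<le> r" "f \<noteq> e" and x: "x \<noteq> 0" "N (e - x) \<le> r"
    and z: "N z \<le> r" "z \<noteq> e" "z = e + s *\<^sub>R (e - f) + t *\<^sub>R x" and st: "s \<ge> 0" "t \<ge> 0"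
  shows False
proof (cases "s = 0")
  case True
  then have t: "t > 0" using z st by (cases "t = 0") auto
  have "(1 + t) *\<^sub>R e = 1 *\<^sub>R z + t *\<^sub>R (e - x)" using z True by (simp add: algebra_simps)
  moreover have "z \<noteq> e - x"
  proof
    assume "z = e - x"
    then have "(1 + t) *\<^sub>R x = 0" using z True by (simp add: algebra_simps)
    then show False using x t by simp
  qed
  ultimately have "N e < r" using N_strict_weights[of z r "e - x" 1 t e] z x t by simp
  then show False using e by simp
next
  case False
  then have s: "s > 0" using st by simp
  define k where "k = s / (1 + t)"
  have k: "k > 0" using s st by (simp add: k_def)
  define u where "u = e + k *\<^sub>R (e - f)"
  have "(1 + t) *\<^sub>R u = (1 + t) *\<^sub>R e + ((1 + t) * k) *\<^sub>R (e - f)"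
    by (simp add: u_def scaleR_add_right)
  also have "(1 + t) * k = s" using st by (simp add: k_def)
  finally have "(1 + t) *\<^sub>R u = 1 *\<^sub>R z + t *\<^sub>R (e - x)"
    unfolding z(3) by (simp add: algebra_simps)
  then have u: "N u \<le> r" using N_le_weights[of z r "e - x" 1 t u] z x st by simp
  have "u = e + k *\<^sub>R (e - f)" by (simp add: u_def)
  then have "(k + 1) *\<^sub>R e = k *\<^sub>R f + 1 *\<^sub>R u"
    by (simp add: algebra_simps)
  moreover have "f \<noteq> u"
  proof
    assume "f = u"
    then have "(1 + k) *\<^sub>R (e - f) = 0" using \<open>u = e + k *\<^sub>R (e - f)\<close> by (simp add: algebra_simps)
    then show False using f k by simp
  qed
  ultimately have "N e < r" using N_strict_weights[of f r u k 1 e] f u k by simp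
  then show False using e by simp
qed

text \<open>
  The cap to the right of the chord from \<open>p\<close> to \<open>q\<close> is moved by \<open>- x\<close>, to the left. The line
  through \<open>z\<close> in direction \<open>x\<close> meets the line of the chord in a point \<open>w\<close>, which is strictly
  between \<open>p\<close> and \<open>q\<close> by \<open>chord_end_inside\<close>. So \<open>z - x\<close> is on the segment from \<open>z\<close> to \<open>w\<close> or on
  the one from \<open>w\<close> to \<open>w - x\<close>, and \<open>w - x\<close> is on the translated chord.
\<close>
lemma cap_inside_centred:
  assumes p: "N p = r" and q: "N q = r" and pq: "p \<noteq> q"
    and px: "N (p - x) \<le> r" and qx: "N (q - x) \<le> r" and shift: "det2 (q - p) x < 0"
    and z: "N z \<le> r" "det2 (q - p) (z - p) \<le> 0" "z \<noteq> p" "z \<noteq> q"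
  shows "N (z - x) < r"
proof -
  define e where "e = - det2 (q - p) x"
  define h where "h = - det2 (q - p) (z - p)"
  define t where "t = h / e"
  have e: "e > 0" and h: "h \<ge> 0" using shift z by (simp_all add: e_def h_def)
  have t: "t \<ge> 0" using e h by (simp add: t_def)
  have x0: "x \<noteq> 0" using shift by (auto simp: det2_simps)
  define w where "w = z - t *\<^sub>R x"
  have "det2 (q - p) (w - p) = - h + t * e"
    by (simp add: w_def h_def e_def det2_diff_right[of "q - p"] det2_scale_right)
  also have "\<dots> = 0" using e by (simp add: t_def)
  finally obtain s where s: "w - p = s *\<^sub>R (q - p)"
    using det2_eq_0_parallel pq by (metis right_minus_eq)
  have zs: "z = p + s *\<^sub>R (q - p) + t *\<^sub>R x" using s by (simp add: w_def algebra_simps)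
  have "s > 0"
  proof (rule ccontr)
    assume "\<not> s > 0"
    then show False
      using chord_end_inside[of p r q x z "- s" t] p q pq px z zs t x0 by (simp add: algebra_simps)
  qed
  moreover have "s < 1"
  proof (rule ccontr)
    assume "\<not> s < 1"
    then show False
      using chord_end_inside[of q r p x z "s - 1" t] p q pq qx z zs t x0 by (simp add: algebra_simps)
  qed
  ultimately have s01: "0 < s" "s < 1" by auto
  have w: "w = (1 - s) *\<^sub>R p + s *\<^sub>R q" using s by (simp add: algebra_simps)
  have Nw: "N w < r" unfolding w using N_strict[of p r q s] p q pq s01 by simp
  have "w - x = (1 - s) *\<^sub>R (p - x) + s *\<^sub>R (q - x)" unfolding w by (simp add: algebra_simps)
  then have Nwx: "N (w - x) < r" using N_strict[of "p - x" r "q - x" s] px qx pq s01 by simp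
  show ?thesis
  proof (cases "t \<ge> 1")
    case True
    have "z - x = (1 - 1 / t) *\<^sub>R z + (1 / t) *\<^sub>R w"
      using True by (simp add: w_def algebra_simps)
    then show ?thesis using N_convex_less2[of "1 / t" z r w] True Nw z by simp
  next
    case False
    have "z - x = (1 - (1 - t)) *\<^sub>R w + (1 - t) *\<^sub>R (w - x)"
      by (simp add: w_def algebra_simps)
    then show ?thesis using N_convex_less2[of "1 - t" w r "w - x"] False t Nw Nwx by simp
  qed
qed

text \<open>
  The previous two chord lemmas are used in this translated form, with the two centers in
  arbitrary position: this one decides on which side of a chord the other center lies, and
  \<open>cap_inside\<close> draws the conclusion for the discs.
\<close>
lemma chord_moves_inwards:
  assumes "N (p - c) = r" "N (q - c) = r" "p \<noteq> q" "N (p - x) \<le> r" "N (q - x) \<le> r" "x \<noteq> c"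
    and "ccw p q c \<ge> 0"
  shows "det2 (q - p) (c - x) > 0"
proof -
  have "det2 (q - p) (x - c) < 0"
    using chord_moves_inwards_centred[of "p - c" r "q - c" "x - c"] assms
    by (simp add: ccw_def det2_diff_right)
  then show ?thesis by (simp add: det2_diff_right)
qed

lemma cap_inside:
  assumes "N (p - c) = r" "N (q - c) = r" "p \<noteq> q" "N (p - x) \<le> r" "N (q - x) \<le> r"
    and "det2 (q - p) (c - x) > 0"
    and "N (z - c) \<le> r" "ccw p q z \<le> 0" "z \<noteq> p" "z \<noteq> q"
  shows "N (z - x) < r"
  using cap_inside_centred[of "p - c" r "q - c" "x - c" "z - c"] assms
  by (simp add: ccw_def det2_diff_right)

section \<open>Circles of equal radius\<close>

lemma N_le_norm: "N x \<le> (N (1, 0) + N (0, 1)) * norm x"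
proof -
  have "x = fst x *\<^sub>R (1, 0) + snd x *\<^sub>R (0, 1)" by (simp add: prod_eq_iff)
  then have "N x \<le> N (fst x *\<^sub>R (1, 0)) + N (snd x *\<^sub>R (0, 1))" by (metis N_triangle)
  also have "\<dots> = \<bar>fst x\<bar> * N (1, 0) + \<bar>snd x\<bar> * N (0, 1)" by (simp only: N_scale)
  also have "\<dots> \<le> norm x * N (1, 0) + norm x * N (0, 1)"
    using norm_fst_le[of "fst x" "snd x"] norm_snd_le[of "snd x" "fst x"]
    by (intro add_mono mult_right_mono) auto
  finally show ?thesis by (simp add: algebra_simps)
qed

lemma continuous_on_N [continuous_intros]:
  assumes "continuous_on A f"
  shows "continuous_on A (\<lambda>x. N (f x))"
proof -
  let ?C = "N (1, 0) + N (0, 1)"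
  have "?C-lipschitz_on UNIV N"
  proof (rule lipschitz_onI)
    fix x y :: pt
    have "N x \<le> N y + N (x - y)" "N y \<le> N x + N (x - y)"
      using N_triangle[of y "x - y"] N_triangle[of x "y - x"] N_commute[of x y] by simp_all
    then have "dist (N x) (N y) \<le> N (x - y)" by (simp add: dist_real_def)
    also have "\<dots> \<le> ?C * dist x y" using N_le_norm[of "x - y"] by (simp add: dist_norm)
    finally show "dist (N x) (N y) \<le> ?C * dist x y" .
  qed simp
  then have "continuous_on UNIV N" by (rule lipschitz_on_continuous_on)
  then show ?thesis using continuous_on_compose2 assms by blast
qed

end

locale ball_plane = strictly_convex_plane +
  fixes r :: real
  assumes r_pos: "r > 0"
begin

text \<open>
  The half circle to the left of the diameter from \<open>- e\<close> to \<open>e\<close> is a continuous path, obtained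
  by normalizing a Euclidean half turn of \<open>e\<close>.
\<close>
lemma circle_intermediate_value:
  assumes e: "N e = r" and F: "continuous_on UNIV F" "F e \<le> (b :: real)" "b \<le> F (- e)"
  obtains z where "N z = r" "F z = b" "det2 e z \<ge> 0"
proof -
  define J where "J = (- snd e, fst e)"
  define u where "u t = cos t *\<^sub>R e + sin t *\<^sub>R J" for t :: real
  have e0: "e \<noteq> 0" using e r_pos by auto
  have u0: "u t \<noteq> 0" for t
  proof
    have rot: "(x * a + y * - b)\<^sup>2 + (x * b + y * a)\<^sup>2 = (y\<^sup>2 + x\<^sup>2) * (a\<^sup>2 + b\<^sup>2)" for a b x y :: real
      by algebra
    assume "u t = 0"
    then have "cos t * fst e + sin t * - snd e = 0" "cos t * snd e + sin t * fst e = 0"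
      by (simp_all add: u_def J_def prod_eq_iff)
    then have "(fst e)\<^sup>2 + (snd e)\<^sup>2 = 0"
      using rot[of "cos t" "fst e" "sin t" "snd e"] by simp
    then have "e = 0" by (simp add: sum_power2_eq_zero_iff prod_eq_iff)
    then show False using e0 by simp
  qed
  define g where "g t = (r / N (u t)) *\<^sub>R u t" for t
  have Ng: "N (g t) = r" for t
    using u0[of t] N_pos[of "u t"] r_pos by (simp add: g_def N_scale)
  have "continuous_on {0..pi} g"
    unfolding g_def u_def using u0 unfolding u_def by (intro continuous_intros) auto
  then have "continuous_on {0..pi} (\<lambda>t. F (g t))"
    using continuous_on_compose2[OF F(1)] by blast
  moreover have "g 0 = e" "g pi = - e"
    using e r_pos by (simp_all add: g_def u_def)
  ultimately obtain t where t: "0 \<le> t" "t \<le> pi" "F (g t) = b"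
    using IVT'[of "\<lambda>t. F (g t)" 0 b pi] F by auto
  have "det2 e (u t) = sin t * ((fst e)\<^sup>2 + (snd e)\<^sup>2)"
    by (simp add: u_def J_def det2_def power2_eq_square algebra_simps)
  then have "det2 e (u t) \<ge> 0" using t sin_ge_zero by simp
  then have "det2 e (g t) \<ge> 0" using r_pos by (simp add: g_def det2_scale_right)
  then show ?thesis using that Ng t by blast
qed

text \<open>
  Of the two intersection points of the circles about \<open>p\<close> and \<open>q\<close>, the one to the left of the
  line from \<open>p\<close> to \<open>q\<close>. If the circles touch, it is their common point, and \<open>vtx p q = vtx q p\<close>.
\<close>
definition vtx :: "pt \<Rightarrow> pt \<Rightarrow> pt" where
  "vtx p q = (SOME z. N (z - p) = r \<and> N (z - q) = r \<and> ccw p q z \<ge> 0)"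

lemma vtx_spec:
  assumes "p \<noteq> q" "N (q - p) \<le> 2 * r"
  shows "N (vtx p q - p) = r" "N (vtx p q - q) = r" "ccw p q (vtx p q) \<ge> 0"
proof -
  define d where "d = q - p"
  have d: "d \<noteq> 0" "N d > 0" "N d \<le> 2 * r" using assms N_pos by (auto simp: d_def)
  define e where "e = (r / N d) *\<^sub>R d"
  have "N e = r" using d r_pos by (simp add: e_def N_scale)
  moreover have "e - d = (r / N d - 1) *\<^sub>R d" by (simp add: e_def algebra_simps)
  then have "N (e - d) = \<bar>(r / N d - 1) * N d\<bar>" using d by (simp add: N_scale abs_mult)
  then have "N (e - d) = \<bar>r - N d\<bar>" using d by (simp add: algebra_simps)
  then have "N (e - d) \<le> r" using d by (simp add: abs_le_iff)
  moreover have "- e - d = (r / N d + 1) *\<^sub>R (- d)" by (simp add: e_def algebra_simps)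
  then have "N (- e - d) = (r / N d + 1) * N d" using d r_pos by (simp add: N_scale)
  then have "N (- e - d) = r + N d" using d by (simp add: algebra_simps)
  then have "r \<le> N (- e - d)" by simp
  moreover have "continuous_on UNIV (\<lambda>z. N (z - d))" by (intro continuous_intros)
  ultimately obtain z where z: "N z = r" "N (z - d) = r" "det2 e z \<ge> 0"
    using circle_intermediate_value[of e "\<lambda>z. N (z - d)" r] by blast
  have "det2 d z \<ge> 0"
    using z(3) d r_pos by (simp add: e_def det2_scale_left zero_le_divide_iff zero_le_mult_iff)
  then have "N (p + z - p) = r \<and> N (p + z - q) = r \<and> ccw p q (p + z) \<ge> 0"
    using z by (simp add: d_def ccw_def algebra_simps)
  then have "N (vtx p q - p) = r \<and> N (vtx p q - q) = r \<and> ccw p q (vtx p q) \<ge> 0"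
    unfolding vtx_def by (rule someI)
  then show "N (vtx p q - p) = r" "N (vtx p q - q) = r" "ccw p q (vtx p q) \<ge> 0" by auto
qed

text \<open>
  Seen from \<open>z\<close> and from \<open>w\<close>, the segment from \<open>p\<close> to \<open>q\<close> is a chord of a circle about \<open>z\<close> and
  of one about \<open>w\<close>; by \<open>chord_moves_inwards\<close>, each of these two centers would be farther to the
  left than the other.
\<close>
lemma vtx_unique:
  assumes "p \<noteq> q" "N (z - p) = r" "N (z - q) = r" "ccw p q z \<ge> 0"
    "N (w - p) = r" "N (w - q) = r" "ccw p q w \<ge> 0"
  shows "z = w"
proof (rule ccontr)
  assume "z \<noteq> w"
  then have "det2 (q - p) (z - w) > 0" "det2 (q - p) (w - z) > 0"
    using chord_moves_inwards[of p z r q w] chord_moves_inwards[of p w r q z] assms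
    by (auto simp: N_commute)
  then show False by (simp add: det2_diff_right)
qed

lemma dist_le_2r:
  assumes "N (z - p) \<le> r" "N (z - q) \<le> r"
  shows "N (q - p) \<le> 2 * r"
  using N_triangle[of "z - p" "q - z"] N_commute[of z q] assms by simp

lemma vtxI:
  assumes "p \<noteq> q" "N (z - p) = r" "N (z - q) = r" "ccw p q z \<ge> 0"
  shows "vtx p q = z"
  using vtx_unique[OF assms(1) vtx_spec[OF assms(1)] assms(2-4)] dist_le_2r[of z p q] assms by simp

lemma common_circle_points:
  assumes "p \<noteq> q" "N (z - p) = r" "N (z - q) = r"
  shows "z = vtx p q \<or> z = vtx q p"
proof (cases "ccw p q z \<ge> 0")
  case True
  then show ?thesis using vtxI assms by metis
next
  case False
  then have "ccw q p z \<ge> 0" by (simp add: ccw_swap[of q p])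
  then show ?thesis using vtxI[of q p z] assms by auto
qed

lemma vtx_off_line:
  assumes "p \<noteq> q" "N (q - p) < 2 * r"
  shows "ccw p q (vtx p q) > 0"
proof (rule ccontr)
  assume *: "\<not> ccw p q (vtx p q) > 0"
  have v: "N (vtx p q - p) = r" "N (vtx p q - q) = r" "ccw p q (vtx p q) \<ge> 0"
    using vtx_spec assms by auto
  then obtain s where s: "vtx p q = (1 - s) *\<^sub>R p + s *\<^sub>R q"
    using ccw_eq_0_on_line[of p q "vtx p q"] * assms by force
  then have "vtx p q - p = s *\<^sub>R (q - p)" "vtx p q - q = (s - 1) *\<^sub>R (q - p)"
    by (simp_all add: algebra_simps)
  then have eqs: "\<bar>s\<bar> * N (q - p) = r" "\<bar>s - 1\<bar> * N (q - p) = r" using v by (simp_all add: N_scale)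
  then have "\<bar>s\<bar> = \<bar>s - 1\<bar>" using assms N_pos[of "q - p"] by (metis mult_right_cancel less_irrefl right_minus_eq)
  then have "s = 1/2" by simp
  then have "1/2 * N (q - p) = r" using eqs(1) by (metis abs_of_pos half_gt_zero_iff zero_less_one)
  then show False using assms by simp
qed

lemma vtx_swap_neq:
  assumes "p \<noteq> q" "N (q - p) < 2 * r"
  shows "vtx p q \<noteq> vtx q p"
  using vtx_off_line[of p q] vtx_off_line[of q p] ccw_swap[of q p "vtx q p"] assms
  by (auto simp: N_commute)

text \<open>
  The common chord of two circles decides which disc is the smaller one: to the right of it the
  disc about \<open>z\<close> is inside the other one, to the left of it the disc about \<open>w\<close>.
\<close>
lemma lens_halves:
  assumes "z \<noteq> w" "N (z - w) < 2 * r"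
  obtains p q where "p \<noteq> q" "N (p - z) = r" "N (p - w) = r" "N (q - z) = r" "N (q - w) = r"
    "\<And>x. ccw p q x \<le> 0 \<Longrightarrow> N (x - z) \<le> r \<Longrightarrow> x = p \<or> x = q \<or> N (x - w) < r"
    "\<And>x. ccw p q x \<ge> 0 \<Longrightarrow> N (x - w) \<le> r \<Longrightarrow> x = p \<or> x = q \<or> N (x - z) < r"
proof -
  note result = that
  define v1 v2 where "v1 = vtx z w" and "v2 = vtx w z"
  have v: "N (v1 - z) = r" "N (v1 - w) = r" "N (v2 - z) = r" "N (v2 - w) = r"
    using vtx_spec[of z w] vtx_spec[of w z] assms by (auto simp: v1_def v2_def N_commute)
  have "v1 \<noteq> v2" using vtx_swap_neq[of z w] assms by (auto simp: v1_def v2_def N_commute)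
  have main: thesis if pq: "p \<noteq> q" "N (p - z) = r" "N (p - w) = r" "N (q - z) = r" "N (q - w) = r"
      "ccw p q z \<ge> 0" for p q
  proof -
    have d: "det2 (q - p) (z - w) > 0"
      using chord_moves_inwards[of p z r q w] pq assms by auto
    then have d': "det2 (p - q) (w - z) > 0" by (simp add: det2_def algebra_simps)
    show thesis
    proof (rule result[OF pq(1-5)])
      fix x assume "ccw p q x \<le> 0" "N (x - z) \<le> r"
      then show "x = p \<or> x = q \<or> N (x - w) < r"
        using cap_inside[of p z r q w x] pq d by auto
    next
      fix x assume "ccw p q x \<ge> 0" "N (x - w) \<le> r"
      then show "x = p \<or> x = q \<or> N (x - z) < r"
        using cap_inside[of q w r p z x] pq d' by (auto simp: ccw_swap[of q p])
    qed
  qed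
  show thesis
  proof (cases "ccw v1 v2 z \<ge> 0")
    case True
    then show thesis using main[of v1 v2] v \<open>v1 \<noteq> v2\<close> by auto
  next
    case False
    then have "ccw v2 v1 z \<ge> 0" by (simp add: ccw_swap[of v2 v1])
    then show thesis using main[of v2 v1] v \<open>v1 \<noteq> v2\<close> by auto
  qed
qed

text \<open>
  The line through the intersection points as a separating line: the two differences of the
  discs lie strictly on different sides of it. This is the form in which \<open>lens_halves\<close> is used
  for separation arguments.
\<close>
lemma common_chord:
  assumes "z \<noteq> w" "N (z - w) < 2 * r"
  obtains p q where "p \<noteq> q" "N (p - z) = r" "N (p - w) = r" "N (q - z) = r" "N (q - w) = r"
    "\<And>x. N (x - z) \<le> r \<Longrightarrow> N (x - w) > r \<Longrightarrow> ccw p q x > 0"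
    "\<And>x. N (x - w) \<le> r \<Longrightarrow> N (x - z) > r \<Longrightarrow> ccw p q x < 0"
    "\<And>x. N (x - z) = r \<Longrightarrow> N (x - w) \<le> r \<Longrightarrow> x = p \<or> x = q \<or> ccw p q x < 0"
    "\<And>x. N (x - z) = r \<Longrightarrow> N (x - w) = r \<Longrightarrow> ccw p q x = 0"
proof -
  obtain p q where pq: "p \<noteq> q" "N (p - z) = r" "N (p - w) = r" "N (q - z) = r" "N (q - w) = r"
    and 1: "\<And>x. ccw p q x \<le> 0 \<Longrightarrow> N (x - z) \<le> r \<Longrightarrow> x = p \<or> x = q \<or> N (x - w) < r"
    and 2: "\<And>x. ccw p q x \<ge> 0 \<Longrightarrow> N (x - w) \<le> r \<Longrightarrow> x = p \<or> x = q \<or> N (x - z) < r"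
    by (rule lens_halves[OF assms]) blast
  show thesis
  proof (rule that[OF pq])
    fix x assume "N (x - z) \<le> r" "N (x - w) > r"
    then show "ccw p q x > 0" using 1[of x] pq by (cases "ccw p q x > 0") auto
  next
    fix x assume "N (x - w) \<le> r" "N (x - z) > r"
    then show "ccw p q x < 0" using 2[of x] pq by (cases "ccw p q x < 0") auto
  next
    fix x assume "N (x - z) = r" "N (x - w) \<le> r"
    then show "x = p \<or> x = q \<or> ccw p q x < 0" using 2[of x] by (cases "ccw p q x < 0") auto
  next
    fix x assume "N (x - z) = r" "N (x - w) = r"
    then have "x = p \<or> x = q" using 1[of x] 2[of x] by (cases "ccw p q x \<le> 0") auto
    then show "ccw p q x = 0" by (auto simp: ccw_left ccw_right)
  qed
qed

lemma inside_chord: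
  assumes "N (p - a) = r" "N (q - a) = r" "N ((1 - s) *\<^sub>R p + s *\<^sub>R q - a) < r"
  shows "0 < s" "s < 1"
proof -
  let ?X = "(1 - s) *\<^sub>R p + s *\<^sub>R q"
  show "0 < s"
  proof (rule ccontr)
    assume s: "\<not> 0 < s"
    define t where "t = 1 / (1 - s)"
    have t: "0 < t" "t \<le> 1" "t * (1 - s) = 1" using s by (auto simp: t_def)
    have "(1 - t) + t * s = 0" using t(3) by (simp add: algebra_simps)
    have "(1 - t) *\<^sub>R (q - a) + t *\<^sub>R (?X - a) = ((1 - t) + t * s) *\<^sub>R q + (t * (1 - s)) *\<^sub>R p - a"
      by (simp add: algebra_simps)
    also have "\<dots> = p - a" using t \<open>(1 - t) + t * s = 0\<close> by simp
    finally have "N (p - a) < r" using N_convex_less2[of t "q - a" r "?X - a"] t assms by simp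
    then show False using assms by simp
  qed
  show "s < 1"
  proof (rule ccontr)
    assume s: "\<not> s < 1"
    define t where "t = 1 / s"
    have t: "0 < t" "t \<le> 1" "t * s = 1" using s by (auto simp: t_def)
    have "(1 - t) + t * (1 - s) = 0" using t(3) by (simp add: algebra_simps)
    have "(1 - t) *\<^sub>R (p - a) + t *\<^sub>R (?X - a) = ((1 - t) + t * (1 - s)) *\<^sub>R p + (t * s) *\<^sub>R q - a"
      by (simp add: algebra_simps)
    also have "\<dots> = q - a" using t \<open>(1 - t) + t * (1 - s) = 0\<close> by simp
    finally have "N (q - a) < r" using N_convex_less2[of t "p - a" r "?X - a"] t assms by simp
    then show False using assms by simp
  qed
qed

text \<open>
  The circle about \<open>b\<close> meets the one about \<open>a\<close> in the ends of a chord whose line separates \<open>w\<close>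
  from \<open>w'\<close>. Then the line through \<open>w\<close> and \<open>w'\<close> separates these two ends, and one of them is in
  the disc about \<open>c\<close>. The proof compares the functionals of both lines at the point \<open>X\<close> where
  the chords cross.
\<close>
lemma separated_chords:
  assumes "a \<noteq> b" "a \<noteq> c"
    and w: "N (w - a) = r" "N (w - c) = r" "N (w' - a) = r" "N (w' - c) = r"
    and w'b: "N (w' - b) \<le> r" and wb: "N (w - b) > r"
    and out: "\<And>u. N (u - a) = r \<Longrightarrow> N (u - b) = r \<Longrightarrow> N (u - c) > r"
    and ab: "N (a - b) < 2 * r"
  shows False
proof -
  obtain p q where pq: "p \<noteq> q" "N (p - a) = r" "N (p - b) = r" "N (q - a) = r" "N (q - b) = r"
    and f1: "\<And>x. N (x - a) \<le> r \<Longrightarrow> N (x - b) > r \<Longrightarrow> ccw p q x > 0"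
    and f3: "\<And>x. N (x - a) = r \<Longrightarrow> N (x - b) \<le> r \<Longrightarrow> x = p \<or> x = q \<or> ccw p q x < 0"
    by (rule common_chord[OF assms(1) ab]) blast
  have ww: "w \<noteq> w'" using w'b wb by auto
  have "N (a - c) < 2 * r" using close_if_common_points[of w a r w' c] w ww by simp
  then obtain p' q' where g1: "\<And>x. N (x - a) \<le> r \<Longrightarrow> N (x - c) > r \<Longrightarrow> ccw p' q' x > 0"
    and g3: "\<And>x. N (x - a) = r \<Longrightarrow> N (x - c) = r \<Longrightarrow> ccw p' q' x = 0"
    by (rule common_chord[OF assms(2)]) blast
  have "w' \<noteq> p" "w' \<noteq> q" using out[of p] out[of q] pq w by auto
  then have fw: "ccw p q w > 0" "ccw p q w' < 0" using f1[of w] f3[of w'] w w'b wb by simp_all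
  define s where "s = ccw p q w / (ccw p q w - ccw p q w')"
  have s: "0 < s" "s < 1" using fw by (auto simp: s_def field_simps)
  define X where "X = (1 - s) *\<^sub>R w + s *\<^sub>R w'"
  have "ccw p q X = ccw p q w - s * (ccw p q w - ccw p q w')"
    unfolding X_def ccw_affine by (simp add: algebra_simps)
  also have "\<dots> = 0" using fw by (simp add: s_def)
  finally obtain k where k: "X = (1 - k) *\<^sub>R p + k *\<^sub>R q" using ccw_eq_0_on_line pq by blast
  have gX: "ccw p' q' X = 0"
    using g3[of w] g3[of w'] w by (simp add: X_def ccw_affine)
  have gpq: "ccw p' q' p > 0" "ccw p' q' q > 0" using g1[of p] g1[of q] out[of p] out[of q] pq by auto
  have "N (X - a) < r" using in_disc_strict[of w a r w' s] w ww s by (simp add: X_def)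
  then have "0 < k" "k < 1" using inside_chord[of p a q k] k pq by auto
  then have "ccw p' q' X > 0"
    unfolding k ccw_affine using gpq by (simp add: add_pos_pos)
  then show False using gX by simp
qed

section \<open>Three and four discs\<close>

text \<open>
  If the disc about \<open>c\<close> misses both vertices of the lens of \<open>a\<close> and \<open>b\<close> but meets the lens, then
  its circle enters and leaves the lens through the same arc, so that the other arc is
  superfluous. Formally, the part of the circle in the lens has an endpoint, found by an
  intermediate value argument, which lies on the circle about \<open>a\<close> or \<open>b\<close>; by \<open>separated_chords\<close>,
  the second intersection point with that circle is in the lens, too.
\<close>
lemma redundant_if_arc_cut_off:
  assumes y: "N (y - a) \<le> r" "N (y - b) \<le> r" "N (y - c) \<le> r"
    and neq: "a \<noteq> b" "a \<noteq> c" "b \<noteq> c"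
    and cut: "N (vtx a b - c) > r" "N (vtx b a - c) > r"
  shows "N (vtx a c - b) \<le> r \<or> N (vtx c b - a) \<le> r"
proof -
  define u where "u = vtx a b"
  have u: "N (u - a) = r" "N (u - b) = r" "N (u - c) > r"
    using vtx_spec[of a b] dist_le_2r[of y a b] y neq cut by (auto simp: u_def)
  have out: "N (x - c) > r" if "N (x - a) = r" "N (x - b) = r" for x
    using common_circle_points[of a b x] that neq cut by auto
  have "y \<noteq> u" using u y by auto
  then have ab: "N (a - b) < 2 * r" using close_if_common_points[of y a r u b] y u by auto
  define g where "g t = (1 - t) *\<^sub>R y + t *\<^sub>R u" for t :: real
  have "continuous_on {0..1} (\<lambda>t. N (g t - c))" unfolding g_def by (intro continuous_intros)
  then obtain t where t: "0 \<le> t" "t \<le> 1" "N (g t - c) = r"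
    using IVT'[of "\<lambda>t. N (g t - c)" 0 r 1] y u by (auto simp: g_def)
  have s: "N (g t - a) \<le> r" "N (g t - b) \<le> r"
    unfolding g_def using in_disc_convex[of y _ r u t] y u t by auto
  define e where "e = g t - c"
  define F where "F z = max (N (z + c - a)) (N (z + c - b))" for z
  have "N e = r" using t by (simp add: e_def)
  moreover have "continuous_on UNIV F" unfolding F_def by (intro continuous_intros)
  moreover have "F e \<le> r" using s by (simp add: F_def e_def)
  moreover have "r \<le> F (- e)"
  proof (rule ccontr)
    \<comment> \<open>antipodal points of the circle about \<open>c\<close> are not both in the disc about \<open>a\<close>, since \<open>c\<close> is their midpoint\<close>
    assume "\<not> r \<le> F (- e)"
    then have *: "N (- e + c - a) < r" by (simp add: F_def)
    have "N ((1 - 1/2) *\<^sub>R (e + c - a) + (1/2) *\<^sub>R (- (- e + c - a))) < r"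
    proof (rule N_convex_less2)
      show "N (e + c - a) \<le> r" using s by (simp add: e_def)
      show "N (- (- e + c - a)) < r" using * by (simp only: N_minus)
    qed simp_all
    moreover have "(1 - 1/2) *\<^sub>R (e + c - a) + (1/2) *\<^sub>R (- (- e + c - a)) = e"
      by (simp add: prod_eq_iff field_simps)
    ultimately have "N e < r" by (simp only:)
    then show False using \<open>N e = r\<close> by simp
  qed
  ultimately obtain z0 where z0: "N z0 = r" "F z0 = r"
    using circle_intermediate_value[of e F r] by blast
  define z where "z = z0 + c"
  have z: "N (z - c) = r" "max (N (z - a)) (N (z - b)) = r"
    using z0 by (simp_all add: z_def F_def)
  then consider "N (z - a) = r" "N (z - b) \<le> r" | "N (z - b) = r" "N (z - a) \<le> r"
    by (auto simp: max_def split: if_splits)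
  then show ?thesis
  proof cases
    case 1
    have "N (vtx a c - b) \<le> r"
    proof (rule ccontr)
      assume "\<not> N (vtx a c - b) \<le> r"
      then show False
        using separated_chords[of a b c "vtx a c" z] vtx_spec[of a c] dist_le_2r[of z a c] z 1 neq out ab
        by auto
    qed
    then show ?thesis ..
  next
    case 2
    have "N (vtx c b - a) \<le> r"
    proof (rule ccontr)
      assume "\<not> N (vtx c b - a) \<le> r"
      then show False
        using separated_chords[of b a c "vtx c b" z] vtx_spec[of c b] dist_le_2r[of z c b] z 2 neq out ab
        by (auto simp: N_commute)
    qed
    then show ?thesis ..
  qed
qed

lemma diagonals_cross:
  assumes "ccw a c d > 0" "ccw c e d > 0" "ccw a c e > 0" "ccw a e d > 0"
  obtains s t where "0 < s" "s < 1" "0 < t" "t < (1::real)"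
    "(1 - s) *\<^sub>R a + s *\<^sub>R e = (1 - t) *\<^sub>R c + t *\<^sub>R d"
proof -
  have sgn1: "ccw c d a > 0" using assms ccw_rotate[of a c d] by linarith
  have sgn2: "ccw c d e < 0" using assms ccw_rotate[of d c e] ccw_swap[of d c e] by linarith
  have sgn3: "ccw a e c < 0" using assms ccw_rotate[of e a c] ccw_swap[of e a c] by linarith
  note sgn = sgn1 sgn2 sgn3
  define s where "s = ccw c d a / (ccw c d a - ccw c d e)"
  have s: "0 < s" "s < 1" using sgn by (auto simp: s_def field_simps)
  define X where "X = (1 - s) *\<^sub>R a + s *\<^sub>R e"
  have "ccw c d X = ccw c d a - s * (ccw c d a - ccw c d e)"
    unfolding X_def ccw_affine by (simp add: algebra_simps)
  also have "\<dots> = 0" using sgn by (simp add: s_def)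
  finally have "ccw c d X = 0" .
  moreover have "c \<noteq> d" using sgn by (auto simp: ccw_degenerate)
  ultimately obtain t where t: "X = (1 - t) *\<^sub>R c + t *\<^sub>R d" using ccw_eq_0_on_line by blast
  have "ccw a e X = 0" by (simp add: X_def ccw_affine ccw_left ccw_right)
  then have 0: "(1 - t) * ccw a e c + t * ccw a e d = 0" by (simp add: t ccw_affine)
  have "0 < t"
  proof (rule ccontr)
    assume "\<not> 0 < t"
    then have "(1 - t) * ccw a e c < 0" "t * ccw a e d \<le> 0"
      using sgn assms by (auto intro: mult_pos_neg mult_nonpos_nonneg)
    then show False using 0 by linarith
  qed
  moreover have "t < 1"
  proof (rule ccontr)
    assume "\<not> t < 1"
    then have "(1 - t) * ccw a e c \<ge> 0" "t * ccw a e d > 0"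
      using sgn assms by (auto intro: mult_nonpos_nonpos)
    then show False using 0 by linarith
  qed
  ultimately show thesis using that[of s t] s t X_def by simp
qed

text \<open>
  The diagonals of a convex quadrilateral cross at a point \<open>X\<close> in both discs. If \<open>a\<close>, \<open>e\<close> were
  in one difference of the discs and \<open>c\<close>, \<open>d\<close> in the other, the line through the intersection
  points of the circles would separate the diagonals. One end of each diagonal is allowed on
  both circles, that is, on the line itself.
\<close>
lemma diagonals_not_separated:
  assumes quad: "ccw a c d > 0" "ccw c e d > 0" "ccw a c e > 0" "ccw a e d > 0"
    and ae: "N (a - w) \<le> r" "N (e - w) \<le> r" and cd: "N (c - t) \<le> r" "N (d - t) \<le> r"
    and out: "N (e - t) > r" "N (c - w) > r"
    and a: "N (a - t) > r \<or> N (a - t) = r \<and> N (a - w) = r"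
    and d: "N (d - w) > r \<or> N (d - w) = r \<and> N (d - t) = r"
  shows False
proof -
  obtain s k where sk: "0 < s" "s < 1" "0 < k" "k < (1::real)"
    "(1 - s) *\<^sub>R a + s *\<^sub>R e = (1 - k) *\<^sub>R c + k *\<^sub>R d"
    by (rule diagonals_cross[OF quad])
  define X where "X = (1 - s) *\<^sub>R a + s *\<^sub>R e"
  have X': "X = (1 - k) *\<^sub>R c + k *\<^sub>R d" using sk by (simp add: X_def)
  have "a \<noteq> e" "c \<noteq> d" using quad by (auto simp: ccw_degenerate ccw_left ccw_right)
  then have "N (X - w) < r" "N (X - t) < r"
    using in_disc_strict[of a w r e s] in_disc_strict[of c t r d k] sk ae cd X_def X' by auto
  then have wt': "N (w - t) < 2 * r"
    using N_triangle[of "w - X" "X - t"] N_commute[of w X] by simp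
  have wt: "w \<noteq> t" using ae out by auto
  obtain p q where f1: "\<And>x. N (x - w) \<le> r \<Longrightarrow> N (x - t) > r \<Longrightarrow> ccw p q x > 0"
    and f2: "\<And>x. N (x - t) \<le> r \<Longrightarrow> N (x - w) > r \<Longrightarrow> ccw p q x < 0"
    and f3: "\<And>x. N (x - w) = r \<Longrightarrow> N (x - t) = r \<Longrightarrow> ccw p q x = 0"
    by (rule common_chord[OF wt wt']) blast
  have "ccw p q X > 0"
  proof -
    have "ccw p q a \<ge> 0" using f1[of a] f3[of a] a ae by auto
    moreover have "ccw p q e > 0" using f1[of e] ae out by simp
    ultimately show ?thesis unfolding X_def ccw_affine using sk by (simp add: add_nonneg_pos)
  qed
  moreover have "ccw p q X < 0"
  proof -
    have "ccw p q d \<le> 0" using f2[of d] f3[of d] d cd by auto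
    moreover have "ccw p q c < 0" using f2[of c] cd out by simp
    ultimately show ?thesis unfolding X' ccw_affine using sk
      by (simp add: add_neg_nonpos mult_pos_neg mult_nonneg_nonpos)
  qed
  ultimately show False by simp
qed

text \<open>
  If \<open>c\<close> is a corner between \<open>a\<close> and \<open>e\<close>, and \<open>e\<close> one between \<open>c\<close> and \<open>d\<close>, then neither loses
  this property when the other is removed. Suppose that \<open>e\<close> is in the disc about \<open>z = vtx a d\<close>.
  Then \<open>a\<close> is outside the disc about \<open>t\<close>, for otherwise this disc would contain the cap at \<open>a d\<close>
  and with it \<open>e\<close>. Applying \<open>diagonals_not_separated\<close> to \<open>w\<close> and \<open>t\<close> gives that \<open>d\<close> is in the
  disc about \<open>w\<close>, hence \<open>c\<close> is not in the one about \<open>z\<close>; applying it to \<open>z\<close> and \<open>t\<close> gives the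
  contradiction. The other case is the mirror image.
\<close>
lemma shortcut_keeps_vertex:
  assumes quad: "ccw a c d > 0" "ccw c e d > 0" "ccw a c e > 0" "ccw a e d > 0"
    and y: "N (y - a) \<le> r" "N (y - c) \<le> r" "N (y - e) \<le> r" "N (y - d) \<le> r"
    and c: "N (c - vtx a e) > r" and e: "N (e - vtx c d) > r"
  shows "N (c - vtx a d) > r \<and> N (e - vtx a d) > r"
proof -
  define w t z where "w = vtx a e" and "t = vtx c d" and "z = vtx a d"
  have neq: "a \<noteq> e" "c \<noteq> d" "a \<noteq> d"
    using quad by (auto simp: ccw_degenerate ccw_left ccw_right)
  have w: "N (a - w) = r" "N (e - w) = r"
    using vtx_spec[of a e] neq dist_le_2r y by (auto simp: w_def N_commute)
  have t: "N (c - t) = r" "N (d - t) = r"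
    using vtx_spec[of c d] neq dist_le_2r y by (auto simp: t_def N_commute)
  have z: "N (a - z) = r" "N (d - z) = r" "ccw a d z \<ge> 0"
    using vtx_spec[of a d] neq dist_le_2r y by (auto simp: z_def N_commute)
  have cw: "N (c - w) > r" and et: "N (e - t) > r" using c e by (simp_all add: w_def t_def)
  have adc: "ccw a d c < 0" using quad ccw_swap[of d a c] ccw_rotate[of a c d] ccw_rotate[of c d a] by linarith
  have ade: "ccw a d e < 0" using quad ccw_swap[of d a e] ccw_rotate[of a e d] ccw_rotate[of e d a] by linarith
  \<comment> \<open>a disc containing a and d contains the cap of the disc z cut off by the chord ad\<close>
  then have cap: "N (x - v) \<le> r"
    if v: "N (a - v) \<le> r" "N (d - v) \<le> r" and x: "x = c \<or> x = e" "N (x - z) \<le> r" for x v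
  proof (cases "v = z")
    case False
    then have "det2 (d - a) (z - v) > 0"
      using chord_moves_inwards[of a z r d v] z v neq by simp
    moreover have "x \<noteq> a" "x \<noteq> d" using x(1) adc ade by (auto simp: ccw_left ccw_right)
    moreover have "ccw a d x \<le> 0" using x(1) adc ade by auto
    ultimately have "N (x - v) < r" using cap_inside[of a z r d v x] z v x(2) neq(3) by blast
    then show ?thesis by simp
  qed (use x in auto)
  show ?thesis
  proof (rule ccontr)
    assume "\<not> ?thesis"
    then consider "N (e - z) \<le> r" | "N (c - z) \<le> r" by (auto simp: z_def)
    then show False
    proof cases
      case 1
      then have at: "N (a - t) > r" using cap[of t e] t et by force
      have "N (d - w) \<le> r"
        using diagonals_not_separated[OF quad, of w t] w t cw et at by force
      then have cz: "N (c - z) > r" using cap[of w c] w cw by force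
      show False
        using diagonals_not_separated[OF quad, of z t] z t 1 cz at et by auto
    next
      case 2
      then have dw: "N (d - w) > r" using cap[of w c] w cw by force
      have "N (a - t) \<le> r"
        using diagonals_not_separated[OF quad, of w t] w t cw et dw by force
      then have ez: "N (e - z) > r" using cap[of t e] t et by force
      show False
        using diagonals_not_separated[OF quad, of w z] z w 2 ez dw cw by auto
    qed
  qed
qed

end

context strictly_convex_plane begin

section \<open>Ball intersections of finite sets\<close>

lemma norm_le_N: "\<exists>k>0. \<forall>x. k * norm x \<le> N x"
proof -
  have "continuous_on (sphere 0 1) N" using continuous_on_N[of "sphere 0 1" "\<lambda>x. x"] by simp
  moreover have "sphere (0::pt) 1 \<noteq> {}" by simp
  ultimately obtain e where e: "e \<in> sphere 0 1" "\<forall>x\<in>sphere 0 1. N e \<le> N x"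
    using continuous_attains_inf[OF compact_sphere[of "0::pt" 1]] by metis
  then have "N e > 0" by (intro N_pos) auto
  moreover have "N e * norm x \<le> N x" for x
  proof (cases "x = 0")
    case False
    then have "N e \<le> N ((1 / norm x) *\<^sub>R x)" using e(2) by simp
    then show ?thesis using False by (simp add: N_scale field_simps)
  qed simp
  ultimately show ?thesis by blast
qed

lemma bi_iff: "y \<in> bi N K \<rho> \<longleftrightarrow> (\<forall>x\<in>K. N (y - x) \<le> \<rho>)"
  by (simp add: bi_def disc_def)

lemma bi_mono: "s \<le> t \<Longrightarrow> bi N K s \<subseteq> bi N K t"
  unfolding bi_def disc_def by force

lemma closed_bi: "closed (bi N K \<rho>)"
  unfolding bi_def disc_def by (intro closed_INT ballI closed_Collect_le continuous_intros)

lemma convex_bi: "convex (bi N K \<rho>)"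
proof -
  have "convex (disc N x \<rho>)" for x
    unfolding convex_alt disc_def using in_disc_convex[of _ x \<rho>] by simp
  then show ?thesis unfolding bi_def by (simp add: convex_INT)
qed

lemma compact_bi:
  assumes "K \<noteq> {}"
  shows "compact (bi N K \<rho>)"
proof -
  obtain x where x: "x \<in> K" using assms by auto
  obtain k where k: "k > 0" "\<And>x. k * norm x \<le> N x" using norm_le_N by blast
  have "bounded (bi N K \<rho>)"
  proof (rule boundedI)
    fix y assume "y \<in> bi N K \<rho>"
    then have "k * norm (y - x) \<le> \<rho>" using k(2)[of "y - x"] x by (auto simp: bi_iff)
    then have "norm (y - x) \<le> \<rho> / k" using k(1) by (simp add: field_simps)
    then show "norm y \<le> \<rho> / k + norm x" using norm_triangle_sub[of y x] by simp
  qed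
  then show ?thesis using closed_bi by (simp add: compact_eq_bounded_closed)
qed

text \<open>
  The circumradius is defined by \<open>LEAST\<close>, which says nothing unless a least radius exists. It
  does: the ball intersections for the radii \<open>s0 + 1 / Suc n\<close> above the infimum \<open>s0\<close> are nested
  nonempty compact sets, and a common point of them is the center of an enclosing disc of radius
  \<open>s0\<close>.
\<close>
lemma bi_nonempty:
  assumes "finite K" "K \<noteq> {}" "circumradius N K \<le> \<rho>"
  shows "bi N K \<rho> \<noteq> {}"
proof -
  define A where "A = {s. bi N K s \<noteq> {}}"
  define s0 where "s0 = Inf A"
  obtain x where x: "x \<in> K" using assms by auto
  have "x \<in> bi N K (Max ((\<lambda>z. N (x - z)) ` K))" using assms by (auto simp: bi_iff)
  then have A: "A \<noteq> {}" by (auto simp: A_def)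
  have "0 \<le> s" if s: "s \<in> A" for s
  proof -
    obtain y where "y \<in> bi N K s" using s unfolding A_def by blast
    then have "N (y - x) \<le> s" using x by (simp add: bi_iff)
    then show ?thesis using N_nonneg[of "y - x"] by linarith
  qed
  then have bdd: "bdd_below A" by (rule bdd_belowI)
  \<comment> \<open>nested compact sets\<close>
  define F where "F n = bi N K (s0 + 1 / Suc n)" for n
  have "F n \<noteq> {}" for n
  proof -
    obtain s where "s \<in> A" "s < s0 + 1 / Suc n"
      using cInf_lessD[OF A, of "s0 + 1 / Suc n"] by (auto simp: s0_def)
    then show ?thesis using bi_mono[of s "s0 + 1 / Suc n" K] by (auto simp: A_def F_def)
  qed
  moreover have "F n \<subseteq> F m" if "m \<le> n" for m n
  proof -
    have "1 / real (Suc n) \<le> 1 / real (Suc m)" using that by (simp add: field_simps)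
    then show ?thesis unfolding F_def by (intro bi_mono) simp
  qed
  moreover have "compact (F n)" for n unfolding F_def using assms by (intro compact_bi)
  ultimately have "\<Inter> (range F) \<noteq> {}" using compact_nest[of F] by blast
  then obtain y where "y \<in> \<Inter> (range F)" by blast
  then have y: "y \<in> F n" for n by blast
  have "N (y - z) \<le> s0" if "z \<in> K" for z
  proof (rule field_le_epsilon)
    fix e :: real assume "e > 0"
    then obtain n where "1 / real (Suc n) < e" using nat_approx_posE by metis
    moreover have "N (y - z) \<le> s0 + 1 / Suc n" using y that by (auto simp: F_def bi_iff)
    ultimately show "N (y - z) \<le> s0 + e" by linarith
  qed
  then have y0: "y \<in> bi N K s0" by (simp add: bi_iff)
  have "K \<subseteq> disc N c s \<longleftrightarrow> c \<in> bi N K s" for c s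
    by (simp add: subset_eq disc_def bi_iff N_commute[of c])
  then have eq: "(\<exists>c. K \<subseteq> disc N c s) \<longleftrightarrow> s \<in> A" for s
    unfolding A_def by blast
  have "circumradius N K = s0"
    unfolding circumradius_def eq
  proof (rule Least_equality)
    show "s0 \<in> A" using y0 by (auto simp: A_def)
  qed (use bdd in \<open>auto simp: s0_def intro: cInf_lower\<close>)
  then have "y \<in> bi N K \<rho>" using y0 assms(3) bi_mono[of s0 \<rho> K] by auto
  then show ?thesis by blast
qed

end

context ball_plane begin

text \<open>
  A frontier point cannot be strictly inside all of the finitely many discs. Conversely, moving
  a point of a circle away from the center leaves the disc.
\<close>
lemma frontier_bi:
  assumes "finite K"
  shows "z \<in> frontier (bi N K r) \<longleftrightarrow> z \<in> bi N K r \<and> (\<exists>x\<in>K. N (z - x) = r)"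
proof
  assume z: "z \<in> frontier (bi N K r)"
  then have zR: "z \<in> bi N K r" using closed_bi frontier_subset_closed by blast
  moreover have "\<exists>x\<in>K. N (z - x) = r"
  proof (rule ccontr)
    assume "\<not> ?thesis"
    then have "z \<in> (\<Inter>x\<in>K. {y. N (y - x) < r})" using zR by (force simp: bi_iff)
    moreover have "open (\<Inter>x\<in>K. {y. N (y - x) < r})"
      using assms by (intro open_INT ballI open_Collect_less continuous_intros) auto
    moreover have "(\<Inter>x\<in>K. {y. N (y - x) < r}) \<subseteq> bi N K r" by (force simp: bi_iff)
    ultimately have "z \<in> interior (bi N K r)" by (meson interiorI)
    then show False using z by (simp add: frontier_def)
  qed
  ultimately show "z \<in> bi N K r \<and> (\<exists>x\<in>K. N (z - x) = r)" by simp
next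
  assume *: "z \<in> bi N K r \<and> (\<exists>x\<in>K. N (z - x) = r)"
  then obtain x where x: "x \<in> K" "N (z - x) = r" by auto
  have "z \<notin> interior (bi N K r)"
  proof
    assume "z \<in> interior (bi N K r)"
    then obtain e where e: "e > 0" "ball z e \<subseteq> bi N K r" by (meson mem_interior)
    have zx: "norm (z - x) > 0" using x r_pos by auto
    define t where "t = e / (2 * norm (z - x))"
    have t: "t > 0" using e zx by (simp add: t_def)
    have "dist z (z + t *\<^sub>R (z - x)) = e / 2" using t zx by (simp add: dist_norm) (simp add: t_def)
    then have "z + t *\<^sub>R (z - x) \<in> bi N K r" using e by auto
    then have "N (z + t *\<^sub>R (z - x) - x) \<le> r" using x by (simp add: bi_iff)
    moreover have "z + t *\<^sub>R (z - x) - x = (1 + t) *\<^sub>R (z - x)" by (simp add: algebra_simps)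
    ultimately have "(1 + t) * r \<le> r" using x t by (simp add: N_scale)
    then show False using t r_pos by simp
  qed
  then show "z \<in> frontier (bi N K r)" using * closure_subset by (auto simp: frontier_def)
qed

text \<open>
  The cap of the disc about \<open>vtx a k\<close> to the right of \<open>a k\<close> lies in every disc that contains \<open>a\<close>
  and \<open>k\<close>. So whoever is within distance \<open>r\<close> from \<open>a\<close> and \<open>k\<close> is within distance \<open>r\<close> from each
  point \<open>b\<close> of the cap.
\<close>
lemma redundant_if_in_cap:
  assumes "a \<noteq> k" "ccw a b k \<ge> 0" "N (b - vtx a k) \<le> r" "N (y - a) \<le> r" "N (y - k) \<le> r"
  shows "N (y - b) \<le> r"
proof -
  define v where "v = vtx a k"
  have v: "N (a - v) = r" "N (k - v) = r" "ccw a k v \<ge> 0"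
    using vtx_spec[of a k] dist_le_2r assms by (auto simp: v_def N_commute)
  have b: "ccw a k b \<le> 0" using assms(2) ccw_swap[of k a b] ccw_rotate[of a b k] ccw_rotate[of b k a] by linarith
  show ?thesis
  proof (cases "y = v")
    case True
    then show ?thesis using assms(3) by (simp add: v_def N_commute)
  next
    case False
    then have "det2 (k - a) (v - y) > 0"
      using chord_moves_inwards[of a v r k y] v assms by (simp add: N_commute)
    then have "b = a \<or> b = k \<or> N (b - y) < r"
      using cap_inside[of a v r k y b] v assms b by (auto simp: N_commute v_def)
    then show ?thesis using assms by (auto simp: N_commute)
  qed
qed

text \<open>
  The orientation of the chord of an arc. The arc of \<open>c\<close> starts at \<open>vtx a c\<close>, where \<open>a\<close> precedes
  \<open>c\<close>, and ends at a point \<open>q\<close> of the disc about \<open>a\<close>; this forces its center to the left of the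
  chord, so that the arc is the boundary of a cap that is contained in all discs containing its
  ends. If the center were to the right, then \<open>vtx c a\<close>, which is on the circle about \<open>a\<close>, would
  be strictly inside it by the cap property.
\<close>
lemma arc_is_minor:
  assumes "a \<noteq> c" "N (q - c) = r" "N (q - a) \<le> r" "q \<noteq> vtx a c"
    and x: "x \<noteq> c" "N (vtx a c - x) \<le> r" "N (q - x) \<le> r"
  shows "det2 (q - vtx a c) (c - x) > 0"
proof -
  define p where "p = vtx a c"
  define p' where "p' = vtx c a"
  have p: "N (p - a) = r" "N (p - c) = r" "ccw a c p \<ge> 0"
    using vtx_spec[of a c] dist_le_2r[of q a c] assms by (auto simp: p_def)
  have pq: "p \<noteq> q" using assms p_def by auto
  have ac: "N (c - a) < 2 * r" using close_if_common_points[of p c r q a] p pq assms by simp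
  have p': "N (p' - a) = r" "N (p' - c) = r" "ccw c a p' > 0"
    using vtx_spec[of c a] vtx_off_line[of c a] assms ac by (auto simp: p'_def N_commute)
  have ccp: "ccw a c p > 0" using vtx_off_line[of a c] assms ac by (auto simp: p_def)
  have pp': "p \<noteq> p'" using ccp p' ccw_swap[of c a p'] by auto
  have side: "ccw p q c \<ge> 0"
  proof (rule ccontr)
    assume "\<not> ccw p q c \<ge> 0"
    then have "ccw q p c \<ge> 0" by (simp add: ccw_swap[of q p])
    then have d: "det2 (p - q) (c - a) > 0"
      using chord_moves_inwards[of q c r p a] p pq assms by simp
    have "det2 (p - q) (c - a) = ccw a c q - ccw a c p" by (simp add: ccw_def det2_def algebra_simps)
    then have ccq: "ccw a c q > 0" using d ccp by simp
    have qa: "N (q - a) < r"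
      using vtxI[of a c q] ccq assms pq p_def by force
    have d': "det2 (p - p') (a - c) > 0"
    proof -
      have "det2 (p - p') (a - c) = ccw a c p + ccw c a p'" by (simp add: ccw_def det2_def algebra_simps)
      then show ?thesis using ccp p' by simp
    qed
    have "ccw p' p q > 0"
    proof (rule ccontr)
      assume "\<not> ccw p' p q > 0"
      moreover have "q \<noteq> p'" using qa p' by auto
      ultimately have "N (q - c) < r"
        using cap_inside[of p' a r p c q] p p' pp' d' assms pq by auto
      then show False using assms by simp
    qed
    then have "ccw q p p' < 0"
      using ccw_rotate[of q p p'] ccw_swap[of p' p q] by linarith
    moreover have "q \<noteq> p'" using qa p' by auto
    ultimately have "N (p' - a) < r"
      using cap_inside[of q c r p a p'] p p' pp' d assms pq by auto
    then show False using p' by simp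
  qed
  then show ?thesis
    using chord_moves_inwards[of p c r q x] p pq assms by (auto simp: p_def)
qed

end

section \<open>Rings of centers\<close>

text \<open>
  A closed polygon that turns counterclockwise around \<open>z\<close> has \<open>z\<close> in its convex hull, convex or
  not. Otherwise some linear functional is positive on all \<open>v i - z\<close>, and the slopes \<open>g i / h i\<close>
  of these vectors increase with \<open>i\<close>, although they are periodic.
\<close>
lemma in_convex_hull_if_left_of_edges:
  fixes v :: "nat \<Rightarrow> pt"
  assumes m: "m > 0" and per: "\<And>i. v (i + m) = v i"
    and left: "\<And>i. ccw (v i) (v (Suc i)) z > 0"
  shows "z \<in> convex hull (v ` {..<m})"
proof (rule ccontr)
  assume nz: "z \<notin> convex hull (v ` {..<m})"
  have "closed (convex hull (v ` {..<m}))"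
    by (intro compact_imp_closed compact_convex_hull finite_imp_compact) simp
  then obtain n b where n: "inner n z < b" "\<forall>x\<in>convex hull (v ` {..<m}). inner n x > b"
    using separating_hyperplane_closed_point[of "convex hull (v ` {..<m})" z] nz convex_convex_hull by blast
  have vmod: "v i = v (i mod m)" for i
  proof -
    have "v (j + k * m) = v j" for j k
      by (induction k) (simp_all add: per add.assoc[symmetric], metis add.assoc add.commute per)
    then show ?thesis by (metis mod_div_decomp add.commute mult.commute)
  qed
  define h where "h i = inner n (v i - z)" for i
  define g where "g i = det2 n (v i - z)" for i
  have h: "h i > 0" for i
  proof -
    have "v i \<in> convex hull (v ` {..<m})" using vmod[of i] m by (intro hull_inc) auto
    then show ?thesis using n by (force simp: h_def inner_diff_right)
  qed
  have inc: "g i / h i < g (Suc i) / h (Suc i)" for i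
  proof -
    have "ccw (v i) (v (Suc i)) z * inner n n = h i * g (Suc i) - g i * h (Suc i)"
      by (simp add: h_def g_def ccw_def det2_def inner_prod_def algebra_simps)
    moreover have "n \<noteq> 0" using n(2) h[of 0] by (auto simp: h_def)
    then have "ccw (v i) (v (Suc i)) z * inner n n > 0" using left by simp
    ultimately show ?thesis using h[of i] h[of "Suc i"] by (simp add: field_simps)
  qed
  have "g (0 + m) / h (0 + m) > g 0 / h 0"
    using lift_Suc_mono_less[of "\<lambda>i. g i / h i" 0 "0 + m"] inc m by simp
  then show False using per[of 0] by (simp add: g_def h_def)
qed

context ball_plane begin

text \<open>
  Corners between neighbors are corners between any two points of the chain before and after
  them: by induction on the distance \<open>k - i\<close>, removing a point next to \<open>l\<close> with
  \<open>shortcut_keeps_vertex\<close>.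
\<close>
lemma triples_from_local:
  fixes c :: "nat \<Rightarrow> pt"
  assumes conv: "\<And>i l k. i < l \<Longrightarrow> l < k \<Longrightarrow> k < M \<Longrightarrow> ccw (c i) (c l) (c k) > 0"
    and y: "\<And>i. i < M \<Longrightarrow> N (y - c i) \<le> r"
    and loc: "\<And>i. i + 2 < M \<Longrightarrow> N (c (i + 1) - vtx (c i) (c (i + 2))) > r"
  shows "i < l \<Longrightarrow> l < k \<Longrightarrow> k < M \<Longrightarrow> N (c l - vtx (c i) (c k)) > r"
proof (induction "k - i" arbitrary: i l k rule: less_induct)
  case less
  consider "k = i + 2" | "l \<ge> i + 2" | "l = i + 1" "k \<ge> i + 3" using less.prems by linarith
  then show ?case
  proof cases
    case 1
    then show ?thesis using loc[of i] less.prems by (metis Suc_eq_plus1 add_2_eq_Suc' less_SucE not_less_eq)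
  next
    case 2
    have "N (c (l - 1) - vtx (c i) (c l)) > r" "N (c l - vtx (c (l - 1)) (c k)) > r"
      using less.hyps[of l i "l - 1"] less.hyps[of k "l - 1" l] 2 less.prems by auto
    then show ?thesis
      using shortcut_keeps_vertex[of "c i" "c (l - 1)" "c k" "c l" y] conv y 2 less.prems by auto
  next
    case 3
    have "N (c l - vtx (c i) (c (l + 1))) > r" "N (c (l + 1) - vtx (c l) (c k)) > r"
      using less.hyps[of "l + 1" i l] less.hyps[of k l "l + 1"] 3 less.prems by auto
    then show ?thesis
      using shortcut_keeps_vertex[of "c i" "c l" "c k" "c (l + 1)" y] conv y 3 less.prems by auto
  qed
qed

text \<open>
  If the circles about three corners of a triangle have a common point \<open>v\<close>, then \<open>v\<close> is inside
  the triangle, since on an outer side of an edge it would be the vertex of that edge and the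
  third point would be in its disc. By \<open>chord_moves_inwards\<close>, another common point of the discs
  would be farther to the right than \<open>v\<close> with respect to all three edges.
\<close>
lemma single_point_if_circumscribed:
  assumes corners: "N (b - vtx a x) > r" "N (a - vtx x b) > r" "N (x - vtx b a) > r"
    and neq: "a \<noteq> b" "b \<noteq> x" "a \<noteq> x"
    and v: "N (v - a) = r" "N (v - b) = r" "N (v - x) = r"
    and y: "N (y - a) \<le> r" "N (y - b) \<le> r" "N (y - x) \<le> r"
  shows "y = v"
proof (rule ccontr)
  assume yv: "y \<noteq> v"
  have "ccw a x v < 0" using vtxI[of a x v] corners v neq by (force simp: N_commute)
  moreover have "ccw x b v < 0" using vtxI[of x b v] corners v neq by (force simp: N_commute)
  moreover have "ccw b a v < 0" using vtxI[of b a v] corners v neq by (force simp: N_commute)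
  ultimately have "ccw a b v \<ge> 0" "ccw b x v \<ge> 0" "ccw x a v \<ge> 0"
    using ccw_swap[of b a v] ccw_swap[of x b v] ccw_swap[of a x v] by simp_all
  then have "det2 (b - a) (v - y) > 0" "det2 (x - b) (v - y) > 0" "det2 (a - x) (v - y) > 0"
    using chord_moves_inwards[of a v r b y] chord_moves_inwards[of b v r x y]
      chord_moves_inwards[of x v r a y] v y neq yv by (auto simp: N_commute)
  moreover have "det2 (b - a) (v - y) + det2 (x - b) (v - y) + det2 (a - x) (v - y) = 0"
    by (simp add: det2_def algebra_simps)
  ultimately show False by linarith
qed

end

text \<open>
  A cyclic sequence of distinct centers is a sequence with period \<open>m\<close>. This makes the successor
  of the last center an ordinary successor, and a cyclic interval an interval.
\<close>
locale center_ring = ball_plane +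
  fixes c :: "nat \<Rightarrow> pt" and m :: nat
  assumes m2: "m \<ge> 2" and periodic: "\<And>i. c (i + m) = c i"
    and distinct_c: "\<And>i j. i < j \<Longrightarrow> j < i + m \<Longrightarrow> c i \<noteq> c j"
    and nonempty: "bi N (range c) r \<noteq> {}"
begin

definition v :: "nat \<Rightarrow> pt" where "v i = vtx (c i) (c (Suc i))"

lemma v_periodic: "v (i + m) = v i"
  using periodic[of i] periodic[of "Suc i"] by (simp add: v_def)

lemma consecutive_distinct: "c i \<noteq> c (Suc i)"
  using distinct_c[of i "Suc i"] m2 by simp

lemma v_spec: "N (v i - c i) = r" "N (v i - c (Suc i)) = r"
proof -
  obtain y where "y \<in> bi N (range c) r" using nonempty by blast
  then have "N (c (Suc i) - c i) \<le> 2 * r" using dist_le_2r[of y "c i" "c (Suc i)"] by (simp add: bi_iff)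
  then show "N (v i - c i) = r" "N (v i - c (Suc i)) = r"
    using vtx_spec consecutive_distinct by (auto simp: v_def)
qed

lemma periodic_mod:
  assumes "\<And>i. f (i + m) = f i"
  shows "f (i::nat) = f (i mod m)"
proof -
  have "f (j + k * m) = f j" for j k
  proof (induction k)
    case (Suc k)
    then show ?case using assms[of "j + k * m"] by (simp add: algebra_simps)
  qed simp
  then show ?thesis by (metis mod_div_decomp add.commute mult.commute)
qed

lemma center_in_window: "\<exists>j'. i \<le> j' \<and> j' < i + m \<and> c j' = c j"
proof -
  define j' where "j' = i + (j + (m - i mod m)) mod m"
  have "j' mod m = (i mod m + (j + (m - i mod m))) mod m"
    unfolding j'_def by (simp add: mod_simps)
  also have "i mod m < m" using m2 by simp
  then have "i mod m + (j + (m - i mod m)) = j + m" by simp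
  finally have "c j' = c j" using periodic_mod[of c, OF periodic] by (metis mod_add_self2)
  moreover have "i \<le> j'" "j' < i + m" using m2 by (auto simp: j'_def)
  ultimately show ?thesis by blast
qed

text \<open>
  A frontier point lies on the circle of some center and, by \<open>in_convex_hull_if_left_of_edges\<close>,
  not to the left of every edge of the vertex polygon. So it is in the cap of some edge; there
  it is strictly inside all discs but the one that bounds the cap, or it is an end of the edge.
\<close>
theorem frontier_is_arcs:
  assumes vR: "\<And>i. v i \<in> bi N (range c) r" and v_step: "\<And>i. v i \<noteq> v (Suc i)"
  shows "frontier (bi N (range c) r) = (\<Union>i<m. ccw_arc N (c (Suc i)) r (v i) (v (Suc i)))"
proof -
  have fin: "finite (range c)"
  proof -
    have "range c \<subseteq> c ` {..<m}"
      using periodic_mod[of c, OF periodic] m2 by (force intro: image_eqI[where x = "i mod m" for i])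
    then show ?thesis using finite_surj by blast
  qed
  have cap: "z = v i \<or> z = v (Suc i) \<or> N (z - c j) < r"
    if "N (z - c (Suc i)) \<le> r" "ccw (v i) (v (Suc i)) z \<le> 0" "c j \<noteq> c (Suc i)" for z i j
  proof -
    have "det2 (v (Suc i) - v i) (c (Suc i) - c j) > 0"
      using arc_is_minor[of "c i" "c (Suc i)" "v (Suc i)" "c j"] consecutive_distinct[of i] v_spec[of "Suc i"] vR
        v_step[of i] that by (auto simp: v_def bi_iff)
    then show ?thesis
      using cap_inside[of "v i" "c (Suc i)" r "v (Suc i)" "c j" z] v_spec vR v_step that
      by (auto simp: bi_iff)
  qed
  have arc: "z \<in> ccw_arc N (c (Suc i)) r (v i) (v (Suc i)) \<longleftrightarrow>
      N (z - c (Suc i)) = r \<and> ccw (v i) (v (Suc i)) z \<le> 0" for z i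
    by (simp add: ccw_arc_def circle_def ccw_def)
  show ?thesis
  proof (intro equalityI subsetI)
    fix z assume z: "z \<in> frontier (bi N (range c) r)"
    then obtain j where zR: "z \<in> bi N (range c) r" and j: "N (z - c j) = r"
      using frontier_bi[OF fin] by auto
    have "\<exists>i. ccw (v i) (v (Suc i)) z \<le> 0"
    proof (rule ccontr)
      assume "\<not> ?thesis"
      then have pos: "\<And>i. ccw (v i) (v (Suc i)) z > 0" by (simp add: not_le)
      define U where "U = (\<Inter>i<m. {z. ccw (v i) (v (Suc i)) z > 0})"
      have "open U"
        unfolding U_def ccw_def det2_def
        by (intro open_INT ballI open_Collect_less continuous_intros) simp
      moreover have "z \<in> U" using pos by (simp add: U_def)
      moreover have "U \<subseteq> bi N (range c) r"
      proof
        fix x assume x: "x \<in> U"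
        have "ccw (v i) (v (Suc i)) x > 0" for i
        proof -
          have "ccw (v (i mod m)) (v (Suc (i mod m))) x > 0" using x m2 by (auto simp: U_def)
          then show ?thesis
            using periodic_mod[of v, OF v_periodic, of i] periodic_mod[of v, OF v_periodic, of "Suc i"]
              periodic_mod[of v, OF v_periodic, of "Suc (i mod m)"] by (simp add: mod_Suc_eq)
        qed
        then have "x \<in> convex hull (v ` {..<m})"
          using in_convex_hull_if_left_of_edges[of m v x] v_periodic m2 by simp
        also have "\<dots> \<subseteq> bi N (range c) r" using vR convex_bi by (intro hull_minimal) auto
        finally show "x \<in> bi N (range c) r" .
      qed
      ultimately have "z \<in> interior (bi N (range c) r)" by (meson interiorI)
      then show False using z by (simp add: frontier_def)
    qed
    then obtain i where i: "ccw (v i) (v (Suc i)) z \<le> 0" by blast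
    have "z \<in> ccw_arc N (c (Suc i)) r (v i) (v (Suc i))"
    proof (cases "z = v i \<or> z = v (Suc i)")
      case True
      then show ?thesis using v_spec[of i] v_spec[of "Suc i"] by (auto simp: arc ccw_left ccw_right)
    next
      case False
      then have "c j = c (Suc i)" using cap[of z i j] i zR j by (auto simp: bi_iff)
      then show ?thesis using i j by (simp add: arc)
    qed
    moreover have "c (Suc i) = c (Suc (i mod m))" "v i = v (i mod m)" "v (Suc i) = v (Suc (i mod m))"
      using periodic_mod[of v, OF v_periodic, of i] periodic_mod[of v, OF v_periodic, of "Suc i"]
        periodic_mod[of v, OF v_periodic, of "Suc (i mod m)"]
        periodic_mod[of c, OF periodic, of "Suc i"] periodic_mod[of c, OF periodic, of "Suc (i mod m)"]
      by (simp_all add: mod_Suc_eq)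
    ultimately show "z \<in> (\<Union>i<m. ccw_arc N (c (Suc i)) r (v i) (v (Suc i)))"
      using m2 by (auto intro!: bexI[of _ "i mod m"])
  next
    fix z assume "z \<in> (\<Union>i<m. ccw_arc N (c (Suc i)) r (v i) (v (Suc i)))"
    then obtain i where i: "N (z - c (Suc i)) = r" "ccw (v i) (v (Suc i)) z \<le> 0" by (auto simp: arc)
    have "N (z - c j) \<le> r" for j
      using cap[of z i j] i vR[of i] vR[of "Suc i"] by (cases "c j = c (Suc i)") (auto simp: bi_iff)
    then show "z \<in> frontier (bi N (range c) r)" using frontier_bi[OF fin] i by (auto simp: bi_iff)
  qed
qed

end

locale convex_ring = center_ring +
  assumes m3: "m \<ge> 3"
    and convex_c: "\<And>i l k. i < l \<Longrightarrow> l < k \<Longrightarrow> k < i + m \<Longrightarrow> ccw (c i) (c l) (c k) > 0"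
    and local_c: "\<And>i. N (c (i + 1) - vtx (c i) (c (i + 2))) > r"
begin

lemma corners_at_distance:
  assumes "i < l" "l < k" "k < i + m"
  shows "N (c l - vtx (c i) (c k)) > r"
proof -
  obtain y where y: "y \<in> bi N (range c) r" using nonempty by blast
  have "N (c (i + (l - i)) - vtx (c (i + 0)) (c (i + (k - i)))) > r"
  proof (rule triples_from_local[where c = "\<lambda>j. c (i + j)" and M = m and y = y])
    show "N (c (i + (j + 1)) - vtx (c (i + j)) (c (i + (j + 2)))) > r" for j
      using local_c[of "i + j"] by (simp add: add.assoc)
  qed (use assms y convex_c in \<open>auto simp: bi_iff\<close>)
  then show ?thesis using assms by simp
qed

lemma corners_of_triangle:
  assumes "i + 1 < j" "j < i + m"
  shows "N (c (Suc i) - vtx (c i) (c j)) > r" "N (c i - vtx (c j) (c (Suc i))) > r"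
    "N (c j - vtx (c (Suc i)) (c i)) > r"
proof -
  show "N (c (Suc i) - vtx (c i) (c j)) > r" using corners_at_distance[of i "Suc i" j] assms by simp
  show "N (c i - vtx (c j) (c (Suc i))) > r"
    using corners_at_distance[of j "i + m" "Suc i + m"] periodic[of i] periodic[of "Suc i"] assms by simp
  show "N (c j - vtx (c (Suc i)) (c i)) > r"
    using corners_at_distance[of "Suc i" j "i + m"] periodic[of i] assms by simp
qed

text \<open>
  If the disc about \<open>c j\<close> missed the vertex between \<open>c i\<close> and \<open>c (Suc i)\<close>, it would miss both
  vertices of their lens, and one of the two centers would be redundant, which contradicts the
  corner conditions of the triangle.
\<close>
lemma vertices_in_bi: "v i \<in> bi N (range c) r"
proof -
  obtain y where y: "y \<in> bi N (range c) r" using nonempty by blast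
  have "N (v i - c j) \<le> r" if ij: "i \<le> j" "j < i + m" for j
  proof -
    consider "j = i" | "j = Suc i" | "i + 1 < j" using ij(1) by linarith
    then show ?thesis
    proof cases
      case 3
      then have "c i \<noteq> c (Suc i)" "c i \<noteq> c j" "c (Suc i) \<noteq> c j"
        using consecutive_distinct distinct_c[of i j] distinct_c[of "Suc i" j] ij by auto
      note neq = this
      show ?thesis
      proof (rule ccontr)
        assume "\<not> ?thesis"
        then have "N (vtx (c i) (c (Suc i)) - c j) > r" by (simp add: v_def)
        moreover have "N (vtx (c (Suc i)) (c i) - c j) > r"
          using corners_of_triangle(3)[OF 3 ij(2)] by (simp add: N_commute)
        ultimately have "N (vtx (c i) (c j) - c (Suc i)) \<le> r \<or> N (vtx (c j) (c (Suc i)) - c i) \<le> r"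
          using redundant_if_arc_cut_off[of y "c i" "c (Suc i)" "c j"] neq y by (simp add: bi_iff)
        then show False
          using corners_of_triangle(1,2)[OF 3 ij(2)] N_commute[of "c (Suc i)"] N_commute[of "c i"] by simp
      qed
    qed (use v_spec[of i] in auto)
  qed
  then have "N (v i - c j) \<le> r" for j using center_in_window[of i j] by metis
  then show ?thesis by (auto simp: bi_iff)
qed

text \<open>
  Two equal vertices belong to at least three centers, whose circles all pass through this
  point.
\<close>
lemma single_point_if_vertices_agree:
  assumes "i < j" "j < i + m" "v i = v j" "y \<in> bi N (range c) r"
  shows "y = v i"
proof -
  define k where "k = (if j = i + 1 then i + 2 else j)"
  have k: "i + 1 < k" "k < i + m" "N (v i - c k) = r"
    using assms m3 v_spec[of j] by (auto simp: k_def)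
  have "c i \<noteq> c (Suc i)" "c i \<noteq> c k" "c (Suc i) \<noteq> c k"
    using consecutive_distinct distinct_c[of i k] distinct_c[of "Suc i" k] k by auto
  then show ?thesis
    using single_point_if_circumscribed[of "c (Suc i)" "c i" "c k" "v i" y] corners_of_triangle[OF k(1,2)] k v_spec[of i] assms
    by (auto simp: bi_iff)
qed

end

section \<open>Convex chains and the angular order\<close>

text \<open>
  The vectors from the lexicographically least point to other points. They lie in a half-open
  half-plane, in which the sign of \<open>det2\<close> is a transitive comparison of directions.
\<close>
definition lexpos :: "pt \<Rightarrow> bool" where
  "lexpos u \<longleftrightarrow> fst u > 0 \<or> fst u = 0 \<and> snd u > 0"

lemma det2_trans:
  assumes "lexpos u" "lexpos v" "lexpos w" "det2 u v \<ge> 0" "det2 v w \<ge> 0"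
  shows "det2 u w \<ge> 0" "det2 u v > 0 \<or> det2 v w > 0 \<Longrightarrow> det2 u w > 0"
proof -
  have id: "fst v * det2 u w = fst u * det2 v w + fst w * det2 u v"
    by (simp add: det2_def algebra_simps)
  have nn: "fst u \<ge> 0" "fst v \<ge> 0" "fst w \<ge> 0" using assms by (auto simp: lexpos_def)
  have vert: "det2 x y = fst x * snd y" if "fst y = 0" for x y
    using that by (simp add: det2_def)
  have vert': "det2 x y = - (snd x * fst y)" if "fst x = 0" for x y
    using that by (simp add: det2_def)
  have "det2 u w \<ge> 0 \<and> (det2 u v > 0 \<or> det2 v w > 0 \<longrightarrow> det2 u w > 0)"
  proof (cases "fst v = 0")
    case True
    then have sv: "snd v > 0" using assms by (simp add: lexpos_def)
    have "fst w = 0" using assms(5) vert'[OF True, of w] sv nn(3)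
      by (metis mult_pos_pos neg_0_le_iff_le not_less order_le_less)
    then have sw: "snd w > 0" using assms by (simp add: lexpos_def)
    have "det2 v w = 0" "det2 u v = fst u * snd v" "det2 u w = fst u * snd w"
      using True \<open>fst w = 0\<close> by (simp_all add: det2_def)
    then show ?thesis using sv sw nn by (simp add: zero_less_mult_iff)
  next
    case False
    then have fv: "fst v > 0" using nn by simp
    have "fst v * det2 u w \<ge> 0" unfolding id using nn assms by simp
    then have "det2 u w \<ge> 0" using fv by (simp add: zero_le_mult_iff)
    moreover have "det2 u w > 0" if "det2 u v > 0"
    proof (cases "fst w = 0")
      case True
      then have sw: "snd w > 0" using assms by (simp add: lexpos_def)
      have "fst u > 0"
      proof (rule ccontr)
        assume "\<not> fst u > 0"
        then have "fst u = 0" using nn by simp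
        then have "det2 u v = - (snd u * fst v)" "snd u > 0"
          using assms vert' by (auto simp: lexpos_def)
        moreover have "snd u * fst v > 0" using \<open>snd u > 0\<close> fv by simp
        ultimately show False using that by linarith
      qed
      then show ?thesis using vert[OF True, of u] sw by simp
    next
      case False
      then have "fst v * det2 u w > 0" unfolding id using nn assms that by (simp add: add_nonneg_pos)
      then show ?thesis using fv by (simp add: zero_less_mult_iff)
    qed
    moreover have "det2 u w > 0" if "det2 v w > 0"
    proof (cases "fst u = 0")
      case True
      then have su: "snd u > 0" using assms by (simp add: lexpos_def)
      have "det2 u v < 0" using vert'[OF True, of v] su fv by simp
      then show ?thesis using assms by simp
    next
      case False
      then have "fst v * det2 u w > 0" unfolding id using nn assms that by (simp add: add_pos_nonneg)
      then show ?thesis using fv by (simp add: zero_less_mult_iff)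
    qed
    ultimately show ?thesis by blast
  qed
  then show "det2 u w \<ge> 0" "det2 u v > 0 \<or> det2 v w > 0 \<Longrightarrow> det2 u w > 0" by blast+
qed

lemma det2_parallel_lexpos:
  assumes "lexpos u" "lexpos v" "det2 u v = 0"
  obtains s where "s > 0" "v = s *\<^sub>R u"
proof -
  have "u \<noteq> 0" using assms by (auto simp: lexpos_def)
  then obtain s where s: "v = s *\<^sub>R u" using det2_eq_0_parallel assms(3) by blast
  have "s > 0"
  proof (rule ccontr)
    assume "\<not> s > 0"
    then have "s * fst u \<le> 0" "fst u = 0 \<Longrightarrow> s * snd u \<le> 0"
      using assms(1) by (auto simp: lexpos_def mult_nonpos_nonneg)
    moreover have "fst u = 0" if "s * fst u = 0" "s \<noteq> 0" using that by simp
    ultimately show False using assms(2) s by (cases "s = 0") (auto simp: lexpos_def)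
  qed
  then show thesis using that s by blast
qed

text \<open>
  The vertices of a strictly convex polygon in counterclockwise order. The definition quantifies
  over all triples, so that the property passes to sublists.
\<close>
definition convex_list :: "pt list \<Rightarrow> bool" where
  "convex_list L \<longleftrightarrow> (\<forall>i j k. i < j \<and> j < k \<and> k < length L \<longrightarrow> ccw (L ! i) (L ! j) (L ! k) > 0)"

lemma convex_listD: "convex_list L \<Longrightarrow> i < j \<Longrightarrow> j < k \<Longrightarrow> k < length L \<Longrightarrow> ccw (L ! i) (L ! j) (L ! k) > 0"
  by (simp add: convex_list_def)

lemma convex_list_tl: "convex_list L \<Longrightarrow> convex_list (tl L)"
  by (auto simp: convex_list_def nth_tl)

lemma convex_list_butlast: "convex_list L \<Longrightarrow> convex_list (butlast L)"
  by (auto simp: convex_list_def nth_butlast)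

lemma convex_list_distinct:
  assumes "convex_list L" "length L \<ge> 3"
  shows "distinct L"
  unfolding distinct_conv_nth
proof (intro allI impI notI)
  have *: False if "i < j" "j < length L" "L ! i = L ! j" for i j
  proof -
    consider "j + 1 < length L" | "i > 0" | "i + 1 < j" using that assms(2) by linarith
    then show False
    proof cases
      case 1 then show False using convex_listD[OF assms(1), of i j "j + 1"] that by (simp add: ccw_degenerate)
    next
      case 2 then show False using convex_listD[OF assms(1), of 0 i j] that by (simp add: ccw_right)
    next
      case 3 then show False using convex_listD[OF assms(1), of i "i + 1" j] that by (simp add: ccw_left)
    qed
  qed
  fix i j assume "i < length L" "j < length L" "i \<noteq> j" "L ! i = L ! j"
  then show False using *[of i j] *[of j i] by (cases i j rule: linorder_cases) auto
qed

text \<open>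
  Pluecker relations for directions at the common point \<open>d\<close>: signs of four orientations
  determine a fifth one.
\<close>
lemma ccw_plucker:
  "ccw p' q d * ccw p d k = ccw p q d * ccw p' d k + ccw p' p d * ccw q d k"
  "ccw p d e * ccw q d k = ccw q d e * ccw p d k + ccw p q d * ccw d e k"
  unfolding ccw_def det2_def fst_diff snd_diff by algebra+

text \<open>
  It is enough that the last turn is to the left and that the new point comes last in the
  angular order around the first one. The turn at each earlier edge follows from the turn at the
  next edge, from the end of the chain backwards.
\<close>
lemma convex_list_snoc:
  assumes conv: "convex_list L" and len: "length L \<ge> 2"
    and ang: "\<And>j. 0 < j \<Longrightarrow> j < length L \<Longrightarrow> ccw (L ! 0) (L ! j) k > 0"
    and last: "ccw (L ! (length L - 2)) (L ! (length L - 1)) k > 0"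
  shows "convex_list (L @ [k])"
proof -
  have step: "ccw (L ! (j - 1)) (L ! j) k > 0" if "0 < j" "j < length L" for j
    using that(2,1)
  proof (induction "length L - j" arbitrary: j rule: less_induct)
    case less
    consider "j = length L - 1" | "j = 1" | "j > 1" "j + 1 < length L" using less.prems by linarith
    then show ?case
    proof cases
      case 1
      then show ?thesis using last by (simp add: numeral_2_eq_2)
    next
      case 2
      then show ?thesis using ang less.prems by simp
    next
      case 3
      let ?o = "L ! 0" and ?q = "L ! (j - 1)" and ?d = "L ! j" and ?e = "L ! (j + 1)"
      have IH: "ccw ?d ?e k > 0" using less.hyps[of "j + 1"] 3 by simp
      have "ccw ?o ?d ?e > 0" "ccw ?q ?d ?e > 0" "ccw ?o ?q ?d > 0"
        using convex_listD[OF conv] 3 by auto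
      moreover have "ccw ?o ?d k > 0" using ang 3 by simp
      ultimately have "ccw ?q ?d ?e * ccw ?o ?d k + ccw ?o ?q ?d * ccw ?d ?e k > 0"
        using IH by (simp add: add_pos_pos)
      then have "ccw ?o ?d ?e * ccw ?q ?d k > 0" using ccw_plucker(2)[of ?o ?d ?e ?q k] by simp
      then show ?thesis using \<open>ccw ?o ?d ?e > 0\<close> by (simp add: zero_less_mult_iff)
    qed
  qed
  have new: "ccw (L ! i) (L ! j) k > 0" if ij: "i < j" "j < length L" for i j
  proof -
    consider "i = 0" | "i = j - 1" | "0 < i" "i < j - 1" using ij(1) by linarith
    then show ?thesis
    proof cases
      case 3
      let ?o = "L ! 0" and ?p = "L ! i" and ?q = "L ! (j - 1)" and ?d = "L ! j"
      have "ccw ?p ?q ?d > 0" "ccw ?o ?q ?d > 0" "ccw ?o ?p ?d > 0"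
        using convex_listD[OF conv] 3 ij by auto
      moreover have "ccw ?o ?d k > 0" "ccw ?q ?d k > 0" using ang step[of j] ij by auto
      ultimately have "ccw ?p ?q ?d * ccw ?o ?d k + ccw ?o ?p ?d * ccw ?q ?d k > 0"
        by (simp add: add_pos_pos)
      then have "ccw ?o ?q ?d * ccw ?p ?d k > 0" using ccw_plucker(1)[of ?o ?q ?d ?p k] by simp
      then show ?thesis using \<open>ccw ?o ?q ?d > 0\<close> by (simp add: zero_less_mult_iff)
    qed (use ang step[of j] ij in auto)
  qed
  show ?thesis
    unfolding convex_list_def
  proof (intro allI impI)
    fix a b c assume *: "a < b \<and> b < c \<and> c < length (L @ [k])"
    show "ccw ((L @ [k]) ! a) ((L @ [k]) ! b) ((L @ [k]) ! c) > 0"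
      using convex_listD[OF conv, of a b c] new[of a b] *
      by (cases "c = length L") (auto simp: nth_append)
  qed
qed

lemma convex_list_rotations:
  assumes conv: "convex_list L" and m: "m = length L" and ilk: "i < l" "l < k" "k < i + m"
  shows "ccw (L ! (i mod m)) (L ! (l mod m)) (L ! (k mod m)) > 0"
proof -
  have m0: "m > 0" using ilk by linarith
  define a where "a = i mod m"
  define b c where "b = a + (l - i)" and "c = a + (k - i)"
  have a: "a < m" using m0 by (simp add: a_def)
  have abc: "a < b" "b < c" "c < a + m" using ilk by (auto simp: b_def c_def)
  have shift: "(a + (x - i)) mod m = x mod m" if "i \<le> x" for x
    using that unfolding a_def by (metis le_add_diff_inverse mod_add_left_eq)
  have bc: "l mod m = b mod m" "k mod m = c mod m"
    using shift[of l] shift[of k] ilk by (simp_all add: b_def c_def)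
  consider "c < m" | "b < m" "m \<le> c" | "m \<le> b" by linarith
  then have "ccw (L ! a) (L ! (b mod m)) (L ! (c mod m)) > 0"
  proof cases
    case 1
    then show ?thesis using convex_listD[OF conv abc(1,2)] abc a m by simp
  next
    case 2
    then have "c mod m = c - m" using abc a by (simp add: mod_if)
    moreover have "ccw (L ! (c - m)) (L ! a) (L ! b) > 0"
      using convex_listD[OF conv, of "c - m" a b] 2 abc m by simp
    ultimately show ?thesis using 2 ccw_rotate[of "L ! (c - m)" "L ! a" "L ! b"] by simp
  next
    case 3
    then have "c mod m = c - m" "b mod m = b - m" using abc a by (simp_all add: mod_if)
    moreover have "ccw (L ! (b - m)) (L ! (c - m)) (L ! a) > 0"
      using convex_listD[OF conv, of "b - m" "c - m" a] 3 abc a m by simp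
    ultimately show ?thesis
      using ccw_rotate[of "L ! (b - m)" "L ! (c - m)" "L ! a"] ccw_rotate[of "L ! (c - m)" "L ! a" "L ! (b - m)"]
      by simp
  qed
  then show ?thesis using bc by (simp add: a_def)
qed

section \<open>The scan and the closing of the ring\<close>

text \<open>
  The Graham scan, with the test for corners as a parameter. The stack has its top at the head
  of the list; its last element is never removed.
\<close>
function scan :: "(pt \<Rightarrow> pt \<Rightarrow> pt \<Rightarrow> bool) \<Rightarrow> pt list \<Rightarrow> pt list \<Rightarrow> pt list" where
  "scan g S [] = S"
| "scan g [] (k # ks) = scan g [k] ks"
| "scan g [b] (k # ks) = scan g [k, b] ks"
| "scan g (b # a # S) (k # ks) =
    (if g a b k then scan g (k # b # a # S) ks else scan g (a # S) (k # ks))"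
  by pat_completeness auto
termination by (relation "Wellfounded.measure (\<lambda>(g, S, ks). 2 * length ks + length S)") auto

text \<open>
  The ends of the chain become neighbors. Removing one end can destroy the corner at the other
  one, hence both are tested again.
\<close>
function close_ring :: "(pt \<Rightarrow> pt \<Rightarrow> pt \<Rightarrow> bool) \<Rightarrow> pt list \<Rightarrow> pt list" where
  "close_ring g L =
    (if length L < 3 then L
     else if \<not> g (last L) (hd L) (L ! 1) then close_ring g (tl L)
     else if \<not> g (L ! (length L - 2)) (last L) (hd L) then close_ring g (butlast L)
     else L)"
  by auto
termination by (relation "Wellfounded.measure (\<lambda>(g, L). length L)") auto

declare close_ring.simps [simp del]

context strictly_convex_plane begin

text \<open>
  The angular order around \<open>o'\<close>. In the same direction the nearer point comes first, so that the
  scan removes it when it meets the farther one.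
\<close>
definition ang_le :: "pt \<Rightarrow> pt \<Rightarrow> pt \<Rightarrow> bool" where
  "ang_le o' b c \<longleftrightarrow> ccw o' b c > 0 \<or> ccw o' b c = 0 \<and> N (b - o') \<le> N (c - o')"

lemma ang_le_trans:
  assumes "lexpos (a - o')" "lexpos (b - o')" "lexpos (c - o')" "ang_le o' a b" "ang_le o' b c"
  shows "ang_le o' a c"
proof -
  have ge: "ccw o' a b \<ge> 0" "ccw o' b c \<ge> 0" using assms by (auto simp: ang_le_def)
  note tr = det2_trans[OF assms(1-3)]
  have ac: "ccw o' a c \<ge> 0" using tr(1) ge by (simp add: ccw_def)
  show ?thesis
  proof (cases "ccw o' a b > 0 \<or> ccw o' b c > 0")
    case True
    then show ?thesis using tr(2) ge by (simp add: ccw_def ang_le_def)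
  next
    case False
    then show ?thesis using assms ac by (auto simp: ang_le_def)
  qed
qed

lemma ang_le_total: "ang_le o' a b \<or> ang_le o' b a"
proof -
  have "ccw o' b a = - ccw o' a b" by (simp add: ccw_def det2_def)
  then show ?thesis by (auto simp: ang_le_def)
qed

end

context ball_plane begin

text \<open>
  A left turn at a point that sticks out of the cap bounded by the chord from \<open>a\<close> to \<open>k\<close> and an
  arc of radius \<open>r\<close>. With arcs of infinite radius, this would be the test of the usual Graham
  scan.
\<close>
definition corner :: "pt \<Rightarrow> pt \<Rightarrow> pt \<Rightarrow> bool" where
  "corner a b k \<longleftrightarrow> ccw a b k > 0 \<and> N (b - vtx a k) > r"

definition corner_list :: "pt list \<Rightarrow> bool" where
  "corner_list L \<longleftrightarrow> (\<forall>i. i + 2 < length L \<longrightarrow> corner (L ! i) (L ! (i + 1)) (L ! (i + 2)))"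

lemma corner_list_tl: "corner_list L \<Longrightarrow> corner_list (tl L)"
  by (auto simp: corner_list_def nth_tl)

lemma corner_list_butlast: "corner_list L \<Longrightarrow> corner_list (butlast L)"
  by (auto simp: corner_list_def nth_butlast)

lemma corner_list_snoc:
  assumes "corner_list L" "length L \<ge> 2 \<Longrightarrow> corner (L ! (length L - 2)) (L ! (length L - 1)) k"
  shows "corner_list (L @ [k])"
  unfolding corner_list_def
proof (intro allI impI)
  fix i assume i: "i + 2 < length (L @ [k])"
  show "corner ((L @ [k]) ! i) ((L @ [k]) ! (i + 1)) ((L @ [k]) ! (i + 2))"
  proof (cases "i + 2 = length L")
    case True
    then have "i = length L - 2" "i + 1 = length L - 1" by auto
    then show ?thesis using assms(2) True by (simp add: nth_append)
  next
    case False
    then show ?thesis using assms(1) i by (simp add: corner_list_def nth_append)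
  qed
qed

text \<open>
  Here \<open>a\<close>, \<open>b\<close>, \<open>k\<close> are in angular order around \<open>o'\<close>. Without a left turn, \<open>b\<close> is in the
  triangle with the vertices \<open>o'\<close>, \<open>a\<close>, \<open>k\<close>, which degenerates to a segment if \<open>a = o'\<close>.
\<close>
lemma no_corner_redundant_in_fan:
  assumes "\<not> corner a b k" and o: "lexpos (b - o')" "lexpos (k - o')" "ang_le o' b k"
    and a: "a = o' \<or> lexpos (a - o') \<and> ccw o' a b > 0"
    and y: "N (y - o') \<le> r" "N (y - a) \<le> r" "N (y - k) \<le> r"
  shows "N (y - b) \<le> r"
proof (cases "ccw a b k > 0")
  case True
  then have "N (b - vtx a k) \<le> r" using assms(1) by (simp add: corner_def)
  moreover have "a \<noteq> k" using True by (auto simp: ccw_left)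
  ultimately show ?thesis using redundant_if_in_cap[of a k b y] True y by simp
next
  case False
  have bk: "ccw o' b k \<ge> 0" using o(3) by (auto simp: ang_le_def)
  show ?thesis
  proof (cases "a = o'")
    case True
    then have 0: "det2 (b - o') (k - o') = 0" using False bk by (simp add: ccw_def)
    then obtain s where s: "s > 0" "k - o' = s *\<^sub>R (b - o')"
      using det2_parallel_lexpos[OF o(1,2)] by blast
    have "N (b - o') \<le> N (k - o')" using o(3) 0 by (auto simp: ang_le_def ccw_def)
    then have "N (b - o') \<le> s * N (b - o')" using s by (simp add: N_scale)
    moreover have "N (b - o') > 0" using o(1) by (intro N_pos) (auto simp: lexpos_def)
    ultimately have "s \<ge> 1" by simp
    have "(1 / s) *\<^sub>R (k - o') = b - o'" using s by simp
    then have "y - b = (1 - 1 / s) *\<^sub>R (y - o') + (1 / s) *\<^sub>R (y - k)"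
      by (simp add: algebra_simps)
    then show ?thesis using N_convex_le[of "1 / s" "y - o'" r "y - k"] y \<open>s \<ge> 1\<close> by simp
  next
    case False': False
    then have al: "lexpos (a - o')" "ccw o' a b > 0" using a by auto
    then have D: "ccw o' a k > 0"
      using det2_trans(2)[OF al(1) o(1,2)] bk by (simp add: ccw_def)
    \<comment> \<open>the barycentric coordinates of \<open>b\<close> with respect to \<open>a\<close> and \<open>k\<close>\<close>
    define p q where "p = ccw o' b k / ccw o' a k" and "q = ccw o' a b / ccw o' a k"
    have pq: "p \<ge> 0" "q \<ge> 0" using D al bk by (simp_all add: p_def q_def)
    have "ccw a b k = ccw o' b k - ccw o' a k + ccw o' a b"
      by (simp add: ccw_def det2_def algebra_simps)
    then have "ccw o' b k + ccw o' a b \<le> ccw o' a k" using False by simp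
    then have pq1: "p + q \<le> 1" using D by (simp add: p_def q_def flip: add_divide_distrib)
    have "ccw o' a k *\<^sub>R (b - o') = ccw o' b k *\<^sub>R (a - o') + ccw o' a b *\<^sub>R (k - o')"
      by (simp add: prod_eq_iff ccw_def det2_def algebra_simps)
    then have "(1 / ccw o' a k) *\<^sub>R (ccw o' a k *\<^sub>R (b - o')) = p *\<^sub>R (a - o') + q *\<^sub>R (k - o')"
      by (simp add: p_def q_def scaleR_add_right)
    then have "b - o' = p *\<^sub>R (a - o') + q *\<^sub>R (k - o')" using D by simp
    then have "y - b = (1 - p - q) *\<^sub>R (y - o') + (p *\<^sub>R (y - a) + q *\<^sub>R (y - k))"
      by (simp add: algebra_simps)
    then have "N (y - b) \<le> (1 - p - q) * N (y - o') + (p * N (y - a) + q * N (y - k))"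
      using N_triangle[of "(1 - p - q) *\<^sub>R (y - o')" "p *\<^sub>R (y - a) + q *\<^sub>R (y - k)"]
        N_triangle[of "p *\<^sub>R (y - a)" "q *\<^sub>R (y - k)"] pq pq1 by (simp add: N_scale)
    also have "\<dots> \<le> (1 - p - q) * r + (p * r + q * r)"
      using pq pq1 y by (intro add_mono mult_left_mono) auto
    finally show ?thesis by (simp add: algebra_simps)
  qed
qed

lemma bi_remove:
  assumes "\<And>y. y \<in> bi N A r \<Longrightarrow> N (y - b) \<le> r"
  shows "bi N (insert b A) r = bi N A r"
  using assms by (auto simp: bi_def disc_def)

text \<open>
  The contents of the stack of the scan, listed from the bottom.
\<close>
definition chain :: "pt \<Rightarrow> pt list \<Rightarrow> bool" where
  "chain o' L \<longleftrightarrow> L \<noteq> [] \<and> hd L = o' \<and> (\<forall>x\<in>set (tl L). lexpos (x - o')) \<and> convex_list L \<and> corner_list L"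

lemma lexpos_neq: "lexpos (x - o') \<Longrightarrow> x \<noteq> o'"
  by (auto simp: lexpos_def)

text \<open>
  The angle of \<open>k\<close> is strictly greater than that of the top \<open>b\<close>, although the order admits
  equality: if \<open>k\<close> were on the ray from \<open>o'\<close> through \<open>b\<close>, it would be beyond \<open>b\<close>, and the turn
  at \<open>b\<close> would not be to the left.
\<close>
lemma chain_snoc:
  assumes ch: "chain o' L" and k: "lexpos (k - o')"
    and last: "length L \<ge> 2 \<Longrightarrow> ang_le o' (last L) k"
    and g: "length L \<ge> 2 \<Longrightarrow> corner (L ! (length L - 2)) (L ! (length L - 1)) k"
  shows "chain o' (L @ [k])"
proof -
  have L: "L \<noteq> []" "L ! 0 = o'" using ch by (auto simp: chain_def hd_conv_nth)
  have lp: "lexpos (L ! j - o')" if "0 < j" "j < length L" for j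
  proof -
    have "L ! j = tl L ! (j - 1)" "j - 1 < length (tl L)" using that by (simp_all add: nth_tl)
    then show ?thesis using ch by (auto simp: chain_def)
  qed
  have "convex_list (L @ [k])"
  proof (cases "length L \<ge> 2")
    case True
    define b where "b = L ! (length L - 1)"
    define a where "a = L ! (length L - 2)"
    have bl: "b = last L" using L by (simp add: b_def last_conv_nth)
    have gd: "ccw a b k > 0" using g[OF True] by (simp add: a_def b_def corner_def)
    have bk0: "ccw o' b k \<ge> 0" using last[OF True] bl by (auto simp: ang_le_def)
    have bk: "ccw o' b k > 0"
    proof (cases "length L = 2")
      case True
      then show ?thesis using gd L by (simp add: a_def)
    next
      case False
      show ?thesis
      proof (rule ccontr)
        assume "\<not> ?thesis"
        then have 0: "det2 (b - o') (k - o') = 0" using bk0 by (simp add: ccw_def)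
        have lb: "lexpos (b - o')" using lp True by (simp add: b_def)
        obtain s where s: "s > 0" "k - o' = s *\<^sub>R (b - o')"
          using det2_parallel_lexpos[OF lb k 0] by blast
        have "N (b - o') \<le> N (k - o')" using last[OF True] 0 bl by (auto simp: ang_le_def ccw_def)
        then have "N (b - o') \<le> s * N (b - o')" using s by (simp add: N_scale)
        moreover have "N (b - o') > 0" using lb by (intro N_pos) (auto simp: lexpos_def)
        ultimately have "s \<ge> 1" by simp
        have "ccw o' a b > 0"
          using convex_listD[of L 0 "length L - 2" "length L - 1"] ch L True False
          by (simp add: chain_def a_def b_def)
        moreover have "ccw a b k = det2 (b - o') (k - o') - det2 (a - o') (k - o') + ccw o' a b"
          by (simp add: ccw_def det2_def algebra_simps)
        moreover have "det2 (a - o') (k - o') = s * ccw o' a b"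
          unfolding s(2) det2_scale_right ccw_def ..
        ultimately have "ccw a b k = (1 - s) * ccw o' a b" "ccw o' a b > 0"
          using 0 by (simp_all add: left_diff_distrib)
        then show False using gd \<open>s \<ge> 1\<close> by (simp add: zero_less_mult_iff)
      qed
    qed
    show ?thesis
    proof (rule convex_list_snoc)
      fix j assume j: "0 < j" "j < length L"
      show "ccw (L ! 0) (L ! j) k > 0"
      proof (cases "j = length L - 1")
        case True
        then show ?thesis using bk L by (simp add: b_def)
      next
        case False
        then have "ccw o' (L ! j) b > 0"
          using convex_listD[of L 0 j "length L - 1"] ch L j by (simp add: chain_def b_def)
        then show ?thesis
          using det2_trans(2)[of "L ! j - o'" "b - o'" "k - o'"] lp[of j] lp[of "length L - 1"] j k bk L
          by (simp add: ccw_def b_def)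
      qed
    qed (use ch True gd in \<open>auto simp: chain_def a_def b_def\<close>)
  next
    case False
    moreover have "length L > 0" using L by simp
    ultimately have "length L = 1" by linarith
    then show ?thesis by (auto simp: convex_list_def)
  qed
  moreover have "corner_list (L @ [k])"
    using ch g by (intro corner_list_snoc) (auto simp: chain_def)
  ultimately show ?thesis using ch k L by (cases L) (auto simp: chain_def)
qed

lemma chain_butlast:
  assumes "chain o' L" "length L \<ge> 2"
  shows "chain o' (butlast L)"
proof -
  obtain x L' where L: "L = x # L'" using assms(2) by (cases L) auto
  moreover have "L' \<noteq> []" using assms L by auto
  ultimately show ?thesis using assms convex_list_butlast[of L] corner_list_butlast[of L]
    by (auto simp: chain_def dest: in_set_butlastD)
qed

text \<open>
  The invariant is preserved by a push because of \<open>chain_snoc\<close> and by a removal because of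
  \<open>no_corner_redundant_in_fan\<close>. After a removal, the new top precedes the input in the angular
  order by transitivity.
\<close>
theorem scan_correct:
  assumes "chain o' (rev S)" "\<forall>k\<in>set ks. lexpos (k - o')" "sorted_wrt (ang_le o') ks"
    and "length S \<ge> 2 \<Longrightarrow> \<forall>k\<in>set ks. ang_le o' (hd S) k"
  shows "chain o' (rev (scan corner S ks)) \<and> bi N (set (scan corner S ks)) r = bi N (set S \<union> set ks) r
    \<and> set (scan corner S ks) \<subseteq> set S \<union> set ks \<and> (ks \<noteq> [] \<or> length S \<ge> 2 \<longrightarrow> length (scan corner S ks) \<ge> 2)"
  using assms
proof (induction corner S ks rule: scan.induct)
  case (1 S)
  then show ?case by simp
next
  case (2 k ks)
  then show ?case by (simp add: chain_def)
next
  case (3 b k ks)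
  have "chain o' ([b] @ [k])"
    by (rule chain_snoc) (use 3 in auto)
  then have "chain o' (rev [k, b])" by simp
  note IH = 3(1)[OF this]
  have "{k, b} \<union> set ks = {b} \<union> set (k # ks)" by auto
  then show ?case using IH 3(3,4) by auto
next
  case (4 b a S k ks)
  let ?L = "rev (b # a # S)"
  have len: "length ?L = Suc (Suc (length S))" by simp
  have nth: "?L ! (length ?L - 2) = a" "?L ! (length ?L - 1) = b"
    by (simp_all add: nth_append)
  have ob: "ang_le o' b k" using 4(6) by simp
  show ?case
  proof (cases "corner a b k")
    case True
    have "chain o' (?L @ [k])"
      by (rule chain_snoc) (use 4 True nth in auto)
    then have "chain o' (rev (k # b # a # S))" by simp
    note IH = 4(1)[OF True this]
    have "set (k # b # a # S) \<union> set ks = set (b # a # S) \<union> set (k # ks)" by auto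
    then show ?thesis using IH 4(4,5) True by auto
  next
    case False
    have ch: "chain o' (rev (a # S))" using chain_butlast[OF 4(3)] by (simp add: butlast_append)
    have hd_o: "hd ?L = o'" using 4(3) by (simp add: chain_def)
    have lexb: "lexpos (x - o')" if "x \<in> set (tl ?L)" for x using 4(3) that by (simp add: chain_def)
    have btl: "lexpos (b - o')" by (rule lexb) (cases "rev S"; simp)
    have ain: "a = o' \<or> lexpos (a - o') \<and> ccw o' a b > 0"
    proof (cases "S = []")
      case True
      then show ?thesis using hd_o by simp
    next
      case False
      then have "?L ! 0 = o'" using hd_o by (metis hd_conv_nth len length_0_conv nat.simps(3))
      then have "ccw o' a b > 0"
        using convex_listD[of ?L 0 "length ?L - 2" "length ?L - 1"] 4(3) nth False by (simp add: chain_def)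
      moreover have "lexpos (a - o')" by (rule lexb) (use False in \<open>cases "rev S"; simp\<close>)
      ultimately show ?thesis by simp
    qed
    have o_in: "o' \<in> set (a # S)" using ch by (metis chain_def hd_in_set set_rev)
    have rem: "bi N (set (b # a # S) \<union> set (k # ks)) r = bi N (set (a # S) \<union> set (k # ks)) r"
    proof -
      have "set (b # a # S) \<union> set (k # ks) = insert b (set (a # S) \<union> set (k # ks))" by auto
      moreover have "N (y - b) \<le> r" if "y \<in> bi N (set (a # S) \<union> set (k # ks)) r" for y
      proof -
        have "\<forall>x\<in>set (a # S) \<union> set (k # ks). N (y - x) \<le> r"
          using that by (simp only: bi_iff)
        moreover have "o' \<in> set (a # S) \<union> set (k # ks)" using o_in by blast
        ultimately have "N (y - o') \<le> r" "N (y - a) \<le> r" "N (y - k) \<le> r"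
          by (blast, simp_all)
        then show ?thesis using no_corner_redundant_in_fan[OF False btl _ ob ain] 4(4) by simp
      qed
      ultimately show ?thesis using bi_remove by metis
    qed
    have sub: "set (a # S) \<union> set (k # ks) \<subseteq> set (b # a # S) \<union> set (k # ks)" by auto
    have ang: "\<forall>k\<in>set (k # ks). ang_le o' (hd (a # S)) k" if len2: "length (a # S) \<ge> 2"
    proof
      fix x assume x: "x \<in> set (k # ks)"
      have "\<forall>x\<in>set (k # ks). ang_le o' b x" using 4(6) by simp
      then have bx: "ang_le o' b x" using x by blast
      have "a \<noteq> o'"
      proof
        assume "a = o'"
        then obtain c S' where S: "S = c # S'" using len2 by (cases S) auto
        have "distinct ?L" using convex_list_distinct[of ?L] 4(3) S by (simp add: chain_def)
        then have "o' \<notin> set (tl ?L)" using hd_o len by (metis distinct.simps(2) list.collapse length_0_conv nat.simps(3))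
        then show False using \<open>a = o'\<close> S by (cases "rev S'") auto
      qed
      then have "lexpos (a - o')" "ang_le o' a b" using ain by (auto simp: ang_le_def)
      then show "ang_le o' (hd (a # S)) x"
        using ang_le_trans[of a o' b x] btl bx bspec[OF 4(4) x] by simp
    qed
    have "chain o' (rev (scan corner (a # S) (k # ks))) \<and>
      bi N (set (scan corner (a # S) (k # ks))) r = bi N (set (a # S) \<union> set (k # ks)) r \<and>
      set (scan corner (a # S) (k # ks)) \<subseteq> set (a # S) \<union> set (k # ks) \<and>
      (k # ks \<noteq> [] \<or> length (a # S) \<ge> 2 \<longrightarrow> length (scan corner (a # S) (k # ks)) \<ge> 2)"
      using 4(2)[OF False ch 4(4,5)] ang by simp
    moreover have "scan corner (b # a # S) (k # ks) = scan corner (a # S) (k # ks)" using False by simp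
    ultimately show ?thesis using rem sub by (metis (no_types, lifting) list.distinct(1) subset_trans)
  qed
qed

lemma no_corner_redundant_if_convex:
  assumes "ccw a b k > 0" "\<not> corner a b k" "N (y - a) \<le> r" "N (y - k) \<le> r"
  shows "N (y - b) \<le> r"
proof -
  have "a \<noteq> k" using assms(1) by (auto simp: ccw_left)
  then show ?thesis using redundant_if_in_cap[of a k b y] assms by (simp add: corner_def)
qed

text \<open>
  The centers are in convex position, also across the junction. So a center that is not a corner
  lies in a cap.
\<close>
theorem close_ring_correct:
  assumes "convex_list L" "corner_list L" "length L \<ge> 2"
  defines "L' \<equiv> close_ring corner L"
  shows "convex_list L' \<and> corner_list L' \<and> length L' \<ge> 2 \<and> bi N (set L') r = bi N (set L) r
    \<and> set L' \<subseteq> set L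
    \<and> (length L' \<ge> 3 \<longrightarrow> corner (last L') (hd L') (L' ! 1) \<and> corner (L' ! (length L' - 2)) (last L') (hd L'))
    \<and> (distinct L \<longrightarrow> distinct L')"
  unfolding L'_def using assms(1-3)
proof (induction "length L" arbitrary: L rule: less_induct)
  case less
  show ?case
  proof (cases "length L < 3")
    case True
    then have "close_ring corner L = L" by (subst close_ring.simps) simp
    then show ?thesis using less.prems True by simp
  next
    case len: False
    then have "L \<noteq> []" by auto
    then have L: "L \<noteq> []" "hd L = L ! 0" "last L = L ! (length L - 1)"
      by (simp_all add: hd_conv_nth last_conv_nth)
    show ?thesis
    proof (cases "corner (last L) (hd L) (L ! 1)")
      case False
      have eq: "close_ring corner L = close_ring corner (tl L)" using len False by (subst close_ring.simps) simp
      have c: "ccw (last L) (hd L) (L ! 1) > 0"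
        using convex_listD[OF less.prems(1), of 0 1 "length L - 1"] len L
          ccw_rotate[of "last L" "hd L" "L ! 1"] by simp
      have "length (tl L) > 0" using len by simp
      then have "tl L \<noteq> []" unfolding length_greater_0_conv .
      then have mem: "last L \<in> set (tl L)" "L ! 1 \<in> set (tl L)"
        using last_in_set[of "tl L"] nth_mem[of 0 "tl L"] len by (simp_all add: last_tl nth_tl)
      have "bi N (set L) r = bi N (set (tl L)) r"
      proof -
        have "set L = insert (hd L) (set (tl L))" using L by (metis list.collapse list.simps(15))
        moreover have "N (y - hd L) \<le> r" if "y \<in> bi N (set (tl L)) r" for y
          using no_corner_redundant_if_convex[OF c False] that mem by (simp add: bi_iff)
        ultimately show ?thesis using bi_remove by metis
      qed
      moreover have "set (tl L) \<subseteq> set L" using L by (metis set_subset_Cons list.collapse)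
      moreover have "distinct L \<Longrightarrow> distinct (tl L)" by (rule distinct_tl)
      ultimately show ?thesis
        using less.hyps[of "tl L"] less.prems len convex_list_tl corner_list_tl unfolding eq by fastforce
    next
      case g1: True
      show ?thesis
      proof (cases "corner (L ! (length L - 2)) (last L) (hd L)")
        case False
        have eq: "close_ring corner L = close_ring corner (butlast L)" using len False g1 by (subst close_ring.simps) simp
        have c: "ccw (L ! (length L - 2)) (last L) (hd L) > 0"
          using convex_listD[OF less.prems(1), of 0 "length L - 2" "length L - 1"] len L
            ccw_rotate[of "hd L" "L ! (length L - 2)" "last L"] by simp
        have mem: "L ! (length L - 2) \<in> set (butlast L)" "hd L \<in> set (butlast L)"
          using nth_mem[of "length L - 2" "butlast L"] nth_mem[of 0 "butlast L"] len L
          by (simp_all add: nth_butlast)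
        have sL: "set L = insert (last L) (set (butlast L))"
          using L by (metis append_butlast_last_id set_append list.simps(15) empty_set Un_insert_right sup_bot.right_neutral)
        have "bi N (set L) r = bi N (set (butlast L)) r"
        proof -
          have "N (y - last L) \<le> r" if "y \<in> bi N (set (butlast L)) r" for y
            using no_corner_redundant_if_convex[OF c False] that mem by (simp add: bi_iff)
          then show ?thesis using bi_remove sL by metis
        qed
        moreover have "set (butlast L) \<subseteq> set L" using sL by auto
        moreover have "distinct L \<Longrightarrow> distinct (butlast L)" by (rule distinct_butlast)
        ultimately show ?thesis
          using less.hyps[of "butlast L"] less.prems len convex_list_butlast corner_list_butlast unfolding eq by fastforce
      next
        case True
        then have "close_ring corner L = L" using len g1 by (subst close_ring.simps) simp
        then show ?thesis using less.prems g1 True by simp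
      qed
    qed
  qed
qed

section \<open>From a ring to the boundary\<close>

text \<open>
  The vertex before each center of the ring, starting with the one between the last and the
  first center.
\<close>
definition ring_vertices :: "pt list \<Rightarrow> pt list" where
  "ring_vertices L = map2 vtx (last L # butlast L) L"

definition boundary_of_ring :: "pt list \<Rightarrow> pt list \<times> pt list" where
  "boundary_of_ring L = (let vs = ring_vertices L in
     if vs ! 0 = vs ! 1 then ([], [vs ! 0]) else (L, vs))"

text \<open>
  The list is unrolled into a periodic sequence that starts with its last center, so that the
  \<open>i\<close>-th vertex of the sequence is the \<open>i\<close>-th entry of \<open>ring_vertices\<close>. A ring of two centers is
  a lens, for which all conditions are immediate.
\<close>
theorem boundary_of_ring_correct:
  assumes conv: "convex_list L" and loc: "corner_list L" and len: "length L \<ge> 2" and dist: "distinct L"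
    and wrap: "length L \<ge> 3 \<Longrightarrow> corner (last L) (hd L) (L ! 1) \<and> corner (L ! (length L - 2)) (last L) (hd L)"
    and sub: "set L \<subseteq> K" and bi_eq: "bi N K r = bi N (set L) r" and ne: "bi N K r \<noteq> {}"
  shows "case boundary_of_ring L of (cs, vs) \<Rightarrow> describes_boundary N K r cs vs"
proof -
  define m where "m = length L"
  define c where "c i = L ! ((i + (m - 1)) mod m)" for i
  have m0: "m \<ge> 2" using len by (simp add: m_def)
  have L0: "L \<noteq> []" using len by auto
  have cSuc: "c (Suc i) = L ! (i mod m)" for i
  proof -
    have "Suc i + (m - 1) = i + m" using m0 by simp
    then show ?thesis unfolding c_def by simp
  qed
  have crange: "range c = set L"
  proof
    show "range c \<subseteq> set L"
    proof (rule image_subsetI)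
      show "c i \<in> set L" for i
        unfolding c_def m_def by (intro nth_mem mod_less_divisor) (use len in linarith)
    qed
    show "set L \<subseteq> range c"
    proof
      fix x assume "x \<in> set L"
      then obtain i where "i < m" "x = L ! i" by (auto simp: in_set_conv_nth m_def)
      then have "c (Suc i) = x" by (simp add: cSuc)
      then show "x \<in> range c" by blast
    qed
  qed
  interpret center_ring N r c m
  proof
    show "c (i + m) = c i" for i
    proof -
      have "i + m + (m - 1) = i + (m - 1) + m" by simp
      then show ?thesis unfolding c_def by (simp only: mod_add_self2)
    qed
    show "c i \<noteq> c j" if "i < j" "j < i + m" for i j
    proof
      assume "c i = c j"
      moreover have "(i + (m - 1)) mod m < length L" "(j + (m - 1)) mod m < length L"
        using m0 by (simp_all flip: m_def)
      ultimately have "(i + (m - 1)) mod m = (j + (m - 1)) mod m"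
        unfolding c_def by (simp only: nth_eq_iff_index_eq[OF dist])
      then have "m dvd (j + (m - 1)) - (i + (m - 1))" using that by (metis mod_eq_dvd_iff_nat add_le_cancel_right less_imp_le)
      then have "m dvd j - i" by simp
      then have "m \<le> j - i" using that by (intro dvd_imp_le) auto
      then show False using that by linarith
    qed
    show "bi N (range c) r \<noteq> {}" using ne bi_eq crange by simp
  qed (rule m0)
  have vs_len: "length (ring_vertices L) = m" using len by (simp add: ring_vertices_def m_def)
  have vs: "ring_vertices L ! i = v i" if "i < m" for i
  proof -
    have "(last L # butlast L) ! i = c i"
    proof (cases i)
      case 0
      then show ?thesis using m0 L0 by (simp add: c_def m_def last_conv_nth)
    next
      case (Suc j)
      then show ?thesis using that cSuc[of j] by (simp add: nth_butlast m_def)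
    qed
    then show ?thesis using that cSuc[of i] m0 by (simp add: ring_vertices_def m_def v_def)
  qed
  have vR_and: "(\<forall>i. v i \<in> bi N (range c) r) \<and>
      (\<forall>i j y. i < j \<longrightarrow> j < i + m \<longrightarrow> v i = v j \<longrightarrow> y \<in> bi N (range c) r \<longrightarrow> y = v i)"
  proof (cases "m \<ge> 3")
    case True
    interpret convex_ring N r c m
    proof
      show "3 \<le> m" by (rule True)
      show "ccw (c i) (c l) (c k) > 0" if "i < l" "l < k" "k < i + m" for i l k
        unfolding c_def by (rule convex_list_rotations[OF conv]) (use that in \<open>auto simp: m_def\<close>)
      show "N (c (i + 1) - vtx (c i) (c (i + 2))) > r" for i
      proof -
        define a where "a = (i + (m - 1)) mod m"
        have a: "a < m" using m0 by (simp add: a_def)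
        have ca: "c i = L ! a" "c (i + 1) = L ! ((a + 1) mod m)" "c (i + 2) = L ! ((a + 2) mod m)"
          by (simp_all add: c_def a_def mod_simps add_ac)
        consider "a + 2 < m" | "a = m - 2" | "a = m - 1" using a by linarith
        then have "corner (L ! a) (L ! ((a + 1) mod m)) (L ! ((a + 2) mod m))"
        proof cases
          case 1
          then show ?thesis using loc by (simp add: corner_list_def m_def)
        next
          case 2
          then have "a + 1 = m - 1" "a + 2 = m" using True by linarith+
          then have "(a + 1) mod m = m - 1" "(a + 2) mod m = 0" using True by simp_all
          then show ?thesis using wrap True 2 L0 by (simp add: m_def last_conv_nth hd_conv_nth)
        next
          case 3
          then have "a + 1 = m" "a + 2 = 1 + m" using True by linarith+
          then have "(a + 1) mod m = 0" "(a + 2) mod m = 1"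
            using True by (simp, simp only: mod_add_self2) simp
          then show ?thesis using wrap True 3 L0 by (simp add: m_def last_conv_nth hd_conv_nth)
        qed
        then show ?thesis unfolding ca corner_def by simp
      qed
    qed
    show ?thesis using vertices_in_bi single_point_if_vertices_agree by blast
  next
    case False
    then have m2': "m = 2" using m0 by simp
    have cj: "c j = c i \<or> c j = c (Suc i)" for i j
      using center_in_window[of i j] m2' by (metis One_nat_def add_2_eq_Suc' le_less_Suc_eq less_antisym)
    have in_R: "x \<in> bi N (range c) r" if "N (x - c i) \<le> r" "N (x - c (Suc i)) \<le> r" for x i
    proof -
      have "N (x - c j) \<le> r" for j using cj[of j i] that by auto
      then show ?thesis by (auto simp: bi_iff)
    qed
    have "v i \<in> bi N (range c) r" for i using in_R[of "v i" i] v_spec[of i] by simp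
    moreover have "y = v i" if "i < j" "j < i + m" "v i = v j" "y \<in> bi N (range c) r" for i j y
    proof (rule ccontr)
      assume yv: "y \<noteq> v i"
      have j: "j = Suc i" using that m2' by simp
      have "c (Suc j) = c i" using periodic[of i] j m2' by simp
      then have "vtx (c i) (c (Suc i)) = vtx (c (Suc i)) (c i)" using that(3) j by (simp add: v_def)
      then have "\<not> N (c (Suc i) - c i) < 2 * r" using vtx_swap_neq[of "c i" "c (Suc i)"] consecutive_distinct by auto
      moreover have "N (c (Suc i) - c i) < 2 * r"
        using close_if_common_points[of y "c (Suc i)" r "v i" "c i"] yv v_spec[of i] that(4) by (simp add: bi_iff)
      ultimately show False by simp
    qed
    ultimately show ?thesis by blast
  qed
  then have vR: "\<And>i. v i \<in> bi N (range c) r"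
    and single: "\<And>i j y. i < j \<Longrightarrow> j < i + m \<Longrightarrow> v i = v j \<Longrightarrow> y \<in> bi N (range c) r \<Longrightarrow> y = v i"
    by blast+
  have R: "bi N K r = bi N (range c) r" using bi_eq crange by simp
  have v01: "ring_vertices L ! 0 = v 0" "ring_vertices L ! 1 = v 1" using vs[of 0] vs[of 1] m0 by simp_all
  show ?thesis
  proof (cases "v 0 = v 1")
    case True
    have "bi N K r = {v 0}"
      using single[of 0 1] True vR m0 unfolding R by force
    then have "frontier (bi N K r) = {v 0}" by (simp add: frontier_def)
    then show ?thesis using True v01 by (simp add: boundary_of_ring_def describes_boundary_def Let_def)
  next
    case False
    have vne: "v i \<noteq> v j" if "i < j" "j < i + m" for i j
    proof
      assume "v i = v j"
      then have "v 0 = v i" "v 1 = v i" using single[OF that] vR by blast+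
      then show False using False by simp
    qed
    have fr: "frontier (bi N K r) = (\<Union>i<m. ccw_arc N (c (Suc i)) r (v i) (v (Suc i)))"
      unfolding R by (rule frontier_is_arcs) (use vR vne m0 in auto)
    define vs' where "vs' = ring_vertices L"
    have nxt: "vs' ! (Suc i mod m) = v (Suc i)" for i
    proof -
      have "Suc i mod m < m" using m0 by simp
      then show ?thesis using vs periodic_mod[of v, OF v_periodic, of "Suc i"] by (simp add: vs'_def)
    qed
    have lv: "length vs' = m" using vs_len by (simp add: vs'_def)
    have dv: "distinct vs'"
      unfolding distinct_conv_nth
    proof (intro allI impI)
      fix i j assume ij: "i < length vs'" "j < length vs'" "i \<noteq> j"
      then show "vs' ! i \<noteq> vs' ! j"
        using vne[of i j] vne[of j i] vs lv by (cases i j rule: linorder_cases) (auto simp: vs'_def)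
    qed
    have "frontier (bi N K r) = (\<Union>i<m. ccw_arc N (L ! i) r (vs' ! i) (vs' ! (Suc i mod m)))"
      unfolding fr nxt using cSuc vs by (intro SUP_cong) (auto simp: vs'_def)
    moreover have "vs' ! i \<in> circle N (L ! i) r \<and> vs' ! (Suc i mod m) \<in> circle N (L ! i) r" if "i < m" for i
      using v_spec(2)[of i] v_spec(1)[of "Suc i"] cSuc[of i] that vs[of i] nxt[of i] by (simp add: circle_def vs'_def)
    ultimately have "describes_boundary N K r L vs'"
      unfolding describes_boundary_def Let_def lv using m0 dv dist sub by (auto simp: m_def)
    then show ?thesis using False v01 by (simp add: boundary_of_ring_def Let_def vs'_def)
  qed
qed

end

section \<open>The program\<close>

text \<open>
  In the bodies of the functions, the parameters are listed in the order of the variables \<open>Var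
  0\<close>, \<open>Var 1\<close>, and so on. The phases continue with one another by tail calls, so that no
  function has to return several values. The main function calls the search for the least center
  (number 4), which sorts and starts the scan (8), which reverses the stack (9) and closes the
  ring (10); then the ring is copied (11), the vertices are computed and the result is assembled
  (12 to 15). Numbers 1 to 3 are tests, 5 to 7 are the merge sort.
\<close>
abbreviation Hd :: "exp \<Rightarrow> exp" where "Hd e \<equiv> Prim Left [e]"
abbreviation Tl :: "exp \<Rightarrow> exp" where "Tl e \<equiv> Prim Right [e]"
abbreviation Push :: "exp \<Rightarrow> exp \<Rightarrow> exp" where "Push e f \<equiv> Prim MkPair [e, f]"
abbreviation Nil' :: exp where "Nil' \<equiv> Prim MkNil []"
abbreviation True' :: exp where "True' \<equiv> Lit 1"
abbreviation Lt :: "exp \<Rightarrow> exp \<Rightarrow> exp" where "Lt e f \<equiv> Prim Less [e, f]"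
abbreviation Minus :: "exp \<Rightarrow> exp \<Rightarrow> exp" where "Minus e f \<equiv> Prim Sub [e, f]"
abbreviation Times :: "exp \<Rightarrow> exp \<Rightarrow> exp" where "Times e f \<equiv> Prim Mul [e, f]"
abbreviation Ccw :: "exp \<Rightarrow> exp \<Rightarrow> exp \<Rightarrow> exp" where
  "Ccw a b c \<equiv> Minus (Times (Minus (Hd b) (Hd a)) (Minus (Tl c) (Tl a)))
                     (Times (Minus (Tl b) (Tl a)) (Minus (Hd c) (Hd a)))"
abbreviation Dist :: "exp \<Rightarrow> exp \<Rightarrow> exp" where
  "Dist a b \<equiv> Prim NormOf [Prim MkPair [Minus (Hd a) (Hd b), Minus (Tl a) (Tl b)]]"
abbreviation Vtx :: "exp \<Rightarrow> exp \<Rightarrow> exp \<Rightarrow> exp" where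
  "Vtx a b \<rho> \<equiv> Hd (Prim Meet [a, b, \<rho>])"

definition main_body :: exp where
  \<comment> \<open>parameters: xs, r\<close>
  "main_body = Cond (Tl (Var 0)) (Call 4 [Hd (Var 0), Nil', Tl (Var 0), Var 1]) (Prim MkPair [Var 0, Nil'])"

definition corner_body :: exp where
  \<comment> \<open>parameters: a, b, k, r\<close>
  "corner_body = Cond (Lt (Lit 0) (Ccw (Var 0) (Var 1) (Var 2)))
     (Lt (Var 3) (Dist (Var 1) (Vtx (Var 0) (Var 2) (Var 3)))) Nil'"

definition lex_body :: exp where
  \<comment> \<open>parameters: a, b\<close>
  "lex_body = Cond (Lt (Hd (Var 0)) (Hd (Var 1))) True'
     (Cond (Lt (Hd (Var 1)) (Hd (Var 0))) Nil' (Lt (Tl (Var 0)) (Tl (Var 1))))"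

definition angle_body :: exp where
  \<comment> \<open>parameters: o, b, c\<close>
  "angle_body = Cond (Lt (Lit 0) (Ccw (Var 0) (Var 1) (Var 2))) True'
     (Cond (Lt (Ccw (Var 0) (Var 1) (Var 2)) (Lit 0)) Nil'
       (Cond (Lt (Dist (Var 2) (Var 0)) (Dist (Var 1) (Var 0))) Nil' True'))"

definition extract_body :: exp where
  \<comment> \<open>parameters: m, rest, ys, r\<close>
  "extract_body = Cond (Var 2)
     (Cond (Call 2 [Hd (Var 2), Var 0])
       (Call 4 [Hd (Var 2), Push (Var 0) (Var 1), Tl (Var 2), Var 3])
       (Call 4 [Var 0, Push (Hd (Var 2)) (Var 1), Tl (Var 2), Var 3]))
     (Call 8 [Push (Var 0) Nil', Call 7 [Var 0, Var 1], Var 3])"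

definition split_body :: exp where
  \<comment> \<open>parameters: o, xs, as, bs\<close>
  "split_body = Cond (Var 1)
     (Call 5 [Var 0, Tl (Var 1), Push (Hd (Var 1)) (Var 3), Var 2])
     (Call 6 [Var 0, Call 7 [Var 0, Var 2], Call 7 [Var 0, Var 3]])"

definition merge_body :: exp where
  \<comment> \<open>parameters: o, as, bs\<close>
  "merge_body = Cond (Var 1)
     (Cond (Var 2)
       (Cond (Call 3 [Var 0, Hd (Var 1), Hd (Var 2)])
         (Push (Hd (Var 1)) (Call 6 [Var 0, Tl (Var 1), Var 2]))
         (Push (Hd (Var 2)) (Call 6 [Var 0, Var 1, Tl (Var 2)])))
       (Var 1))
     (Var 2)"

definition msort_body :: exp where
  \<comment> \<open>parameters: o, xs\<close>
  "msort_body = Cond (Var 1) (Cond (Tl (Var 1)) (Call 5 [Var 0, Var 1, Nil', Nil']) (Var 1)) Nil'"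

definition scan_body :: exp where
  \<comment> \<open>parameters: S, ks, r\<close>
  "scan_body = Cond (Var 1)
     (Cond (Tl (Var 0))
       (Cond (Call 1 [Hd (Tl (Var 0)), Hd (Var 0), Hd (Var 1), Var 2])
         (Call 8 [Push (Hd (Var 1)) (Var 0), Tl (Var 1), Var 2])
         (Call 8 [Tl (Var 0), Var 1, Var 2]))
       (Call 8 [Push (Hd (Var 1)) (Var 0), Tl (Var 1), Var 2]))
     (Call 9 [Var 0, Nil', Lit 0, Var 0, Var 2])"

text \<open>
  Reversal and counting in one pass. The unreversed stack \<open>S\<close> is handed on, since the closing of
  the ring works at both ends.
\<close>
definition reverse_body :: exp where
  \<comment> \<open>parameters: xs, acc, n, S, r\<close>
  "reverse_body = Cond (Var 0)
     (Call 9 [Tl (Var 0), Push (Hd (Var 0)) (Var 1), Prim Add [Var 2, Lit 1], Var 3, Var 4])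
     (Call 10 [Var 1, Var 3, Var 2, Var 4])"

text \<open>
  The ring is kept as two lists, \<open>F\<close> forwards and \<open>B\<close> backwards, so that both ends are
  accessible. Removing a center shortens one list only. So the first \<open>n\<close> elements of each list
  are valid, where \<open>n\<close> is the size of the ring.
\<close>
definition close_body :: exp where
  \<comment> \<open>parameters: F, B, n, r\<close>
  "close_body =
     Cond (Lt (Var 2) (Lit 3)) (Call 12 [Call 11 [Var 2, Var 0], Hd (Var 1), Var 3])
     (Cond (Call 1 [Hd (Var 1), Hd (Var 0), Hd (Tl (Var 0)), Var 3])
       (Cond (Call 1 [Hd (Tl (Var 1)), Hd (Var 1), Hd (Var 0), Var 3])
         (Call 12 [Call 11 [Var 2, Var 0], Hd (Var 1), Var 3])
         (Call 10 [Var 0, Tl (Var 1), Minus (Var 2) (Lit 1), Var 3]))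
       (Call 10 [Tl (Var 0), Var 1, Minus (Var 2) (Lit 1), Var 3]))"

definition take_body :: exp where
  \<comment> \<open>parameters: n, xs\<close>
  "take_body = Cond (Lt (Lit 0) (Var 0))
     (Push (Hd (Var 1)) (Call 11 [Minus (Var 0) (Lit 1), Tl (Var 1)])) Nil'"

definition out_body :: exp where
  \<comment> \<open>parameters: L, prev, r\<close>
  "out_body = Call 14 [Var 0, Call 13 [Var 1, Var 0, Var 2]]"

definition vertices_body :: exp where
  \<comment> \<open>parameters: prev, L, r\<close>
  "vertices_body = Cond (Var 1)
     (Push (Vtx (Var 0) (Hd (Var 1)) (Var 2)) (Call 13 [Hd (Var 1), Tl (Var 1), Var 2])) Nil'"

definition result_body :: exp where
  \<comment> \<open>parameters: L, vs\<close>
  "result_body = Cond (Call 15 [Hd (Var 1), Hd (Tl (Var 1))])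
     (Prim MkPair [Nil', Push (Hd (Var 1)) Nil']) (Prim MkPair [Var 0, Var 1])"

definition equal_body :: exp where
  \<comment> \<open>parameters: a, b\<close>
  "equal_body = Cond (Lt (Lit 0) (Dist (Var 0) (Var 1))) Nil' True'"

definition program :: "exp list" where
  "program = [main_body, corner_body, lex_body, angle_body, extract_body, split_body, merge_body,
     msort_body, scan_body, reverse_body, close_body, take_body, out_body, vertices_body,
     result_body, equal_body]"

section \<open>Selection and sorting\<close>

definition lex_less :: "pt \<Rightarrow> pt \<Rightarrow> bool" where
  "lex_less a b \<longleftrightarrow> fst a < fst b \<or> fst a = fst b \<and> snd a < snd b"

fun extract_min :: "pt \<Rightarrow> pt list \<Rightarrow> pt list \<Rightarrow> pt \<times> pt list" where
  "extract_min m rest [] = (m, rest)"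
| "extract_min m rest (y # ys) =
    (if lex_less y m then extract_min y (m # rest) ys else extract_min m (y # rest) ys)"

text \<open>
  Swapping the two piles at each step splits a list into halves without counting.
\<close>
fun deal :: "'a list \<Rightarrow> 'a list \<Rightarrow> 'a list \<Rightarrow> 'a list \<times> 'a list" where
  "deal [] as bs = (as, bs)"
| "deal (x # xs) as bs = deal xs (x # bs) as"

lemma deal_length:
  assumes "deal xs as bs = (as', bs')" "length as = length bs \<or> length as = length bs + 1"
  shows "length as' + length bs' = length xs + length as + length bs
    \<and> (length as' = length bs' \<or> length as' = length bs' + 1)"
  using assms by (induction xs as bs rule: deal.induct) auto

lemma deal_mset: "deal xs as bs = (as', bs') \<Longrightarrow> mset as' + mset bs' = mset xs + mset as + mset bs"
  by (induction xs as bs rule: deal.induct) auto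

fun merge_by :: "('a \<Rightarrow> 'a \<Rightarrow> bool) \<Rightarrow> 'a list \<Rightarrow> 'a list \<Rightarrow> 'a list" where
  "merge_by le [] bs = bs"
| "merge_by le (a # as) [] = a # as"
| "merge_by le (a # as) (b # bs) =
    (if le a b then a # merge_by le as (b # bs) else b # merge_by le (a # as) bs)"

lemma merge_mset: "mset (merge_by le as bs) = mset as + mset bs"
  by (induction le as bs rule: merge_by.induct) auto

lemma merge_set: "set (merge_by le as bs) = set as \<union> set bs"
  using merge_mset[of le as bs] by (metis set_mset_mset set_mset_union)

lemma merge_sorted:
  assumes trans: "\<And>x y z. x \<in> A \<Longrightarrow> y \<in> A \<Longrightarrow> z \<in> A \<Longrightarrow> le x y \<Longrightarrow> le y z \<Longrightarrow> le x z"
    and total: "\<And>x y. x \<in> A \<Longrightarrow> y \<in> A \<Longrightarrow> le x y \<or> le y x"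
    and "set as \<subseteq> A" "set bs \<subseteq> A" "sorted_wrt le as" "sorted_wrt le bs"
  shows "sorted_wrt le (merge_by le as bs)"
  using assms(3-)
proof (induction "length as + length bs" arbitrary: as bs rule: less_induct)
  case less
  consider "as = []" | "as \<noteq> []" "bs = []" | a as' b bs' where "as = a # as'" "bs = b # bs'"
    by (metis neq_Nil_conv)
  then show ?case
  proof cases
    case 1
    then show ?thesis using less.prems by simp
  next
    case 2
    then show ?thesis using less.prems by (cases as) simp_all
  next
    case 3
    have mem: "a \<in> A" "b \<in> A" "set as' \<subseteq> A" "set bs' \<subseteq> A" using 3 less.prems by auto
    have a_le: "le a x" if "x \<in> set as'" for x using 3 less.prems that by simp
    have b_le: "le b x" if "x \<in> set bs'" for x using 3 less.prems that by simp
    show ?thesis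
    proof (cases "le a b")
      case True
      have "sorted_wrt le (merge_by le as' bs)"
        by (rule less.hyps) (use 3 less.prems in auto)
      moreover have "le a x" if "x \<in> set as' \<union> set bs" for x
        using that a_le b_le trans[OF mem(1,2) _ True] mem 3 True by auto
      ultimately show ?thesis using 3 True by (simp add: merge_set)
    next
      case False
      then have ba: "le b a" using total mem by blast
      have "sorted_wrt le (merge_by le as bs')"
        by (rule less.hyps) (use 3 less.prems in auto)
      moreover have "le b x" if "x \<in> set as \<union> set bs'" for x
        using that a_le b_le trans[OF mem(2,1) _ ba] mem 3 ba by auto
      ultimately show ?thesis using 3 False by (simp add: merge_set)
    qed
  qed
qed

function msort_by :: "('a \<Rightarrow> 'a \<Rightarrow> bool) \<Rightarrow> 'a list \<Rightarrow> 'a list" where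
  "msort_by le xs = (if length xs < 2 then xs else
     merge_by le (msort_by le (fst (deal xs [] []))) (msort_by le (snd (deal xs [] []))))"
  by auto
termination
proof (relation "Wellfounded.measure (\<lambda>(le, xs). length xs)", goal_cases)
  case (2 le xs)
  then show ?case using deal_length[of xs "[]" "[]"] by (cases "deal xs [] []") auto
next
  case (3 le xs)
  then show ?case using deal_length[of xs "[]" "[]"] by (cases "deal xs [] []") auto
qed simp

declare msort_by.simps [simp del]

lemma msort_mset: "mset (msort_by le xs) = mset xs"
proof (induction le xs rule: msort_by.induct)
  case (1 le xs)
  show ?case
  proof (cases "length xs < 2")
    case True
    then show ?thesis by (subst msort_by.simps) simp
  next
    case False
    then show ?thesis using 1 deal_mset[of xs "[]" "[]"]
      by (subst msort_by.simps) (cases "deal xs [] []"; simp add: merge_mset)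
  qed
qed

lemma msort_sorted:
  assumes "\<And>x y z. x \<in> A \<Longrightarrow> y \<in> A \<Longrightarrow> z \<in> A \<Longrightarrow> le x y \<Longrightarrow> le y z \<Longrightarrow> le x z"
    and "\<And>x y. x \<in> A \<Longrightarrow> y \<in> A \<Longrightarrow> le x y \<or> le y x"
  shows "set xs \<subseteq> A \<Longrightarrow> sorted_wrt le (msort_by le xs)"
proof (induction "length xs" arbitrary: xs rule: less_induct)
  case less
  show ?case
  proof (cases "length xs < 2")
    case True
    then have "xs = [] \<or> (\<exists>x. xs = [x])" by (cases xs rule: list.exhaust) (auto simp: length_Suc_conv)
    then have "sorted_wrt le xs" by auto
    then show ?thesis using True by (subst msort_by.simps) simp
  next
    case False
    obtain as bs where d: "deal xs [] [] = (as, bs)" by (cases "deal xs [] []")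
    have ms: "mset as + mset bs = mset xs" using deal_mset[OF d] by simp
    then have "set xs = set as \<union> set bs" by (metis set_mset_mset set_mset_union)
    then have sub: "set as \<subseteq> A" "set bs \<subseteq> A" using less.prems by auto
    have "length as < length xs" "length bs < length xs" using deal_length[OF d] False by auto
    then have "sorted_wrt le (msort_by le as)" "sorted_wrt le (msort_by le bs)"
      using less.hyps sub by auto
    moreover have "set (msort_by le as) \<subseteq> A" "set (msort_by le bs) \<subseteq> A"
      using sub msort_mset by (metis set_mset_mset)+
    ultimately have "sorted_wrt le (merge_by le (msort_by le as) (msort_by le bs))"
      using merge_sorted[of A le] assms by blast
    then show ?thesis using False d by (subst msort_by.simps) simp
  qed
qed

context strictly_convex_plane begin

section \<open>Timed evaluation\<close>

text \<open>
  Evaluation within a time bound. The bounds compose by addition, so that they can be left open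
  in a proof and be compared with the stated bound at the end.
\<close>
definition runs :: "val list \<Rightarrow> exp \<Rightarrow> val \<Rightarrow> nat \<Rightarrow> bool" where
  "runs env e v b \<longleftrightarrow> (\<exists>t\<le>b. eval N program env e v t)"

definition runs_list :: "val list \<Rightarrow> exp list \<Rightarrow> val list \<Rightarrow> nat \<Rightarrow> bool" where
  "runs_list env es vs b \<longleftrightarrow> (\<exists>t\<le>b. evals N program env es vs t)"

lemma runs_mono: "runs env e v b \<Longrightarrow> b \<le> b' \<Longrightarrow> runs env e v b'"
  unfolding runs_def using order_trans by blast

lemma runs_list_Nil: "runs_list env [] [] 0"
  unfolding runs_list_def using eval_evals.Empty by blast

lemma runs_list_Cons:
  assumes "runs env e v b" "runs_list env es vs b'"
  shows "runs_list env (e # es) (v # vs) (b + b')"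
proof -
  obtain t t' where "t \<le> b" "eval N program env e v t" "t' \<le> b'" "evals N program env es vs t'"
    using assms by (auto simp: runs_def runs_list_def)
  then show ?thesis unfolding runs_list_def
    by (intro exI[of _ "t + t'"] conjI add_mono eval_evals.More)
qed

lemma runs_Prim:
  assumes "runs_list env es vs b" "prim_result N f vs v"
  shows "runs env (Prim f es) v (b + 1)"
proof -
  obtain t where "t \<le> b" "evals N program env es vs t" using assms by (auto simp: runs_list_def)
  then show ?thesis unfolding runs_def using assms(2)
    by (intro exI[of _ "t + 1"] conjI add_mono eval_evals.Prim order_refl)
qed

lemma runs_Call:
  assumes "runs vs body v b'" "g < length program" "program ! g = body" "runs_list env es vs b"
  shows "runs env (Call g es) v (b + b' + 1)"
proof -
  obtain t t' where "t \<le> b" "evals N program env es vs t" "t' \<le> b'" "eval N program vs body v t'"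
    using assms by (auto simp: runs_def runs_list_def)
  then show ?thesis unfolding runs_def using assms(2,3)
    by (intro exI[of _ "t + t' + 1"] conjI add_mono eval_evals.Call order_refl) simp_all
qed

lemma runs_CondT:
  assumes "runs env e (enc_bool c) b" "c" "runs env e1 v b1"
  shows "runs env (Cond e e1 e2) v (b + b1 + 1)"
proof -
  obtain t t1 where "t \<le> b" "eval N program env e (VReal 1) t" "t1 \<le> b1" "eval N program env e1 v t1"
    using assms by (auto simp: runs_def enc_bool_def)
  then show ?thesis unfolding runs_def
    by (intro exI[of _ "t + t1 + 1"] conjI add_mono eval_evals.CondTrue[where v = "VReal 1"] order_refl) simp_all
qed

lemma runs_CondF:
  assumes "runs env e (enc_bool c) b" "\<not> c" "runs env e2 v b2"
  shows "runs env (Cond e e1 e2) v (b + b2 + 1)"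
proof -
  obtain t t1 where "t \<le> b" "eval N program env e VNil t" "t1 \<le> b2" "eval N program env e2 v t1"
    using assms by (auto simp: runs_def enc_bool_def)
  then show ?thesis unfolding runs_def
    by (intro exI[of _ "t + t1 + 1"] conjI add_mono eval_evals.CondFalse order_refl) simp_all
qed

lemma runs_Cond_Cons:
  assumes "runs env e (enc_pts (x # xs)) b" "runs env e1 v b1"
  shows "runs env (Cond e e1 e2) v (b + b1 + 1)"
proof -
  obtain t t1 where "t \<le> b" "eval N program env e (VPair (enc_pt x) (enc_pts xs)) t" "t1 \<le> b1" "eval N program env e1 v t1"
    using assms by (auto simp: runs_def)
  then show ?thesis unfolding runs_def
    by (intro exI[of _ "t + t1 + 1"] conjI add_mono eval_evals.CondTrue[where v = "VPair (enc_pt x) (enc_pts xs)"] order_refl) simp_all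
qed

lemma runs_Cond_Nil:
  assumes "runs env e (enc_pts []) b" "runs env e2 v b2"
  shows "runs env (Cond e e1 e2) v (b + b2 + 1)"
proof -
  obtain t t1 where "t \<le> b" "eval N program env e VNil t" "t1 \<le> b2" "eval N program env e2 v t1"
    using assms by (auto simp: runs_def)
  then show ?thesis unfolding runs_def
    by (intro exI[of _ "t + t1 + 1"] conjI add_mono eval_evals.CondFalse order_refl) simp_all
qed

lemma runs_Var: "i < length env \<Longrightarrow> runs env (Var i) (env ! i) 1"
  unfolding runs_def using eval_evals.Var by blast

lemma runs_Var0: "runs (v # env) (Var 0) v 1" using runs_Var[of 0 "v # env"] by simp
lemma runs_Var1: "runs (a # v # env) (Var 1) v 1" using runs_Var[of 1 "a # v # env"] by simp
lemma runs_Var2: "runs (a # b # v # env) (Var 2) v 1" using runs_Var[of 2 "a # b # v # env"] by simp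
lemma runs_Var3: "runs (a # b # c # v # env) (Var 3) v 1" using runs_Var[of 3 "a # b # c # v # env"] by simp
lemma runs_Var4: "runs (a # b # c # d # v # env) (Var 4) v 1" using runs_Var[of 4 "a # b # c # d # v # env"] by simp

lemma runs_Lit: "runs env (Lit k) (VReal (of_int k)) 1"
  unfolding runs_def using eval_evals.Lit by blast

lemma runs_True: "runs env True' (enc_bool True) 1"
  using runs_Lit[of env 1] by (simp add: enc_bool_def)

lemma runs_prim0:
  assumes "prim_result N f [] v"
  shows "runs env (Prim f []) v 1"
  using runs_Prim[OF runs_list_Nil assms] by simp

lemma runs_prim1:
  assumes "prim_result N f [v1] v" "runs env e1 v1 b1"
  shows "runs env (Prim f [e1]) v (b1 + 1)"
  using runs_Prim[OF runs_list_Cons[OF assms(2) runs_list_Nil] assms(1)] by simp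

lemma runs_prim2:
  assumes "prim_result N f [v1, v2] v" "runs env e1 v1 b1" "runs env e2 v2 b2"
  shows "runs env (Prim f [e1, e2]) v (b1 + b2 + 1)"
  using runs_Prim[OF runs_list_Cons[OF assms(2) runs_list_Cons[OF assms(3) runs_list_Nil]] assms(1)]
  by (simp add: add.assoc)

lemma runs_prim3:
  assumes "prim_result N f [v1, v2, v3] v" "runs env e1 v1 b1" "runs env e2 v2 b2" "runs env e3 v3 b3"
  shows "runs env (Prim f [e1, e2, e3]) v (b1 + b2 + b3 + 1)"
  using runs_Prim[OF runs_list_Cons[OF assms(2) runs_list_Cons[OF assms(3) runs_list_Cons[OF assms(4) runs_list_Nil]]] assms(1)]
  by (simp add: add.assoc)

lemma runs_Nil: "runs env Nil' (enc_pts []) 1" "runs env Nil' (enc_bool False) 1"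
  using runs_prim0[OF prim_result.intros(6)] by (simp_all add: enc_bool_def)

lemmas runs_Add = runs_prim2[OF prim_result.intros(1)]
lemmas runs_Sub = runs_prim2[OF prim_result.intros(2)]
lemmas runs_Mul = runs_prim2[OF prim_result.intros(3)]
lemmas runs_Less = runs_prim2[OF prim_result.intros(5)]
lemmas runs_MkPair = runs_prim2[OF prim_result.intros(7)]
lemmas runs_NormOf = runs_prim1[OF prim_result.intros(10)]

text \<open>
  \<open>Hd\<close> and \<open>Tl\<close> are used for the coordinates of points as well as for lists. The rules differ in
  the form of the resulting value, which determines the rule to be applied.
\<close>
lemma runs_fst: "runs env e (enc_pt p) b \<Longrightarrow> runs env (Hd e) (VReal (fst p)) (b + 1)"
  using runs_prim1[OF prim_result.intros(8)] by (simp add: enc_pt_def)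

lemma runs_snd: "runs env e (enc_pt p) b \<Longrightarrow> runs env (Tl e) (VReal (snd p)) (b + 1)"
  using runs_prim1[OF prim_result.intros(9)] by (simp add: enc_pt_def)

lemma runs_hd: "runs env e (enc_pts (x # xs)) b \<Longrightarrow> runs env (Hd e) (enc_pt x) (b + 1)"
  using runs_prim1[OF prim_result.intros(8)] by simp

lemma runs_tl: "runs env e (enc_pts (x # xs)) b \<Longrightarrow> runs env (Tl e) (enc_pts xs) (b + 1)"
  using runs_prim1[OF prim_result.intros(9)] by simp

lemma runs_cons: "runs env e (enc_pt x) b \<Longrightarrow> runs env f (enc_pts xs) b' \<Longrightarrow>
    runs env (Push e f) (enc_pts (x # xs)) (b + b' + 1)"
  using runs_MkPair[of env e "enc_pt x" b f "enc_pts xs" b'] by simp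

lemma runs_Dist:
  assumes "runs env e (enc_pt p) b" "runs env f (enc_pt q) b'"
  shows "runs env (Dist e f) (VReal (N (p - q))) (2 * b + 2 * b' + 8)"
proof -
  have "runs env (Prim MkPair [Minus (Hd e) (Hd f), Minus (Tl e) (Tl f)]) (enc_pt (p - q)) (2 * b + 2 * b' + 7)"
    unfolding enc_pt_def fst_diff snd_diff
    by (rule runs_mono, (rule runs_MkPair runs_Sub runs_fst runs_snd assms)+) simp
  then show ?thesis by (rule runs_mono[OF runs_NormOf]) simp
qed

lemma runs_Ccw:
  assumes "runs env e (enc_pt p) b" "runs env f (enc_pt q) b" "runs env g (enc_pt z) b"
  shows "runs env (Ccw e f g) (VReal (ccw p q z)) (8 * b + 15)"
  unfolding ccw_def det2_def fst_diff snd_diff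
  by (rule runs_mono, (rule runs_Sub runs_Mul runs_fst runs_snd assms)+) simp

lemmas runs_basic = runs_Var0 runs_Var1 runs_Var2 runs_Var3 runs_Var4 runs_Dist runs_Ccw
  runs_True runs_Nil runs_Lit runs_Add runs_Sub runs_Mul runs_Less
  runs_fst runs_snd runs_hd runs_tl runs_cons runs_list_Nil runs_list_Cons

lemma lex_runs: "runs [enc_pt a, enc_pt b] lex_body (enc_bool (lex_less a b)) 30"
proof -
  consider "fst a < fst b" | "fst b < fst a" | "fst a = fst b" by linarith
  then show ?thesis
  proof cases
    case 1
    then have "lex_less a b = True" by (simp add: lex_less_def)
    then show ?thesis unfolding lex_body_def
      by (simp only:) (rule runs_mono, rule runs_CondT, (rule runs_basic 1)+, simp)
  next
    case 2
    then have "lex_less a b = False" "\<not> fst a < fst b" by (simp_all add: lex_less_def)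
    then show ?thesis unfolding lex_body_def
      by (simp only:) (rule runs_mono, rule runs_CondF, (rule runs_basic)+, use 2 in simp,
        rule runs_CondT, (rule runs_basic 2)+, simp)
  next
    case 3
    then have "lex_less a b = (snd a < snd b)" "\<not> fst a < fst b" "\<not> fst b < fst a" by (simp_all add: lex_less_def)
    then show ?thesis unfolding lex_body_def
      by (simp only:) (rule runs_mono, rule runs_CondF, (rule runs_basic)+, simp add: 3,
        rule runs_CondF, (rule runs_basic)+, simp add: 3, (rule runs_basic)+, simp)
  qed
qed

end

section \<open>Running times of the functions\<close>

lemma program_length: "length program = 16"
  by (simp add: program_def)

context strictly_convex_plane begin

text \<open>
  Each rule takes the value and the time from the lemma on the body of the called function,
  before the arguments are evaluated. This determines the form of the values of the arguments.
\<close>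
lemma program_call:
  "runs vs corner_body v b' \<Longrightarrow> runs_list env es vs b \<Longrightarrow> runs env (Call 1 es) v (b + b' + 1)"
  "runs vs lex_body v b' \<Longrightarrow> runs_list env es vs b \<Longrightarrow> runs env (Call 2 es) v (b + b' + 1)"
  "runs vs angle_body v b' \<Longrightarrow> runs_list env es vs b \<Longrightarrow> runs env (Call 3 es) v (b + b' + 1)"
  "runs vs extract_body v b' \<Longrightarrow> runs_list env es vs b \<Longrightarrow> runs env (Call 4 es) v (b + b' + 1)"
  "runs vs split_body v b' \<Longrightarrow> runs_list env es vs b \<Longrightarrow> runs env (Call 5 es) v (b + b' + 1)"
  "runs vs merge_body v b' \<Longrightarrow> runs_list env es vs b \<Longrightarrow> runs env (Call 6 es) v (b + b' + 1)"
  "runs vs msort_body v b' \<Longrightarrow> runs_list env es vs b \<Longrightarrow> runs env (Call 7 es) v (b + b' + 1)"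
  "runs vs scan_body v b' \<Longrightarrow> runs_list env es vs b \<Longrightarrow> runs env (Call 8 es) v (b + b' + 1)"
  "runs vs reverse_body v b' \<Longrightarrow> runs_list env es vs b \<Longrightarrow> runs env (Call 9 es) v (b + b' + 1)"
  "runs vs close_body v b' \<Longrightarrow> runs_list env es vs b \<Longrightarrow> runs env (Call 10 es) v (b + b' + 1)"
  "runs vs take_body v b' \<Longrightarrow> runs_list env es vs b \<Longrightarrow> runs env (Call 11 es) v (b + b' + 1)"
  "runs vs out_body v b' \<Longrightarrow> runs_list env es vs b \<Longrightarrow> runs env (Call 12 es) v (b + b' + 1)"
  "runs vs vertices_body v b' \<Longrightarrow> runs_list env es vs b \<Longrightarrow> runs env (Call 13 es) v (b + b' + 1)"
  "runs vs result_body v b' \<Longrightarrow> runs_list env es vs b \<Longrightarrow> runs env (Call 14 es) v (b + b' + 1)"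
  "runs vs equal_body v b' \<Longrightarrow> runs_list env es vs b \<Longrightarrow> runs env (Call 15 es) v (b + b' + 1)"
  by (rule runs_Call, assumption, simp add: program_length, simp add: program_def, assumption)+

lemma angle_runs: "runs [enc_pt a, enc_pt b, enc_pt c] angle_body (enc_bool (ang_le a b c)) 80"
proof -
  consider "0 < ccw a b c" | "ccw a b c < 0" | "ccw a b c = 0" "N (c - a) < N (b - a)"
    | "ccw a b c = 0" "\<not> N (c - a) < N (b - a)" by linarith
  then show ?thesis
  proof cases
    case 1
    then have eq: "ang_le a b c = True" by (simp add: ang_le_def)
    show ?thesis unfolding angle_body_def eq
      by (rule runs_mono, rule runs_CondT, (rule runs_basic)+, use 1 in simp, (rule runs_basic)+, simp)
  next
    case 2
    then have eq: "ang_le a b c = False" by (simp add: ang_le_def)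
    show ?thesis unfolding angle_body_def eq
      by (rule runs_mono, rule runs_CondF, (rule runs_basic)+, use 2 in simp,
          rule runs_CondT, (rule runs_basic)+, use 2 in simp, (rule runs_basic)+, simp)
  next
    case 3
    then have eq: "ang_le a b c = False" by (simp add: ang_le_def)
    show ?thesis unfolding angle_body_def eq
      by (rule runs_mono, rule runs_CondF, (rule runs_basic)+, use 3 in simp,
          rule runs_CondF, (rule runs_basic)+, use 3 in simp,
          rule runs_CondT, (rule runs_basic)+, use 3 in simp, (rule runs_basic)+, simp)
  next
    case 4
    then have eq: "ang_le a b c = True" by (simp add: ang_le_def)
    show ?thesis unfolding angle_body_def eq
      by (rule runs_mono, rule runs_CondF, (rule runs_basic)+, use 4 in simp,
          rule runs_CondF, (rule runs_basic)+, use 4 in simp,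
          rule runs_CondF, (rule runs_basic)+, use 4 in simp, (rule runs_basic)+, simp)
  qed
qed

lemma equal_runs: "runs [enc_pt a, enc_pt b] equal_body (enc_bool (a = b)) 60"
proof (cases "a = b")
  case True
  then have eq: "(a = b) = True" by simp
  show ?thesis unfolding equal_body_def eq
    by (rule runs_mono, rule runs_CondF, (rule runs_basic)+, use True in simp, (rule runs_basic)+, simp)
next
  case False
  then have eq: "(a = b) = False" and pos: "of_int 0 < N (a - b)" using N_pos[of "a - b"] by simp_all
  show ?thesis unfolding equal_body_def eq
    by (rule runs_mono, rule runs_CondT, (rule runs_basic)+, rule pos, (rule runs_basic)+, simp)
qed

lemma merge_runs: "runs [enc_pt a, enc_pts xs, enc_pts ys] merge_body
    (enc_pts (merge_by (ang_le a) xs ys)) (120 * (length xs + length ys) + 10)"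
proof (induction "length xs + length ys" arbitrary: xs ys rule: less_induct)
  case less
  consider "xs = []" | x xs' where "xs = x # xs'" "ys = []"
    | x xs' y ys' where "xs = x # xs'" "ys = y # ys'" by (metis neq_Nil_conv)
  then show ?case
  proof cases
    case 1
    show ?thesis unfolding merge_body_def 1 merge_by.simps
      by (rule runs_mono, rule runs_Cond_Nil, (rule runs_basic)+, simp)
  next
    case 2
    show ?thesis unfolding merge_body_def 2 merge_by.simps
      by (rule runs_mono, rule runs_Cond_Cons, (rule runs_basic)+, rule runs_Cond_Nil, (rule runs_basic)+, simp)
  next
    case 3
    have IH1: "runs [enc_pt a, enc_pts xs', enc_pts (y # ys')] merge_body
      (enc_pts (merge_by (ang_le a) xs' (y # ys'))) (120 * (length xs' + length (y # ys')) + 10)"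
      by (rule less.hyps) (simp add: 3)
    have IH2: "runs [enc_pt a, enc_pts (x # xs'), enc_pts ys'] merge_body
      (enc_pts (merge_by (ang_le a) (x # xs') ys')) (120 * (length (x # xs') + length ys') + 10)"
      by (rule less.hyps) (simp add: 3)
    show ?thesis
    proof (cases "ang_le a x y")
      case True
      then have eq: "merge_by (ang_le a) (x # xs') (y # ys') = x # merge_by (ang_le a) xs' (y # ys')" by simp
      show ?thesis unfolding merge_body_def 3 eq
        by (rule runs_mono, rule runs_Cond_Cons, (rule runs_basic)+, rule runs_Cond_Cons, (rule runs_basic)+,
            rule runs_CondT, rule program_call, rule angle_runs, (rule runs_basic)+, rule True,
            rule runs_cons, (rule runs_basic)+, rule program_call, rule IH1, (rule runs_basic)+, simp)
    next
      case False
      then have eq: "merge_by (ang_le a) (x # xs') (y # ys') = y # merge_by (ang_le a) (x # xs') ys'" by simp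
      show ?thesis unfolding merge_body_def 3 eq
        by (rule runs_mono, rule runs_Cond_Cons, (rule runs_basic)+, rule runs_Cond_Cons, (rule runs_basic)+,
            rule runs_CondF, rule program_call, rule angle_runs, (rule runs_basic)+, rule False,
            rule runs_cons, (rule runs_basic)+, rule program_call, rule IH2, (rule runs_basic)+, simp)
    qed
  qed
qed

text \<open>
  The sorting of the two halves enters as a hypothesis, which \<open>msort_runs\<close> provides by
  induction.
\<close>
lemma split_runs:
  assumes "deal xs as bs = (as', bs')"
    and "runs [enc_pt a, enc_pts as'] msort_body (enc_pts A) t" "runs [enc_pt a, enc_pts bs'] msort_body (enc_pts B) t'"
  shows "runs [enc_pt a, enc_pts xs, enc_pts as, enc_pts bs] split_body
    (enc_pts (merge_by (ang_le a) A B)) (20 * length xs + t + t' + 120 * (length A + length B) + 30)"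
  using assms(1)
proof (induction xs as bs rule: deal.induct)
  case (1 as bs)
  then have eq: "as' = as" "bs' = bs" by simp_all
  show ?case unfolding split_body_def
    by (rule runs_mono, rule runs_Cond_Nil, (rule runs_basic)+, rule program_call, rule merge_runs[of a A B],
        rule runs_list_Cons, (rule runs_basic)+, rule program_call, rule assms(2)[unfolded eq], (rule runs_basic)+,
        rule program_call, rule assms(3)[unfolded eq], (rule runs_basic)+, simp)
next
  case (2 x xs as bs)
  then have IH: "runs [enc_pt a, enc_pts xs, enc_pts (x # bs), enc_pts as] split_body
    (enc_pts (merge_by (ang_le a) A B)) (20 * length xs + t + t' + 120 * (length A + length B) + 30)" by simp
  show ?case unfolding split_body_def
    by (rule runs_mono, rule runs_Cond_Cons, (rule runs_basic)+, rule program_call, rule IH, (rule runs_basic)+, simp)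
qed

text \<open>
  The recursion depth is \<open>k\<close>. The summand \<open>1\<close> in the bound pays for the empty list; the two
  halves together gain one such summand, which the linear term of the current level covers.
\<close>
lemma msort_runs:
  "length xs \<le> 2 ^ k \<Longrightarrow> runs [enc_pt a, enc_pts xs] msort_body
    (enc_pts (msort_by (ang_le a) xs)) (500 * (length xs * k + length xs + 1))"
proof (induction k arbitrary: xs)
  case 0
  then consider "xs = []" | x where "xs = [x]" by (cases xs rule: list.exhaust) auto
  then show ?case
  proof cases
    case 1
    have eq: "msort_by (ang_le a) [] = []" by (subst msort_by.simps) simp
    show ?thesis unfolding msort_body_def 1 eq
      by (rule runs_mono, rule runs_Cond_Nil, (rule runs_basic)+, simp)
  next
    case 2
    have eq: "msort_by (ang_le a) [x] = [x]" by (subst msort_by.simps) simp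
    show ?thesis unfolding msort_body_def 2 eq
      by (rule runs_mono, rule runs_Cond_Cons, (rule runs_basic)+, rule runs_Cond_Nil, (rule runs_basic)+, simp)
  qed
next
  case (Suc k)
  show ?case
  proof (cases "length xs < 2")
    case True
    then have "length xs \<le> 1" by simp
    also have "1 \<le> (2::nat) ^ k" by simp
    finally have "length xs \<le> 2 ^ k" .
    then show ?thesis by (rule runs_mono[OF Suc.IH]) simp
  next
    case False
    obtain as bs where d: "deal xs [] [] = (as, bs)" by (cases "deal xs [] []")
    have len: "length as + length bs = length xs" "length as \<le> 2 ^ k" "length bs \<le> 2 ^ k"
      using deal_length[OF d] Suc.prems by auto
    obtain x y xs' where xs: "xs = x # y # xs'"
      using False by (cases xs rule: list.exhaust; cases "tl xs" rule: list.exhaust) auto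
    have eq: "msort_by (ang_le a) xs = merge_by (ang_le a) (msort_by (ang_le a) as) (msort_by (ang_le a) bs)"
      using False d by (subst msort_by.simps) simp
    have l: "length (msort_by (ang_le a) zs) = length zs" for zs
      using msort_mset[of "ang_le a" zs] by (metis size_mset)
    note S = split_runs[OF d Suc.IH[OF len(2)] Suc.IH[OF len(3)], unfolded l]
    have "runs [enc_pt a, enc_pts (x # y # xs')] msort_body
       (enc_pts (merge_by (ang_le a) (msort_by (ang_le a) as) (msort_by (ang_le a) bs)))
       (20 * length xs + 500 * (length as * k + length as + 1) + 500 * (length bs * k + length bs + 1)
         + 120 * (length as + length bs) + 60)"
      unfolding msort_body_def
      by (rule runs_mono, rule runs_Cond_Cons, (rule runs_basic)+, rule runs_Cond_Cons, (rule runs_basic)+,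
          rule program_call, rule S[unfolded xs], (rule runs_basic)+, simp add: xs)
    moreover have "20 * length xs + 500 * (length as * k + length as + 1) + 500 * (length bs * k + length bs + 1)
         + 120 * (length as + length bs) + 60 \<le> 500 * (length xs * Suc k + length xs + 1)"
    proof -
      have "length as * k + length bs * k = length xs * k" using len(1) by (metis add_mult_distrib)
      then show ?thesis using len(1) False by simp
    qed
    ultimately show ?thesis unfolding eq unfolding xs by (rule runs_mono)
  qed
qed

text \<open>
  Since the functions continue by tail calls, the time of the rest of the computation is a
  hypothesis here and in the lemmas on the later functions.
\<close>
lemma extract_runs:
  assumes "extract_min m rest ys = (m', rest')"
    and "runs [enc_pt m', enc_pts rest'] msort_body (enc_pts zs) t"
    and "runs [enc_pts [m'], enc_pts zs, VReal \<rho>] scan_body v t'"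
  shows "runs [enc_pt m, enc_pts rest, enc_pts ys, VReal \<rho>] extract_body v (80 * length ys + t + t' + 20)"
  using assms(1)
proof (induction m rest ys rule: extract_min.induct)
  case (1 m rest)
  then have eq: "m' = m" "rest' = rest" by simp_all
  show ?case unfolding extract_body_def
    by (rule runs_mono, rule runs_Cond_Nil, (rule runs_basic)+, rule program_call, rule assms(3)[unfolded eq],
        rule runs_list_Cons, rule runs_cons, (rule runs_basic)+, rule program_call, rule assms(2)[unfolded eq],
        (rule runs_basic)+, simp)
next
  case (2 m rest y ys)
  show ?case
  proof (cases "lex_less y m")
    case True
    then have IH: "runs [enc_pt y, enc_pts (m # rest), enc_pts ys, VReal \<rho>] extract_body v (80 * length ys + t + t' + 20)"
      using 2 by simp
    show ?thesis unfolding extract_body_def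
      by (rule runs_mono, rule runs_Cond_Cons, (rule runs_basic)+, rule runs_CondT, rule program_call,
          rule lex_runs, (rule runs_basic)+, rule True, rule program_call, rule IH, (rule runs_basic)+, simp)
  next
    case False
    then have IH: "runs [enc_pt m, enc_pts (y # rest), enc_pts ys, VReal \<rho>] extract_body v (80 * length ys + t + t' + 20)"
      using 2 by simp
    show ?thesis unfolding extract_body_def
      by (rule runs_mono, rule runs_Cond_Cons, (rule runs_basic)+, rule runs_CondF, rule program_call,
          rule lex_runs, (rule runs_basic)+, rule False, rule program_call, rule IH, (rule runs_basic)+, simp)
  qed
qed

lemma reverse_runs:
  assumes "runs [enc_pts (rev xs @ acc), enc_pts S, VReal (n + real (length xs)), VReal \<rho>] close_body v t"
  shows "runs [enc_pts xs, enc_pts acc, VReal n, enc_pts S, VReal \<rho>] reverse_body v (20 * length xs + t + 10)"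
  using assms
proof (induction xs arbitrary: acc n)
  case Nil
  then have *: "runs [enc_pts acc, enc_pts S, VReal n, VReal \<rho>] close_body v t" by simp
  show ?case unfolding reverse_body_def
    by (rule runs_mono, rule runs_Cond_Nil, (rule runs_basic)+, rule program_call, rule *, (rule runs_basic)+, simp)
next
  case (Cons x xs)
  have "runs [enc_pts xs, enc_pts (x # acc), VReal (n + 1), enc_pts S, VReal \<rho>] reverse_body v (20 * length xs + t + 10)"
    by (rule Cons.IH) (use Cons.prems in \<open>simp add: add.assoc\<close>)
  then have IH: "runs [enc_pts xs, enc_pts (x # acc), VReal (n + of_int 1), enc_pts S, VReal \<rho>] reverse_body v (20 * length xs + t + 10)"
    by simp
  show ?case unfolding reverse_body_def
    by (rule runs_mono, rule runs_Cond_Cons, (rule runs_basic)+, rule program_call, rule IH, (rule runs_basic)+, simp)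
qed

lemma take_runs:
  "runs [VReal (real (length L)), enc_pts (L @ F)] take_body (enc_pts L) (20 * length L + 10)"
proof (induction L)
  case Nil
  show ?case unfolding take_body_def
    by (rule runs_mono, rule runs_CondF, (rule runs_basic)+, simp, (rule runs_basic)+, simp)
next
  case (Cons x L)
  then have IH: "runs [VReal (real (length (x # L)) - of_int 1), enc_pts (L @ F)] take_body (enc_pts L) (20 * length L + 10)"
    by simp
  show ?case unfolding take_body_def append_Cons
    by (rule runs_mono, rule runs_CondT, (rule runs_basic)+, simp, rule runs_cons, (rule runs_basic)+,
        rule program_call, rule IH, (rule runs_basic)+, simp)
qed

end

context ball_plane begin

text \<open>
  The first point in the result of \<open>Meet\<close> is \<open>vtx\<close>, also when the circles touch.
\<close>
lemma left_to_right_circles: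
  assumes "p \<noteq> q" "N (q - p) \<le> 2 * r"
  shows "\<exists>zs. left_to_right (q - p) (circle N p r \<inter> circle N q r) = vtx p q # zs"
proof -
  have S: "circle N p r \<inter> circle N q r = {vtx p q, vtx q p}"
    using vtx_spec[OF assms] vtx_spec[of q p] assms common_circle_points[OF assms(1)]
    by (auto simp: circle_def N_commute[of p q])
  show ?thesis
  proof (cases "vtx p q = vtx q p")
    case True
    then have "left_to_right (q - p) (circle N p r \<inter> circle N q r) = [vtx p q]"
      unfolding S by (intro left_to_right_eqI) auto
    then show ?thesis by blast
  next
    case False
    have "ccw p q (vtx q p) < 0"
    proof (rule ccontr)
      assume "\<not> ?thesis"
      then show False
        using vtxI[of p q "vtx q p"] vtx_spec[of q p] assms False by (simp add: N_commute[of p q])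
    qed
    then have "det2 (q - p) (vtx p q) > det2 (q - p) (vtx q p)"
      using vtx_spec(3)[OF assms] by (simp add: ccw_def det2_diff_right)
    then have "left_to_right (q - p) (circle N p r \<inter> circle N q r) = [vtx p q, vtx q p]"
      unfolding S by (intro left_to_right_eqI) auto
    then show ?thesis by blast
  qed
qed

lemma runs_Vtx:
  assumes "p \<noteq> q" "N (q - p) \<le> 2 * r"
    and "runs env e (enc_pt p) b" "runs env f (enc_pt q) b'" "runs env g (VReal r) b''"
  shows "runs env (Vtx e f g) (enc_pt (vtx p q)) (b + b' + b'' + 2)"
proof -
  obtain zs where zs: "left_to_right (q - p) (circle N p r \<inter> circle N q r) = vtx p q # zs"
    using left_to_right_circles[OF assms(1,2)] by blast
  have "runs env (Prim Meet [e, f, g]) (enc_pts (vtx p q # zs)) (b + b' + b'' + 1)"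
    using runs_prim3[OF prim_result.intros(11)[OF r_pos assms(1), of N] assms(3-5)] unfolding zs .
  then show ?thesis by (rule runs_mono[OF runs_hd]) simp
qed

lemma corner_runs:
  assumes "N (k - a) \<le> 2 * r"
  shows "runs [enc_pt a, enc_pt b, enc_pt k, VReal r] corner_body (enc_bool (corner a b k)) 60"
proof (cases "0 < ccw a b k")
  case True
  then have ak: "a \<noteq> k" by (auto simp: ccw_left)
  have eq: "corner a b k = (r < N (b - vtx a k))" using True by (simp add: corner_def)
  show ?thesis unfolding corner_body_def eq
    by (rule runs_mono, rule runs_CondT, (rule runs_basic)+, use True in simp, rule runs_Less, rule runs_Var3,
        rule runs_Dist, rule runs_Var1, rule runs_Vtx[OF ak assms], (rule runs_basic)+, simp)
next
  case False
  then have eq: "corner a b k = False" by (simp add: corner_def)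
  show ?thesis unfolding corner_body_def eq
    by (rule runs_mono, rule runs_CondF, (rule runs_basic)+, use False in simp, (rule runs_basic)+, simp)
qed

text \<open>
  A step either moves a center from the input to the stack or removes one from the stack, so \<open>2
  * length ks + length S\<close> decreases. The bound on distances guarantees that all circles to be
  intersected meet.
\<close>
lemma scan_runs:
  assumes "S \<noteq> []" "\<And>p q. p \<in> set S \<union> set ks \<Longrightarrow> q \<in> set S \<union> set ks \<Longrightarrow> N (q - p) \<le> 2 * r"
    and fin: "runs [enc_pts (scan corner S ks), enc_pts [], VReal 0, enc_pts (scan corner S ks), VReal r] reverse_body v t"
  shows "runs [enc_pts S, enc_pts ks, VReal r] scan_body v (120 * (2 * length ks + length S) + t + 20)"
  using assms
proof (induction corner S ks rule: scan.induct)
  case (1 S)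
  then have *: "runs [enc_pts S, enc_pts [], VReal (of_int 0), enc_pts S, VReal r] reverse_body v t" by simp
  show ?case unfolding scan_body_def
    by (rule runs_mono, rule runs_Cond_Nil, (rule runs_basic)+, rule program_call, rule *, (rule runs_basic)+, simp)
next
  case (2 k ks)
  then show ?case by simp
next
  case (3 b k ks)
  have IH: "runs [enc_pts [k, b], enc_pts ks, VReal r] scan_body v (120 * (2 * length ks + length [k, b]) + t + 20)"
    by (rule 3(1)) (use 3 in auto)
  show ?case unfolding scan_body_def
    by (rule runs_mono, rule runs_Cond_Cons, (rule runs_basic)+, rule runs_Cond_Nil, (rule runs_basic)+,
        rule program_call, rule IH, (rule runs_basic)+, simp)
next
  case (4 b a S k ks)
  have ak: "N (k - a) \<le> 2 * r" by (rule 4(4)) simp_all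
  show ?case
  proof (cases "corner a b k")
    case True
    have IH: "runs [enc_pts (k # b # a # S), enc_pts ks, VReal r] scan_body v
        (120 * (2 * length ks + length (k # b # a # S)) + t + 20)"
    proof (rule 4(1)[OF True])
      have sub: "set (k # b # a # S) \<union> set ks \<subseteq> set (b # a # S) \<union> set (k # ks)" by auto
      show "N (q - p) \<le> 2 * r" if "p \<in> set (k # b # a # S) \<union> set ks" "q \<in> set (k # b # a # S) \<union> set ks" for p q
        by (rule 4(4)) (rule subsetD[OF sub that(1)], rule subsetD[OF sub that(2)])
    qed (use 4(5) True in simp_all)
    show ?thesis unfolding scan_body_def
      by (rule runs_mono, rule runs_Cond_Cons, (rule runs_basic)+, rule runs_Cond_Cons, (rule runs_basic)+,
          rule runs_CondT, rule program_call, rule corner_runs[OF ak], (rule runs_basic)+, rule True,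
          rule program_call, rule IH, (rule runs_basic)+, simp)
  next
    case False
    have IH: "runs [enc_pts (a # S), enc_pts (k # ks), VReal r] scan_body v
        (120 * (2 * length (k # ks) + length (a # S)) + t + 20)"
    proof (rule 4(2)[OF False])
      have sub: "set (a # S) \<union> set (k # ks) \<subseteq> set (b # a # S) \<union> set (k # ks)" by auto
      show "N (q - p) \<le> 2 * r" if "p \<in> set (a # S) \<union> set (k # ks)" "q \<in> set (a # S) \<union> set (k # ks)" for p q
        by (rule 4(4)) (rule subsetD[OF sub that(1)], rule subsetD[OF sub that(2)])
    qed (use 4(5) False in simp_all)
    show ?thesis unfolding scan_body_def
      by (rule runs_mono, rule runs_Cond_Cons, (rule runs_basic)+, rule runs_Cond_Cons, (rule runs_basic)+,
          rule runs_CondF, rule program_call, rule corner_runs[OF ak], (rule runs_basic)+, rule False,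
          rule program_call, rule IH, (rule runs_basic)+, simp)
  qed
qed

lemma close_runs:
  assumes "length L \<ge> 2" "\<And>p q. p \<in> set L \<Longrightarrow> q \<in> set L \<Longrightarrow> N (q - p) \<le> 2 * r"
    and fin: "runs [enc_pts (close_ring corner L), enc_pt (last (close_ring corner L)), VReal r] out_body v t"
  shows "runs [enc_pts (L @ F), enc_pts (rev L @ B), VReal (real (length L)), VReal r] close_body v
    (300 * length L + t + 30)"
  using assms
proof (induction "length L" arbitrary: L F B rule: less_induct)
  case less
  obtain z M where zM: "rev L = z # M" using less.prems(1) by (cases "rev L" rule: list.exhaust) auto
  then have last: "last L = z" by (metis hd_rev list.sel(1))
  have out: "runs [enc_pts (L @ F), enc_pts (rev L @ B), VReal (real (length L)), VReal r]
      (Call 12 [Call 11 [Var 2, Var 0], Hd (Var 1), Var 3]) v (20 * length L + t + 20)"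
    if "close_ring corner L = L"
  proof -
    have fin': "runs [enc_pts L, enc_pt z, VReal r] out_body v t" using less.prems(3) that last by simp
    show ?thesis unfolding zM append_Cons
      by (rule runs_mono, rule program_call, rule fin', rule runs_list_Cons, rule program_call,
          rule take_runs, (rule runs_basic)+, simp)
  qed
  show ?case
  proof (cases "length L < 3")
    case True
    then have "close_ring corner L = L" by (subst close_ring.simps) simp
    note out = out[OF this]
    show ?thesis unfolding close_body_def
      by (rule runs_mono, rule runs_CondT, (rule runs_basic)+, use True in simp, rule out, simp)
  next
    case False
    obtain x y L1 where L: "L = x # y # L1"
      using False by (cases L rule: list.exhaust; cases "tl L" rule: list.exhaust) auto
    have "length M \<ge> 2" using zM False by (metis length_rev length_Cons not_less Suc_le_mono numeral_2_eq_2 numeral_3_eq_3)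
    then obtain w M' where M: "M = w # M'" by (cases M rule: list.exhaust) auto
    have Lw: "L = rev M' @ [w, z]" using zM M by (metis append.assoc append_Cons append_Nil rev.simps(2) rev_rev_ident)
    have nth2: "L ! (length L - 2) = w" unfolding Lw by (simp add: nth_append)
    have xy: "x \<in> set L" "y \<in> set L" by (simp_all add: L)
    have zw: "z \<in> set L" "w \<in> set L" by (subst Lw, simp)+
    note mem = xy zw
    have g1: "runs [enc_pt z, enc_pt x, enc_pt y, VReal r] corner_body (enc_bool (corner z x y)) 60"
      by (rule corner_runs) (rule less.prems(2)[OF mem(3,2)])
    have g2: "runs [enc_pt w, enc_pt z, enc_pt x, VReal r] corner_body (enc_bool (corner w z x)) 60"
      by (rule corner_runs) (rule less.prems(2)[OF mem(4,1)])
    have n3: "\<not> real (length L) < of_int 3" using False by simp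
    have L': "L @ F = x # y # (L1 @ F)" "rev L @ B = z # w # (M' @ B)" using L zM M by simp_all
    show ?thesis
    proof (cases "corner z x y")
      case F1: False
      have cr: "close_ring corner L = close_ring corner (y # L1)"
        using False F1 last L by (subst close_ring.simps) simp
      have "runs [enc_pts ((y # L1) @ F), enc_pts (rev (y # L1) @ ([x] @ B)), VReal (real (length (y # L1))), VReal r]
          close_body v (300 * length (y # L1) + t + 30)"
      proof (rule less.hyps)
        show "2 \<le> length (y # L1)" using False unfolding L list.size by linarith
        show "N (q - p) \<le> 2 * r" if "p \<in> set (y # L1)" "q \<in> set (y # L1)" for p q
          by (rule less.prems(2)) (use that L in simp_all)
      qed (use L False less.prems(3) cr in simp_all)
      moreover have "rev (y # L1) @ ([x] @ B) = z # w # (M' @ B)" unfolding L'(2)[symmetric] L by simp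
      moreover have "real (length (y # L1)) = real (length L) - of_int 1" using L by simp
      moreover have "(y # L1) @ F = y # (L1 @ F)" by simp
      ultimately have IH: "runs [enc_pts (y # (L1 @ F)), enc_pts (z # w # (M' @ B)), VReal (real (length L) - of_int 1), VReal r]
          close_body v (300 * length (y # L1) + t + 30)" by (simp only:)
      show ?thesis unfolding close_body_def L'
        by (rule runs_mono, rule runs_CondF, (rule runs_basic)+, rule n3, rule runs_CondF, rule program_call,
            rule g1, (rule runs_basic)+, rule F1, rule program_call, rule IH, (rule runs_basic)+, simp add: L)
    next
      case T1: True
      show ?thesis
      proof (cases "corner w z x")
        case F2: False
        have bl: "butlast L = rev M' @ [w]" unfolding Lw by (simp add: butlast_append)
        have cr: "close_ring corner L = close_ring corner (butlast L)"
          using False T1 F2 last L nth2 by (subst close_ring.simps) simp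
        have "runs [enc_pts (butlast L @ ([z] @ F)), enc_pts (rev (butlast L) @ B), VReal (real (length (butlast L))), VReal r]
            close_body v (300 * length (butlast L) + t + 30)"
        proof (rule less.hyps)
          show "N (q - p) \<le> 2 * r" if "p \<in> set (butlast L)" "q \<in> set (butlast L)" for p q
            by (rule less.prems(2)) (use that in_set_butlastD in metis)+
        qed (use False less.prems(3) cr in simp_all)
        moreover have "butlast L @ ([z] @ F) = x # y # (L1 @ F)" unfolding L'(1)[symmetric] bl by (simp add: Lw)
        moreover have "rev (butlast L) @ B = w # (M' @ B)" unfolding bl by simp
        moreover have "real (length (butlast L)) = real (length L) - of_int 1" using False by simp
        ultimately have IH: "runs [enc_pts (x # y # (L1 @ F)), enc_pts (w # (M' @ B)), VReal (real (length L) - of_int 1), VReal r]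
            close_body v (300 * length (butlast L) + t + 30)" by (simp only:)
        show ?thesis unfolding close_body_def L'
          by (rule runs_mono, rule runs_CondF, (rule runs_basic)+, rule n3, rule runs_CondT, rule program_call,
              rule g1, (rule runs_basic)+, rule T1, rule runs_CondF, rule program_call, rule g2, (rule runs_basic)+,
              rule F2, rule program_call, rule IH, (rule runs_basic)+, use False in simp)
      next
        case T2: True
        have "close_ring corner L = L" using False T1 T2 last L nth2 by (subst close_ring.simps) simp
        note out = out[OF this, unfolded L']
        show ?thesis unfolding close_body_def L'
          by (rule runs_mono, rule runs_CondF, (rule runs_basic)+, rule n3, rule runs_CondT, rule program_call,
              rule g1, (rule runs_basic)+, rule T1, rule runs_CondT, rule program_call, rule g2, (rule runs_basic)+,
              rule T2, rule out, use False in simp)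
      qed
    qed
  qed
qed

lemma vertices_runs:
  assumes "prev \<noteq> hd L" "distinct L" "\<And>p q. p \<in> insert prev (set L) \<Longrightarrow> q \<in> insert prev (set L) \<Longrightarrow> N (q - p) \<le> 2 * r"
  shows "runs [enc_pt prev, enc_pts L, VReal r] vertices_body (enc_pts (map2 vtx (prev # butlast L) L)) (30 * length L + 10)"
  using assms
proof (induction L arbitrary: prev)
  case Nil
  have eq: "map2 vtx (prev # butlast []) [] = []" by simp
  show ?case unfolding vertices_body_def eq
    by (rule runs_mono, rule runs_Cond_Nil, (rule runs_basic)+, simp)
next
  case (Cons x L)
  have px: "prev \<noteq> x" "N (x - prev) \<le> 2 * r" using Cons.prems(1) Cons.prems(3)[of prev x] by simp_all
  have eq: "map2 vtx (prev # butlast (x # L)) (x # L) = vtx prev x # map2 vtx (x # butlast L) L"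
    by (cases L rule: list.exhaust) simp_all
  have IH: "runs [enc_pt x, enc_pts L, VReal r] vertices_body (enc_pts (map2 vtx (x # butlast L) L)) (30 * length L + 10)"
  proof (cases "L = []")
    case True
    have eq: "map2 vtx (x # butlast []) [] = []" by simp
    show ?thesis unfolding vertices_body_def True eq
      by (rule runs_mono, rule runs_Cond_Nil, (rule runs_basic)+, simp)
  next
    case False
    show ?thesis
    proof (rule Cons.IH)
      show "x \<noteq> hd L" using Cons.prems(2) False by (metis distinct.simps(2) hd_in_set)
      show "distinct L" using Cons.prems(2) by simp
      show "N (q - p) \<le> 2 * r" if "p \<in> insert x (set L)" "q \<in> insert x (set L)" for p q
        by (rule Cons.prems(3)) (use that in simp_all)
    qed
  qed
  show ?case unfolding vertices_body_def eq
    by (rule runs_mono, rule runs_Cond_Cons, rule runs_Var1, rule runs_cons, rule runs_Vtx[OF px],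
        (rule runs_basic)+, rule program_call, rule IH, (rule runs_basic)+, simp)
qed

lemma result_runs:
  assumes "length vs \<ge> 2"
  shows "runs [enc_pts L, enc_pts vs] result_body
    (case if vs ! 0 = vs ! 1 then ([], [vs ! 0]) else (L, vs) of (cs, ws) \<Rightarrow> VPair (enc_pts cs) (enc_pts ws)) 100"
proof -
  obtain a b ws where vs: "vs = a # b # ws"
    using assms by (cases vs rule: list.exhaust; cases "tl vs" rule: list.exhaust) auto
  show ?thesis
  proof (cases "a = b")
    case True
    then have eq: "(case if vs ! 0 = vs ! 1 then ([], [vs ! 0]) else (L, vs) of (cs, ws) \<Rightarrow> VPair (enc_pts cs) (enc_pts ws))
      = VPair (enc_pts []) (enc_pts [a])" by (simp add: vs)
    show ?thesis unfolding result_body_def eq unfolding vs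
      by (rule runs_mono, rule runs_CondT, rule program_call, rule equal_runs[of a b], (rule runs_basic)+, rule True,
          rule runs_MkPair, (rule runs_basic)+, simp)
  next
    case False
    then have eq: "(case if vs ! 0 = vs ! 1 then ([], [vs ! 0]) else (L, vs) of (cs, ws) \<Rightarrow> VPair (enc_pts cs) (enc_pts ws))
      = VPair (enc_pts L) (enc_pts vs)" by (simp add: vs)
    show ?thesis unfolding result_body_def eq unfolding vs
      by (rule runs_mono, rule runs_CondF, rule program_call, rule equal_runs[of a b], (rule runs_basic)+, rule False,
          rule runs_MkPair, (rule runs_basic)+, simp)
  qed
qed

lemma out_runs:
  assumes "length L \<ge> 2" "distinct L" "\<And>p q. p \<in> set L \<Longrightarrow> q \<in> set L \<Longrightarrow> N (q - p) \<le> 2 * r"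
  shows "runs [enc_pts L, enc_pt (last L), VReal r] out_body
    (case boundary_of_ring L of (cs, ws) \<Rightarrow> VPair (enc_pts cs) (enc_pts ws)) (30 * length L + 130)"
proof -
  have L0: "L \<noteq> []" using assms(1) by auto
  have ne: "last L \<noteq> hd L"
  proof
    assume "last L = hd L"
    then have "L ! (length L - 1) = L ! 0" using L0 by (simp add: last_conv_nth hd_conv_nth)
    then have "length L - 1 = 0"
      using nth_eq_iff_index_eq[OF assms(2), of "length L - 1" 0] L0 by simp
    then show False using assms(1) by simp
  qed
  have ins: "insert (last L) (set L) = set L" using L0 by auto
  have V: "runs [enc_pt (last L), enc_pts L, VReal r] vertices_body (enc_pts (ring_vertices L)) (30 * length L + 10)"
    unfolding ring_vertices_def
    by (rule vertices_runs[OF ne assms(2)]) (use assms(3) in \<open>simp only: ins\<close>)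
  have len: "length (ring_vertices L) \<ge> 2" using assms(1) by (simp add: ring_vertices_def)
  show ?thesis unfolding out_body_def boundary_of_ring_def Let_def
    by (rule runs_mono, rule program_call, rule result_runs[OF len], rule runs_list_Cons, (rule runs_basic)+,
        rule program_call, rule V, (rule runs_basic)+, simp)
qed

end

section \<open>Correctness and running time of the program\<close>

lemma extract_min_correct:
  assumes "extract_min m rest ys = (m', rest')"
    and "\<forall>x\<in>set rest. lexpos (x - m)" "distinct (m # rest @ ys)"
  shows "(\<forall>x\<in>set rest'. lexpos (x - m')) \<and> mset (m' # rest') = mset (m # rest @ ys)"
  using assms
proof (induction m rest ys rule: extract_min.induct)
  case (1 m rest)
  then show ?case by auto
next
  case (2 m rest y ys)
  show ?case
  proof (cases "lex_less y m")
    case True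
    have my: "lexpos (m - y)" using True by (auto simp: lex_less_def lexpos_def)
    have "lexpos (x - y)" if "x \<in> set rest" for x
    proof -
      have "lexpos (x - m)" using 2(4) that by simp
      then show ?thesis using my by (auto simp: lexpos_def)
    qed
    then have "(\<forall>x\<in>set rest'. lexpos (x - m')) \<and> mset (m' # rest') = mset (y # (m # rest) @ ys)"
      using 2(1)[OF True] 2(3,5) True my by auto
    then show ?thesis by (simp add: add_mset_commute)
  next
    case False
    have "y \<noteq> m" using 2(5) by auto
    then have "lexpos (y - m)" using False by (auto simp: lex_less_def lexpos_def prod_eq_iff)
    then have "(\<forall>x\<in>set rest'. lexpos (x - m')) \<and> mset (m' # rest') = mset (m # (y # rest) @ ys)"
      using 2(2)[OF False] 2(3,4,5) False by auto
    then show ?thesis by simp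
  qed
qed

definition levels :: "nat \<Rightarrow> nat" where "levels n = nat \<lceil>log 2 (real n)\<rceil>"

lemma le_two_power_levels: "n \<le> 2 ^ levels n"
proof (cases "n = 0")
  case False
  have "real n = 2 powr log 2 (real n)" using False by simp
  also have "\<dots> \<le> 2 powr real (levels n)"
    unfolding levels_def by (intro powr_mono) (auto intro: order_trans[OF le_of_int_ceiling])
  also have "\<dots> = real (2 ^ levels n)" by (simp add: powr_realpow)
  finally show ?thesis by linarith
qed simp

definition time_bound :: "nat \<Rightarrow> nat" where
  "time_bound n = 2000 * (n * levels n) + 2000 * n + 2000"

lemma time_bound_bigo: "(\<lambda>n. real (time_bound n)) \<in> O(\<lambda>n. real n * ln (real n))"
proof (rule bigoI)
  show "\<forall>\<^sub>F n in sequentially. norm (real (time_bound n)) \<le> (2000 / ln 2 + 6000) * norm (real n * ln (real n))"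
  proof (rule eventually_sequentiallyI)
    fix n :: nat assume n: "n \<ge> 3"
    have "exp (1::real) \<le> 3" using exp_le by simp
    then have "exp 1 \<le> real n" using n by linarith
    then have ln1: "ln (real n) \<ge> 1" using n by (metis exp_gt_zero ln_exp ln_mono)
    have "log 2 (real n) \<ge> 0" using n by simp
    then have "real (levels n) \<le> log 2 (real n) + 1" unfolding levels_def by linarith
    also have "\<dots> \<le> ln (real n) / ln 2 + ln (real n)" using ln1 by (simp add: log_def)
    finally have "real n * real (levels n) \<le> real n * (ln (real n) / ln 2 + ln (real n))"
      by (intro mult_left_mono) auto
    moreover have "real n \<le> real n * ln (real n)" using ln1 n by simp
    moreover have "1 \<le> real n * ln (real n)" using \<open>real n \<le> real n * ln (real n)\<close> n by linarith
    ultimately have "real (time_bound n) \<le> 2000 * (real n * (ln (real n) / ln 2 + ln (real n)))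
        + 2000 * (real n * ln (real n)) + 2000 * (real n * ln (real n))"
      unfolding time_bound_def of_nat_add of_nat_mult by simp
    also have "\<dots> = (2000 / ln 2 + 6000) * (real n * ln (real n))" by (simp add: algebra_simps)
    finally show "norm (real (time_bound n)) \<le> (2000 / ln 2 + 6000) * norm (real n * ln (real n))"
      using ln1 by simp
  qed
qed

context strictly_convex_plane begin

lemma main_runs_single:
  "runs [enc_pts [x], VReal \<rho>] main_body (VPair (enc_pts [x]) (enc_pts [])) 100"
  unfolding main_body_def
  by (rule runs_mono, rule runs_Cond_Nil, rule runs_tl, rule runs_Var0, rule runs_MkPair, (rule runs_basic)+, simp)

text \<open>
  For a single center the radius 0 is possible, and the circle is then a point.
\<close>
lemma single_boundary:
  assumes "\<rho> \<ge> 0"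
  shows "describes_boundary N {x} \<rho> [x] []"
proof -
  have "frontier (bi N {x} \<rho>) = circle N x \<rho>"
  proof (cases "\<rho> = 0")
    case True
    have "N (y - x) \<le> 0 \<longleftrightarrow> N (y - x) = 0" for y
      using N_nonneg[of "y - x"] by linarith
    then have "bi N {x} \<rho> = {x}" "circle N x \<rho> = {x}"
      using True by (simp_all add: bi_def disc_def circle_def)
    then show ?thesis by (simp add: frontier_def)
  next
    case False
    then interpret ball_plane N \<rho> by unfold_locales (use assms in simp)
    show ?thesis
      using frontier_bi[of "{x}"] by (auto simp: bi_def disc_def circle_def)
  qed
  then show ?thesis unfolding describes_boundary_def by blast
qed

end

context ball_plane begin

lemma main_correct:
  assumes K: "set xs = K" "distinct xs" "length xs \<ge> 2" and ne: "bi N K r \<noteq> {}"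
  shows "\<exists>cs vs. runs [enc_pts xs, VReal r] main_body (VPair (enc_pts cs) (enc_pts vs)) (time_bound (length xs))
    \<and> describes_boundary N K r cs vs"
proof -
  obtain x y ys where xs: "xs = x # y # ys"
    using K(3) by (cases xs rule: list.exhaust; cases "tl xs" rule: list.exhaust) auto
  obtain m rest where ex: "extract_min x [] (y # ys) = (m, rest)" by (cases "extract_min x [] (y # ys)")
  have lex: "\<forall>z\<in>set rest. lexpos (z - m)" and ms: "mset (m # rest) = mset xs"
    using extract_min_correct[OF ex] K(2) xs by auto
  have sK: "set (m # rest) = K" using ms K(1) by (metis set_mset_mset)
  have len: "length rest + 1 = length xs" using arg_cong[OF ms, of size] by simp
  define zs where "zs = msort_by (ang_le m) rest"
  have ms_zs: "mset zs = mset rest" by (simp add: zs_def msort_mset)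
  then have set_zs: "set zs = set rest" and len_zs: "length zs = length rest"
    by (metis set_mset_mset, metis size_mset)
  have sorted: "sorted_wrt (ang_le m) zs"
    unfolding zs_def
  proof (rule msort_sorted[where A = "set rest"])
    show "ang_le m a c" if "a \<in> set rest" "b \<in> set rest" "c \<in> set rest" "ang_le m a b" "ang_le m b c" for a b c
      using ang_le_trans[of a m b c] lex that by blast
  qed (use ang_le_total in blast)+
  obtain p where p: "\<And>z. z \<in> K \<Longrightarrow> N (p - z) \<le> r" using ne unfolding bi_def disc_def by blast
  have dist: "N (b - a) \<le> 2 * r" if "a \<in> K" "b \<in> K" for a b
    using dist_le_2r[of p a b] p that by blast
  define S where "S = scan corner [m] zs"
  have ch0: "chain m (rev [m])" by (simp add: chain_def convex_list_def corner_list_def)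
  have lex_zs: "\<forall>k\<in>set zs. lexpos (k - m)" using lex set_zs by simp
  have S: "chain m (rev S)" "bi N (set S) r = bi N (set [m] \<union> set zs) r" "set S \<subseteq> set [m] \<union> set zs"
    "zs \<noteq> [] \<longrightarrow> length S \<ge> 2"
    using scan_correct[OF ch0 lex_zs sorted] unfolding S_def by simp_all
  have mzs: "set [m] \<union> set zs = K" using sK set_zs by simp
  have "length zs > 0" using len len_zs K(3) by linarith
  then have S2: "length S \<ge> 2" using S(4) by simp
  define L where "L = close_ring corner (rev S)"
  have dS: "distinct (rev S)"
  proof (cases "length S \<ge> 3")
    case True
    then show ?thesis using convex_list_distinct[of "rev S"] S(1) by (simp add: chain_def)
  next
    case False
    then have "length (rev S) = 2" using S2 by simp
    then obtain a b where ab: "rev S = [a, b]" by (metis length_0_conv length_Suc_conv numeral_2_eq_2)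
    then have "lexpos (b - a)" using S(1) by (auto simp: chain_def)
    then have "b \<noteq> a" by (rule lexpos_neq)
    then show ?thesis unfolding ab by simp
  qed
  have conv: "convex_list (rev S)" and loc: "corner_list (rev S)" using S(1) by (simp_all add: chain_def)
  have "length (rev S) \<ge> 2" using S2 by simp
  note cl = close_ring_correct[OF conv loc this, folded L_def]
  have LK: "set L \<subseteq> K" using cl S(3) mzs by auto
  have biL: "bi N K r = bi N (set L) r" using cl S(2) mzs by simp
  have dL: "distinct L" and L2: "length L \<ge> 2" using cl dS by blast+
  obtain cs vs where b: "boundary_of_ring L = (cs, vs)" by (cases "boundary_of_ring L")
  have desc: "describes_boundary N K r cs vs"
  proof -
    have "case boundary_of_ring L of (cs, vs) \<Rightarrow> describes_boundary N K r cs vs"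
      by (rule boundary_of_ring_correct) (use cl dL LK biL ne in simp_all)
    then show ?thesis by (simp add: b)
  qed
  have cK: "card K = length xs" using distinct_card[OF K(2)] K(1) by simp
  have finK: "finite K" using K(1) by auto
  have "card (set S) \<le> card K" "card (set L) \<le> card K"
    using S(3) mzs LK finK by (simp_all add: card_mono)
  moreover have "card (set S) = length S" "card (set L) = length L"
    using distinct_card[of S] distinct_card[OF dL] dS by simp_all
  ultimately have lenS: "length S \<le> length xs" and lenL: "length L \<le> length xs"
    using cK by simp_all
  have SK: "set (rev S) \<subseteq> K" using S(3) mzs by simp
  have R1: "runs [enc_pts L, enc_pt (last L), VReal r] out_body (VPair (enc_pts cs) (enc_pts vs)) (30 * length L + 130)"
  proof -
    have "N (q - p) \<le> 2 * r" if "p \<in> set L" "q \<in> set L" for p q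
      by (rule dist) (rule subsetD[OF LK that(1)], rule subsetD[OF LK that(2)])
    from out_runs[OF L2 dL this] show ?thesis by (simp add: b)
  qed
  have R2: "runs [enc_pts (rev S @ []), enc_pts (rev (rev S) @ []), VReal (real (length (rev S))), VReal r] close_body
      (VPair (enc_pts cs) (enc_pts vs)) (300 * length (rev S) + (30 * length L + 130) + 30)"
  proof (rule close_runs)
    show "N (q - p) \<le> 2 * r" if "p \<in> set (rev S)" "q \<in> set (rev S)" for p q
      by (rule dist) (rule subsetD[OF SK that(1)], rule subsetD[OF SK that(2)])
    show "2 \<le> length (rev S)" using S2 by simp
    show "runs [enc_pts (close_ring corner (rev S)), enc_pt (last (close_ring corner (rev S))), VReal r] out_body
        (VPair (enc_pts cs) (enc_pts vs)) (30 * length L + 130)" using R1 unfolding L_def .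
  qed
  have R2': "runs [enc_pts (rev S @ []), enc_pts S, VReal (0 + real (length S)), VReal r] close_body
      (VPair (enc_pts cs) (enc_pts vs)) (300 * length S + (30 * length L + 130) + 30)"
    using R2 unfolding rev_rev_ident length_rev append_Nil2 add_0 .
  note R3 = reverse_runs[OF R2']
  have R4: "runs [enc_pts [m], enc_pts zs, VReal r] scan_body (VPair (enc_pts cs) (enc_pts vs))
     (120 * (2 * length zs + length [m]) + (20 * length S + (300 * length S + (30 * length L + 130) + 30) + 10) + 20)"
  proof (rule scan_runs)
    show "N (q - p) \<le> 2 * r" if "p \<in> set [m] \<union> set zs" "q \<in> set [m] \<union> set zs" for p q
      using dist that unfolding mzs by blast
    show "runs [enc_pts (scan corner [m] zs), enc_pts [], VReal 0, enc_pts (scan corner [m] zs), VReal r] reverse_body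
        (VPair (enc_pts cs) (enc_pts vs)) (20 * length S + (300 * length S + (30 * length L + 130) + 30) + 10)"
      using R3 unfolding S_def .
  qed simp
  have "length rest \<le> 2 ^ levels (length xs)"
    using le_two_power_levels[of "length xs"] len by linarith
  note R5 = msort_runs[OF this, of m, folded zs_def]
  note R6 = extract_runs[OF ex R5 R4]
  have R7: "runs [enc_pts (x # y # ys), VReal r] main_body (VPair (enc_pts cs) (enc_pts vs))
     (80 * length (y # ys) + 500 * (length rest * levels (length xs) + length rest + 1) +
     (120 * (2 * length zs + length [m]) + (20 * length S + (300 * length S + (30 * length L + 130) + 30) + 10) + 20) + 60)"
    unfolding main_body_def
    by (rule runs_mono, rule runs_Cond_Cons, rule runs_tl, rule runs_Var0, rule program_call, rule R6,
        (rule runs_basic)+, simp)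
  have arith: "80 * a + 500 * (p + b + 1) + (120 * (2 * c + d) + (20 * e + (300 * e + (30 * f + 130) + 30) + 10) + 20) + 60
      \<le> 2000 * q + 2000 * n + 2000"
    if "p \<le> q" "a \<le> n" "b + 1 = n" "c = b" "e \<le> n" "f \<le> n" "d = 1" for a b c d e f n p q :: nat
    using that by simp
  have bound: "80 * length (y # ys) + 500 * (length rest * levels (length xs) + length rest + 1) +
     (120 * (2 * length zs + length [m]) + (20 * length S + (300 * length S + (30 * length L + 130) + 30) + 10) + 20) + 60
     \<le> time_bound (length xs)"
    unfolding time_bound_def
  proof (rule arith)
    show "length rest * levels (length xs) \<le> length xs * levels (length xs)"
      using len by (intro mult_right_mono) linarith+
  qed (use xs len len_zs lenS lenL in simp_all)
  have "runs [enc_pts xs, VReal r] main_body (VPair (enc_pts cs) (enc_pts vs)) (time_bound (length xs))"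
    using runs_mono[OF R7 bound] unfolding xs .
  then show ?thesis using desc by blast
qed

end

theorem theorem3:
  fixes N :: "real \<times> real \<Rightarrow> real"
  assumes "is_norm N" and "strictly_convex N"
  shows "\<exists>(P :: exp list) (T :: nat \<Rightarrow> nat).
    (\<lambda>n. real (T n)) \<in> O(\<lambda>n. real n * ln (real n)) \<and>
    (\<forall>(K :: (real \<times> real) set) (xs :: (real \<times> real) list) (lam :: real).
       finite K \<and> K \<noteq> {} \<and> distinct xs \<and> set xs = K \<and> circumradius N K \<le> lam \<longrightarrow>
       (\<exists>cs vs t.
          computes N P [enc_pts xs, VReal lam] (VPair (enc_pts cs) (enc_pts vs)) t \<and>
          t \<le> T (card K) \<and>
          describes_boundary N K lam cs vs))"
proof (rule exI[of _ program], rule exI[of _ time_bound], intro conjI allI impI)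
  show "(\<lambda>n. real (time_bound n)) \<in> O(\<lambda>n. real n * ln (real n))" by (rule time_bound_bigo)
next
  fix K :: "(real \<times> real) set" and xs :: "(real \<times> real) list" and lam :: real
  assume *: "finite K \<and> K \<noteq> {} \<and> distinct xs \<and> set xs = K \<and> circumradius N K \<le> lam"
  interpret strictly_convex_plane N by unfold_locales (rule assms)+
  have main: "program \<noteq> []" "program ! 0 = main_body" by (simp_all add: program_def)
  have ne: "bi N K lam \<noteq> {}" using bi_nonempty[of K lam] * by simp
  have card: "card K = length xs" using * distinct_card[of xs] by simp
  have "\<exists>cs vs. runs [enc_pts xs, VReal lam] main_body (VPair (enc_pts cs) (enc_pts vs)) (time_bound (length xs))
    \<and> describes_boundary N K lam cs vs"
  proof (cases "length xs \<ge> 2")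
    case True
    have "lam > 0"
    proof -
      obtain a b where ab: "a \<in> K" "b \<in> K" "a \<noteq> b"
      proof -
        have "\<not> card K \<le> Suc 0" using True card by simp
        then show ?thesis using card_le_Suc0_iff_eq[of K] * that by blast
      qed
      obtain p where p: "p \<in> bi N K lam" using ne by blast
      have "N (p - a) \<le> lam" "N (p - b) \<le> lam" using p ab by (simp_all add: bi_iff)
      then have "N (b - a) \<le> 2 * lam"
        using N_triangle[of "p - a" "b - p"] N_commute[of p b] by simp
      moreover have "N (b - a) > 0" using ab by (intro N_pos) simp
      ultimately show ?thesis by linarith
    qed
    then interpret ball_plane N lam by unfold_locales
    show ?thesis using main_correct[of xs K] * True ne by simp
  next
    case False
    moreover have "length xs \<noteq> 0" using * by auto
    ultimately have "length xs = 1" by linarith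
    then obtain x where x: "xs = [x]" by (metis One_nat_def length_0_conv length_Suc_conv)
    obtain p where "p \<in> bi N K lam" using ne by blast
    then have "N (p - x) \<le> lam" using * x unfolding bi_iff by force
    then have "lam \<ge> 0" using N_nonneg[of "p - x"] by linarith
    moreover have "K = {x}" using * x by simp
    moreover have "100 \<le> time_bound (length xs)" by (simp add: time_bound_def)
    ultimately show ?thesis
      using runs_mono[OF main_runs_single[of x lam]] single_boundary[of lam x] unfolding x by blast
  qed
  then obtain cs vs where cv: "runs [enc_pts xs, VReal lam] main_body (VPair (enc_pts cs) (enc_pts vs)) (time_bound (length xs))"
    "describes_boundary N K lam cs vs" by blast
  then obtain t where "t \<le> time_bound (length xs)"
    "eval N program [enc_pts xs, VReal lam] main_body (VPair (enc_pts cs) (enc_pts vs)) t"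
    unfolding runs_def by blast
  then show "\<exists>cs vs t. computes N program [enc_pts xs, VReal lam] (VPair (enc_pts cs) (enc_pts vs)) t \<and>
      t \<le> time_bound (card K) \<and> describes_boundary N K lam cs vs"
    unfolding computes_def card using main cv(2) by auto
qed

end
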